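(* Let $k\in\{1,\dots,d-1\}$ and $\alpha<k$. (i) Suppose $(\mu_n)\in\mathcal{SM}$ is a subdivision martingale on $\mathbb{R}^d$ whose cells $\mathcal{F}=\bigcup_n\mathcal{F}_n$ satisfy the non-flatness condition: there are $0<\gamma_0,C<\infty$ such that for all $V\in\mathbb{A}_{d,k}$, $\varepsilon>0$ and isometries $f$ $\varepsilon$-close to the identity, $\mathcal{H}^k(V\cap\Lambda\setminus f(\Lambda))\le C\varepsilon^{\gamma_0}$ for all $\Lambda\in\mathcal{F}$; and suppose for some constants $C_1,C_2>0$, $C_1\mu_n(x)\le2^{\alpha n}\mathbf{1}_{A_n}(x)\le C_2\mu_n(x)$ for all $n,x$. Then there is a finite random variable $K$ such that $\mathcal{H}^k(A(2^{-n})\cap V)\le K2^{-\alpha n}$ for all $V\in\mathbb{A}_{d,k}$ and all $n$. (ii) Suppose $(\mu_n)$ is a Poissonian cutout martingale with parameter $\alpha<k$, admitting a regular inner approximation $(\Lambda_\varrho)$ such that for every sufficiently small $\varrho>0$, the non-flatness condition above (with constants $C,\gamma_0$ possibly depending on $\varrho$) holds for the initial domain $\Omega$ and for the sets $\Lambda_\varrho$ for $\mathbf{Q}_0$-almost all $\Lambda$. Then for each $\varepsilon>0$ there is a finite random variable $K$ such that $\mathcal{H}^k(A(2^{-n})\cap V)\le K2^{(\varepsilon-\alpha)n}$ for all $V\in\mathbb{A}_{d,k}$ and all $n$. In particular, in either case almost surely $\overline{\dim}_B(V\cap A)\le k-\alpha$ for all $V\in\mathbb{A}_{d,k}$.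
   Context: Subdivision martingales ($\mathcal{SM}$): let $F_0\subset\mathbb{R}^d$ be a bounded Borel seed, $\mathcal{F}_n$ an increasing sequence of finite atomic $\sigma$-algebras on $F_0$ with Borel atoms (identified with their atoms), $\mathcal{F}_0=\{F_0,\varnothing\}$. Random variables $\{W_F\}_{F\in\bigcup\mathcal{F}_n}$ satisfy, for some $C\ge1$: (SD1) the law of $(W_F)_{F\in\mathcal{F}_{n+1}}$ is measurable w.r.t. $\mathcal{B}_n=\sigma(W_F:F\in\mathcal{F}_j,j\le n)$; (SD2) $W_F\in[0,C]$; (SD3) $\mathbb{E}(W_F\mid\mathcal{B}_n)=1$ for $F\in\mathcal{F}_{n+1}$; (SD4) if $F_j\in\mathcal{F}_{n+1}$ are subsets of pairwise disjoint cells of $\mathcal{F}_n$, the $W_{F_j}$ are conditionally independent given $\mathcal{B}_n$; (SD5) each $F\in\mathcal{F}_n$ contains a ball $B$ with $C^{-1}2^{-n}\le\operatorname{diam}B\le\operatorname{diam}F\le C2^{-n}$. Then $\mu_0=\mathbf{1}[F_0]$, $\mu_{n+1}(x)=W_F\mu_n(x)$ for $x\in F\in\mathcal{F}_{n+1}$. In (i), $A_n=\{\mu_n\neq0\}$. Poissonian cutout martingales: $\mathcal{X}$ = compact subsets of $\mathbb{R}^d$; $\mathbf{Q}_0$ is a finite measure on sets in $\mathcal{X}$ of unit diameter, $\mathbf{Q}$ is the push-forward of $\mathcal{L}^d\times\frac{ds}{s}\times\mathbf{Q}_0$ under $(t,s,\Lambda)\mapsto s(\Lambda+t)$, assumed to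 satisfy $\mathcal{L}^d(\partial\Lambda)=0$ for $\mathbf{Q}$-a.e. $\Lambda$. $\mathcal{Y}$ is a Poisson point process with intensity $\mathbf{Q}$, $\Omega$ a bounded initial domain, $\alpha$ defined by $2^{-\alpha}=\mathbb{P}(0\notin$ union of sets in $\mathcal{Y}$ of diameter in $[1/2,1))$, $A_n=\Omega\setminus\bigcup\{\Lambda\in\mathcal{Y}:2^{-n}\le\operatorname{diam}\Lambda<1\}$, $\mu_n=2^{\alpha n}\mathbf{1}_{A_n}$. In both cases $A=\overline{\bigcap_nA_n}$ and $A(r)$ is its open $r$-neighbourhood. For $\Lambda\in\mathcal{X}$, $\Lambda^\kappa=\{x\in\Lambda:d(x,\partial\Lambda)\ge\kappa\operatorname{diam}\Lambda\}$. A regular inner approximation is a family of Borel maps $\Lambda\mapsto\Lambda_\varrho$ on $\operatorname{supp}\mathbf{Q}_0$, $0<\varrho<1$, such that for each $\varrho$ and $\mathbf{Q}_0$-a.e. $\Lambda$: there is $\beta=\beta(\varrho)>0$ with $\Lambda_\varrho\subset\Lambda^\beta$, and $\mathcal{L}^d(\Lambda_\varrho)\ge(1-\varrho)\mathcal{L}^d(\Lambda)$. $\mathbb{A}_{d,k}$ is the space of affine $k$-planes; isometries $f(x)=gx+z$ are at distance $\|g-\mathrm{I}\|+|z|$ from the identity. *)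

theory Defs
  imports "HOL-Analysis.Analysis" "HOL-Probability.Probability"
begin

definition hausdorff_measure :: "nat \<Rightarrow> 'a::euclidean_space set \<Rightarrow> ennreal" where
  "hausdorff_measure k E =
     (SUP \<delta>\<in>{0<..}. INF U\<in>{U::nat \<Rightarrow> 'a set. E \<subseteq> (\<Union>i. U i) \<and>
                                  (\<forall>i. bounded (U i) \<and> diameter (U i) \<le> \<delta>)}.
        (\<Sum>i. ennreal (unit_ball_vol (real k) / 2 ^ k * diameter (U i) ^ k)))"

definition affine_planes :: "nat \<Rightarrow> 'a::euclidean_space set set" where
  "affine_planes k = {V. affine V \<and> V \<noteq> {} \<and> aff_dim V = int k}"

text \<open>Non-flatness bound with constants gamma and C for a single set.
  The isometry is x |-> g x + z with g orthogonal; its distance from the identity is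
  the operator norm of g - I plus |z|.\<close>
definition nf_bound :: "nat \<Rightarrow> real \<Rightarrow> real \<Rightarrow> 'a::euclidean_space set \<Rightarrow> bool" where
  "nf_bound k \<gamma> C \<Lambda> \<longleftrightarrow>
     (\<forall>V\<in>affine_planes k. \<forall>\<epsilon>>0. \<forall>g z. orthogonal_transformation g \<and>
         onorm (\<lambda>x. g x - x) + norm z \<le> \<epsilon> \<longrightarrow>
         hausdorff_measure k (V \<inter> \<Lambda> - (\<lambda>x. g x + z) ` \<Lambda>) \<le> ennreal (C * \<epsilon> powr \<gamma>))"

definition non_flat :: "nat \<Rightarrow> 'a::euclidean_space set set \<Rightarrow> bool" where
  "non_flat k \<F> \<longleftrightarrow> (\<exists>\<gamma>0>0. \<exists>C>0. \<forall>\<Lambda>\<in>\<F>. nf_bound k \<gamma>0 C \<Lambda>)"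

definition open_nbhd :: "'a::metric_space set \<Rightarrow> real \<Rightarrow> 'a set" where
  "open_nbhd A r = {x. \<exists>a\<in>A. dist x a < r}"

definition cover_number :: "'a::metric_space set \<Rightarrow> real \<Rightarrow> nat" where
  "cover_number E r = Inf {card C | C. finite C \<and> E \<subseteq> (\<Union>c\<in>C. cball c r)}"

definition upper_box_dim :: "'a::metric_space set \<Rightarrow> ereal" where
  "upper_box_dim E = (if E = {} then - \<infinity> else
      Limsup (at_right 0) (\<lambda>r. ereal (ln (real (cover_number E r)) / - ln r)))"

definition inner_core :: "real \<Rightarrow> 'a::euclidean_space set \<Rightarrow> 'a set" where
  "inner_core \<kappa> \<Lambda> = {x\<in>\<Lambda>. infdist x (frontier \<Lambda>) \<ge> \<kappa> * diameter \<Lambda>}"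

definition cell :: "(nat \<Rightarrow> 'a set set) \<Rightarrow> nat \<Rightarrow> 'a \<Rightarrow> 'a set" where
  "cell \<F> n x = (THE F. F \<in> \<F> n \<and> x \<in> F)"

primrec sm_mu :: "(nat \<Rightarrow> 'a set set) \<Rightarrow> 'a set \<Rightarrow> (nat \<Rightarrow> 'a set \<Rightarrow> 'w \<Rightarrow> real)
                    \<Rightarrow> nat \<Rightarrow> 'w \<Rightarrow> 'a \<Rightarrow> real" where
  "sm_mu \<F> F0 W 0 \<omega> x = indicator F0 x"
| "sm_mu \<F> F0 W (Suc n) \<omega> x =
     (if x \<in> F0 then W (Suc n) (cell \<F> (Suc n) x) \<omega> else 0) * sm_mu \<F> F0 W n \<omega> x"

definition sm_filtr :: "'w measure \<Rightarrow> (nat \<Rightarrow> 'a set set) \<Rightarrow> (nat \<Rightarrow> 'a set \<Rightarrow> 'w \<Rightarrow> real)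
                         \<Rightarrow> nat \<Rightarrow> 'w measure" where
  "sm_filtr M \<F> W n = sigma (space M)
      (\<Union>j\<in>{..n}. \<Union>F\<in>\<F> j. {W j F -` A \<inter> space M | A. A \<in> sets (borel :: real measure)})"

definition cond_indep :: "'w measure \<Rightarrow> 'w measure \<Rightarrow> ('i \<Rightarrow> 'w \<Rightarrow> real) \<Rightarrow> 'i set \<Rightarrow> bool" where
  "cond_indep M G X J \<longleftrightarrow>
     (\<forall>S :: 'i \<Rightarrow> real set. (\<forall>j\<in>J. S j \<in> sets borel) \<longrightarrow>
        (AE \<omega> in M. real_cond_exp M G
              (indicator ((\<Inter>j\<in>J. X j -` S j) \<inter> space M) :: 'w \<Rightarrow> real) \<omega>
           = (\<Prod>j\<in>J. real_cond_exp M G (indicator (X j -` S j \<inter> space M) :: 'w \<Rightarrow> real) \<omega>)))"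

definition subdivision_martingale ::
  "'w measure \<Rightarrow> 'a::euclidean_space set \<Rightarrow> (nat \<Rightarrow> 'a set set)
     \<Rightarrow> (nat \<Rightarrow> 'a set \<Rightarrow> 'w \<Rightarrow> real) \<Rightarrow> real \<Rightarrow> bool" where
  "subdivision_martingale M F0 \<F> W C \<longleftrightarrow>
     prob_space M \<and> C \<ge> 1 \<and> F0 \<in> sets borel \<and> bounded F0 \<and>
     \<F> 0 = {F0} \<and>
     (\<forall>n. finite (\<F> n) \<and> (\<forall>F\<in>\<F> n. F \<in> sets borel \<and> F \<noteq> {}) \<and>
          \<Union>(\<F> n) = F0 \<and> disjoint (\<F> n)) \<and>
     (\<forall>n. \<forall>F\<in>\<F> (Suc n). \<exists>P\<in>\<F> n. F \<subseteq> P) \<and>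
     (\<forall>n. \<forall>F\<in>\<F> n. W n F \<in> borel_measurable M) \<and>
     \<comment> \<open>(SD1)\<close>
     (\<forall>n. \<exists>K. K \<in> sm_filtr M \<F> W n \<rightarrow>\<^sub>M prob_algebra (PiM (\<F> (Suc n)) (\<lambda>_. borel :: real measure)) \<and>
          (\<forall>S\<in>sets (PiM (\<F> (Suc n)) (\<lambda>_. borel :: real measure)). \<forall>B\<in>sets (sm_filtr M \<F> W n).
             measure M ({\<omega>\<in>space M. (\<lambda>F\<in>\<F> (Suc n). W (Suc n) F \<omega>) \<in> S} \<inter> B)
               = (LINT \<omega>:B|M. measure (K \<omega>) S))) \<and>
     \<comment> \<open>(SD2)\<close>
     (\<forall>n. \<forall>F\<in>\<F> n. \<forall>\<omega>\<in>space M. 0 \<le> W n F \<omega> \<and> W n F \<omega> \<le> C) \<and>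
     \<comment> \<open>(SD3)\<close>
     (\<forall>n. \<forall>F\<in>\<F> (Suc n). AE \<omega> in M. real_cond_exp M (sm_filtr M \<F> W n) (W (Suc n) F) \<omega> = 1) \<and>
     \<comment> \<open>(SD4)\<close>
     (\<forall>n J. J \<subseteq> \<F> (Suc n) \<and> (\<forall>F\<in>J. \<forall>G\<in>J. F \<noteq> G \<longrightarrow> \<not> (\<exists>P\<in>\<F> n. F \<subseteq> P \<and> G \<subseteq> P))
          \<longrightarrow> cond_indep M (sm_filtr M \<F> W n) (W (Suc n)) J) \<and>
     \<comment> \<open>(SD5)\<close>
     (\<forall>n. \<forall>F\<in>\<F> n. \<exists>x r. ball x r \<subseteq> F \<and> 2 powr (- real n) / C \<le> diameter (ball x r) \<and>
                             diameter F \<le> C * 2 powr (- real n))"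

text \<open>Measurable space of compact sets (Effros / Hausdorff-metric Borel structure).\<close>
definition compacts :: "'a::euclidean_space set measure" where
  "compacts = sigma {K. compact K} {{K. compact K \<and> K \<inter> U \<noteq> {}} | U. open U}"

definition cutout_intensity :: "'a::euclidean_space set measure \<Rightarrow> 'a set measure" where
  "cutout_intensity Q0 =
     distr (lborel \<Otimes>\<^sub>M (density lborel (\<lambda>s::real. ennreal (indicator {0<..} s / s)) \<Otimes>\<^sub>M Q0))
           compacts (\<lambda>(t, s, \<Lambda>). (\<lambda>x. s *\<^sub>R (x + t)) ` \<Lambda>)"

definition poisson_pp :: "'w measure \<Rightarrow> 'b measure \<Rightarrow> ('w \<Rightarrow> 'b set) \<Rightarrow> bool" where
  "poisson_pp M Q Y \<longleftrightarrow> prob_space M \<and> (\<forall>\<omega>\<in>space M. Y \<omega> \<subseteq> space Q) \<and>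
     (\<forall>S\<in>sets Q. emeasure Q S < \<infinity> \<longrightarrow>
        (\<lambda>\<omega>. card (Y \<omega> \<inter> S)) \<in> M \<rightarrow>\<^sub>M count_space UNIV \<and>
        (AE \<omega> in M. finite (Y \<omega> \<inter> S)) \<and>
        (\<forall>j::nat. measure M {\<omega>\<in>space M. card (Y \<omega> \<inter> S) = j}
                   = measure Q S ^ j / fact j * exp (- measure Q S))) \<and>
     (\<forall>(I::nat set) S. finite I \<and> (\<forall>i\<in>I. S i \<in> sets Q \<and> emeasure Q (S i) < \<infinity>) \<and>
          disjoint_family_on S I \<longrightarrow>
          prob_space.indep_vars M (\<lambda>_. count_space UNIV) (\<lambda>i \<omega>. card (Y \<omega> \<inter> S i)) I)"

definition cutout_A :: "'a::euclidean_space set \<Rightarrow> ('w \<Rightarrow> 'a set set) \<Rightarrow> nat \<Rightarrow> 'w \<Rightarrow> 'a set" where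
  "cutout_A \<Omega> Y n \<omega> = \<Omega> - \<Union>{\<Lambda>\<in>Y \<omega>. 2 powr (- real n) \<le> diameter \<Lambda> \<and> diameter \<Lambda> < 1}"

text \<open>Regular inner approximation; Borel-measurability of the map is rendered as joint
  measurability of {(Lambda, x). x in Lambda_rho}.\<close>
definition reg_inner_approx :: "'a::euclidean_space set measure \<Rightarrow> (real \<Rightarrow> 'a set \<Rightarrow> 'a set) \<Rightarrow> bool" where
  "reg_inner_approx Q0 R \<longleftrightarrow>
     (\<forall>\<rho>\<in>{0<..<1}. {(\<Lambda>, x). x \<in> R \<rho> \<Lambda>} \<in> sets (Q0 \<Otimes>\<^sub>M lborel) \<and>
        (\<exists>\<beta>>0. AE \<Lambda> in Q0. R \<rho> \<Lambda> \<subseteq> inner_core \<beta> \<Lambda> \<and>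
                 ennreal (1 - \<rho>) * emeasure lborel \<Lambda> \<le> emeasure lborel (R \<rho> \<Lambda>)))"

end

theory Submission
  imports Defs
begin

text \<open>
  A plane is parametrised by an isometry applied to the span of some of the basis vectors, so that its
  \<open>k\<close>-dimensional volume is an image of a product of Lebesgue measures. Planes that meet a bounded set
  are approximated by nets of polynomial size, hence a bound with superpolynomially small failure
  probability for a single plane extends to all planes by the Borel-Cantelli lemma.

  For a subdivision martingale let \<open>X n\<close> be the mass of the \<open>n\<close>-th density on a plane. The children of each
  cell are distributed over boundedly many colours such that the weights within a colour are
  conditionally independent. This gives an exponential moment of the increment of \<open>X\<close> whose
  variance proxy is \<open>2 powr ((\<alpha> - k) * n)\<close> times \<open>X n\<close>. Non-flatness makes \<open>X n\<close> Hoelder continuous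
  in the plane, so the supremum over all planes grows by the factors of a convergent product.
  Averaging over small translates of the plane passes from the cells to a neighbourhood of the limit set.

  For a cutout martingale, a point close to the limit set is not deep inside a removed set, and the set
  of points that are deep inside no removed set absorbs small motions of the plane. The moments of the
  number of such points on a grid in the plane are sums of void probabilities of the Poisson process.
  Such a probability is estimated by adding the points one at a time: the sets around the new point that
  are smaller than the distance to the nearest old point contain none of the old points.
\<close>

section \<open>Flat measures on affine planes\<close>

text \<open>In (i) the rate has no loss, so the union bound over the planes may cost only summable
  terms. The increment of the mass on a plane fluctuates on the scale 2^(-(k-\<alpha>)n/2) times the
  root of the mass, and a net of planes fine enough for the Hoelder continuity has 2^(O(n))
  elements; a deviation of order n times that scale is exponentially unlikely. As \<alpha> < k,
  these deviations are summable over n, whether they enter as summands or as factors. In (ii)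
  moments of a fixed order p give failure probabilities 2^(-\<epsilon>pn) above a threshold raised
  by 2^(\<epsilon>n). The order p is taken large in terms of the size exponent of the net, and
  raising the threshold is one source of the loss \<epsilon>. Requiring depth lowers the exponent
  from \<alpha> to a slightly smaller one, which tends back to \<alpha> with the depth because
  boundaries are null. In both cases the obstacle behind the last step is that A(2^-n) sticks out of
  A_n, so a bound for the slices of A_n does not by itself bound the slices of the
  neighbourhood.\<close>

definition flat_map :: "'a::euclidean_space set \<Rightarrow> ('a \<Rightarrow> 'a) \<Rightarrow> 'a \<Rightarrow> ('a \<Rightarrow> real) \<Rightarrow> 'a" where
  "flat_map D g z t = g (\<Sum>b\<in>D. t b *\<^sub>R b) + z"

text \<open>The k-dimensional Lebesgue measure on the plane through \<open>z\<close> with direction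
  space g(span D). As an image of a product measure it is open to Fubini and to explicit boxes,
  which \<open>hausdorff_measure\<close> is not.\<close>

definition flat_measure :: "'a::euclidean_space set \<Rightarrow> ('a \<Rightarrow> 'a) \<Rightarrow> 'a \<Rightarrow> 'a measure" where
  "flat_measure D g z = distr (PiM D (\<lambda>_. lborel)) borel (flat_map D g z)"

lemma orthogonal_transformation_imp_linear: "orthogonal_transformation g \<Longrightarrow> linear g"
  by (simp add: orthogonal_transformation_def)

lemma flat_map_measurable:
  assumes "linear g"
  shows "flat_map D g z \<in> borel_measurable (PiM D (\<lambda>_. lborel))"
proof -
  have [measurable]: "g \<in> borel_measurable borel"
    using assms by (intro borel_measurable_continuous_onI linear_continuous_on)
      (simp add: linear_conv_bounded_linear)
  have "(\<lambda>t. \<Sum>b\<in>D. t b *\<^sub>R b) \<in> borel_measurable (PiM D (\<lambda>_. lborel))"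
    by (intro borel_measurable_sum borel_measurable_scaleR) auto
  then show ?thesis unfolding flat_map_def by measurable
qed

lemma sets_flat_measure [simp, measurable_cong]: "sets (flat_measure D g z) = sets borel"
  and space_flat_measure [simp]: "space (flat_measure D g z) = UNIV"
  by (auto simp: flat_measure_def)

lemma emeasure_flat_measure:
  assumes "linear g" "E \<in> sets borel"
  shows "emeasure (flat_measure D g z) E
    = emeasure (PiM D (\<lambda>_. lborel)) {t \<in> space (PiM D (\<lambda>_. lborel)). flat_map D g z t \<in> E}"
  unfolding flat_measure_def
  by (subst emeasure_distr) (auto simp: flat_map_measurable assms intro!: arg_cong2[where f=emeasure])

lemma flat_map_diff:
  assumes "orthogonal_transformation g"
  shows "dist (flat_map D g z t) (flat_map D g z t') = norm (\<Sum>b\<in>D. (t b - t' b) *\<^sub>R b)"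
proof -
  have "flat_map D g z t - flat_map D g z t' = g (\<Sum>b\<in>D. (t b - t' b) *\<^sub>R b)"
    using linear_diff[OF orthogonal_transformation_imp_linear[OF assms], symmetric]
    by (simp add: flat_map_def scaleR_diff_left sum_subtractf)
  then show ?thesis
    by (simp add: dist_norm orthogonal_transformation_norm[OF assms])
qed

lemma inner_sum_Basis_subset:
  assumes "D \<subseteq> Basis" "b \<in> D"
  shows "(\<Sum>c\<in>D. t c *\<^sub>R c) \<bullet> b = t b"
proof -
  have "finite D" using assms finite_subset finite_Basis by blast
  have "(\<Sum>c\<in>D. t c *\<^sub>R c) \<bullet> b = (\<Sum>c\<in>D. if c = b then t b else 0)"
    unfolding inner_sum_left
    by (intro sum.cong) (use assms in \<open>auto simp: inner_Basis subset_iff\<close>)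
  then show ?thesis using assms \<open>finite D\<close> by simp
qed

lemma abs_coord_le_flat_dist:
  assumes "orthogonal_transformation g" "D \<subseteq> Basis" "b \<in> D"
  shows "\<bar>t b - t' b\<bar> \<le> dist (flat_map D g z t) (flat_map D g z t')"
  using Basis_le_norm[of b "\<Sum>b\<in>D. (t b - t' b) *\<^sub>R b"] assms
  by (auto simp: flat_map_diff inner_sum_Basis_subset subset_iff)

lemma flat_dist_le:
  assumes "orthogonal_transformation g" "D \<subseteq> Basis"
    and "\<And>b. b \<in> D \<Longrightarrow> \<bar>t b - t' b\<bar> \<le> \<delta>"
  shows "dist (flat_map D g z t) (flat_map D g z t') \<le> real (card D) * \<delta>"
proof -
  have "norm (\<Sum>b\<in>D. (t b - t' b) *\<^sub>R b) \<le> (\<Sum>b\<in>D. \<bar>t b - t' b\<bar>)"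
    by (rule order_trans[OF norm_sum]) (use assms in \<open>auto intro!: sum_mono simp: subset_iff\<close>)
  also have "\<dots> \<le> real (card D) * \<delta>"
    using sum_bounded_above[of D "\<lambda>b. \<bar>t b - t' b\<bar>" \<delta>] assms by auto
  finally show ?thesis by (simp add: flat_map_diff assms)
qed

lemma emeasure_PiM_lborel_box:
  fixes D :: "'a::euclidean_space set"
  assumes "finite D" "\<And>b. b \<in> D \<Longrightarrow> l b \<le> (u b :: real)"
  shows "emeasure (PiM D (\<lambda>_. lborel)) (PiE D (\<lambda>b. {l b..u b})) = ennreal (\<Prod>b\<in>D. u b - l b)"
    and "emeasure (PiM D (\<lambda>_. lborel)) (PiE D (\<lambda>b. {l b..<u b})) = ennreal (\<Prod>b\<in>D. u b - l b)"
proof -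
  interpret product_sigma_finite "\<lambda>_::'a. lborel :: real measure"
    by unfold_locales
  show "emeasure (PiM D (\<lambda>_. lborel)) (PiE D (\<lambda>b. {l b..u b})) = ennreal (\<Prod>b\<in>D. u b - l b)"
    using assms by (subst emeasure_PiM) (auto simp: prod_ennreal)
  show "emeasure (PiM D (\<lambda>_. lborel)) (PiE D (\<lambda>b. {l b..<u b})) = ennreal (\<Prod>b\<in>D. u b - l b)"
    using assms by (subst emeasure_PiM) (auto simp: prod_ennreal)
qed

text \<open>Coordinates are 1-Lipschitz in the distance of the image points, so the preimage of
  \<open>E\<close> lies in a box of side 2r around any of its parameters.\<close>

lemma flat_measure_le_diameter:
  assumes g: "orthogonal_transformation g" and D: "D \<subseteq> Basis" and E: "E \<in> sets borel"
    and diam: "\<And>x y. x \<in> E \<Longrightarrow> y \<in> E \<Longrightarrow> dist x y \<le> r" and "0 \<le> r"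
  shows "emeasure (flat_measure D g z) E \<le> ennreal ((2 * r) ^ card D)"
proof -
  have fin: "finite D" using D finite_subset finite_Basis by blast
  let ?P = "{t \<in> space (PiM D (\<lambda>_. lborel)). flat_map D g z t \<in> E}"
  show ?thesis
  proof (cases "?P = {}")
    case True
    then show ?thesis
      by (subst emeasure_flat_measure[OF orthogonal_transformation_imp_linear[OF g] E]) (subst True, simp)
  next
    case False
    then obtain t0 where t0: "t0 \<in> ?P" by blast
    have sub: "?P \<subseteq> PiE D (\<lambda>b. {t0 b - r..t0 b + r})"
    proof
      fix t assume t: "t \<in> ?P"
      have "\<bar>t b - t0 b\<bar> \<le> r" if "b \<in> D" for b
        using abs_coord_le_flat_dist[OF g D that, of t t0 z] diam[of "flat_map D g z t" "flat_map D g z t0"] t t0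
        by auto
      then show "t \<in> PiE D (\<lambda>b. {t0 b - r..t0 b + r})"
        using t by (auto simp: space_PiM PiE_iff abs_le_iff algebra_simps)
    qed
    have "emeasure (flat_measure D g z) E \<le> emeasure (PiM D (\<lambda>_. lborel)) (PiE D (\<lambda>b. {t0 b - r..t0 b + r}))"
      unfolding emeasure_flat_measure[OF orthogonal_transformation_imp_linear[OF g] E]
      by (intro emeasure_mono sub sets_PiM_I_finite fin) auto
    also have "\<dots> = ennreal ((2 * r) ^ card D)"
      using fin \<open>0 \<le> r\<close> by (subst emeasure_PiM_lborel_box) (auto simp: algebra_simps)
    finally show ?thesis .
  qed
qed

section \<open>Comparison of the flat measure with the Hausdorff measure\<close>

lemma hausdorff_measure_mono:
  assumes "E \<subseteq> F"
  shows "hausdorff_measure k E \<le> hausdorff_measure k F"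
  unfolding hausdorff_measure_def
  by (intro SUP_mono' INF_superset_mono) (use assms in auto)

text \<open>The bound \<open>1 \<le> k\<close> matters: for k = 0 every member of a cover, the empty
  set included, contributes 0^0 = 1, and each sequence of sets has an infinite sum.\<close>

lemma hausdorff_measure_empty:
  assumes "1 \<le> k"
  shows "hausdorff_measure k {} = 0"
proof -
  have "(INF U\<in>{U::nat \<Rightarrow> 'a set. {} \<subseteq> (\<Union>i. U i) \<and> (\<forall>i. bounded (U i) \<and> diameter (U i) \<le> \<delta>)}.
        (\<Sum>i. ennreal (unit_ball_vol (real k) / 2 ^ k * diameter (U i) ^ k))) \<le> 0" if "\<delta> > 0" for \<delta>
    by (rule INF_lower2[where i="\<lambda>_. {}"]) (use that assms in \<open>auto simp: power_0_left\<close>)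
  then show ?thesis
    unfolding hausdorff_measure_def
    by (intro antisym SUP_least) auto
qed

text \<open>Mass distribution principle: a covering set of diameter r carries flat measure at most
  (2r)^k. The 4^-k combines 2^-k for the box of side 2r with the 2^-k of the Hausdorff
  normalisation.\<close>

lemma flat_measure_le_hausdorff_measure:
  fixes D :: "'a::euclidean_space set"
  assumes g: "orthogonal_transformation g" and D: "D \<subseteq> Basis" and E: "E \<in> sets borel"
  shows "ennreal (unit_ball_vol (real (card D)) / 4 ^ card D) * emeasure (flat_measure D g z) E
    \<le> hausdorff_measure (card D) (E \<inter> range (flat_map D g z))"
proof -
  define k where "k = card D"
  define c where "c = unit_ball_vol (real k) / 4 ^ k"
  have c: "c \<ge> 0" by (simp add: c_def less_imp_le)
  note lin = orthogonal_transformation_imp_linear[OF g]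
  have "ennreal c * emeasure (flat_measure D g z) E
      \<le> (\<Sum>i. ennreal (unit_ball_vol (real k) / 2 ^ k * diameter (U i) ^ k))"
    if U: "E \<inter> range (flat_map D g z) \<subseteq> (\<Union>i. U i)" "\<forall>i. bounded (U i) \<and> diameter (U i) \<le> 1"
    for U :: "nat \<Rightarrow> 'a set"
  proof -
    \<comment> \<open>Covering sets need not be measurable; their closures are, and they have the
      same diameter.\<close>
    have cl: "closure (U i) \<in> sets borel" for i by simp
    have "emeasure (flat_measure D g z) E \<le> emeasure (flat_measure D g z) (\<Union>i. closure (U i))"
    proof -
      have un: "(\<Union>i. closure (U i)) \<in> sets borel" by auto
      have "{t \<in> space (PiM D (\<lambda>_. lborel)). flat_map D g z t \<in> E}
          \<subseteq> {t \<in> space (PiM D (\<lambda>_. lborel)). flat_map D g z t \<in> (\<Union>i. closure (U i))}"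
      proof (intro Collect_mono impI conjI; elim conjE)
        fix t assume "flat_map D g z t \<in> E"
        then have "flat_map D g z t \<in> (\<Union>i. U i)" using U(1) by blast
        then show "flat_map D g z t \<in> (\<Union>i. closure (U i))" using closure_subset by blast
      qed
      then show ?thesis
        unfolding emeasure_flat_measure[OF lin E] emeasure_flat_measure[OF lin un]
        by (intro emeasure_mono) (use un flat_map_measurable[OF lin, of D z] in measurable)
    qed
    also have "\<dots> \<le> (\<Sum>i. emeasure (flat_measure D g z) (closure (U i)))"
      by (intro emeasure_subadditive_countably) auto
    also have "\<dots> \<le> (\<Sum>i. ennreal ((2 * diameter (U i)) ^ k))"
    proof (intro suminf_le)
      fix i
      have b: "bounded (closure (U i))" using U(2) by (simp add: bounded_closure)
      have "dist x y \<le> diameter (U i)" if "x \<in> closure (U i)" "y \<in> closure (U i)" for x y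
        using diameter_bounded_bound[OF b that] U(2) by (simp add: diameter_closure)
      then show "emeasure (flat_measure D g z) (closure (U i)) \<le> ennreal ((2 * diameter (U i)) ^ k)"
        unfolding k_def using U(2) by (intro flat_measure_le_diameter g D) (auto simp: diameter_ge_0)
    qed auto
    finally have "ennreal c * emeasure (flat_measure D g z) E \<le> ennreal c * (\<Sum>i. ennreal ((2 * diameter (U i)) ^ k))"
      by (rule mult_left_mono) simp
    also have "\<dots> = (\<Sum>i. ennreal c * ennreal ((2 * diameter (U i)) ^ k))"
      by simp
    also have "\<dots> = (\<Sum>i. ennreal (unit_ball_vol (real k) / 2 ^ k * diameter (U i) ^ k))"
    proof (intro suminf_cong)
      fix i
      have "(4::real) ^ k = 2 ^ k * 2 ^ k" by (simp flip: power_mult_distrib)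
      then show "ennreal c * ennreal ((2 * diameter (U i)) ^ k) = ennreal (unit_ball_vol (real k) / 2 ^ k * diameter (U i) ^ k)"
        by (subst ennreal_mult'[OF c, symmetric]) (simp add: c_def power_mult_distrib)
    qed
    finally show ?thesis .
  qed
  then have "ennreal c * emeasure (flat_measure D g z) E
    \<le> (INF U\<in>{U::nat \<Rightarrow> 'a set. E \<inter> range (flat_map D g z) \<subseteq> (\<Union>i. U i) \<and>
                                  (\<forall>i. bounded (U i) \<and> diameter (U i) \<le> 1)}.
        (\<Sum>i. ennreal (unit_ball_vol (real k) / 2 ^ k * diameter (U i) ^ k)))"
    by (intro INF_greatest) blast
  \<comment> \<open>The scale 1 is an arbitrary choice, since the bound holds for covers at any
    scale.\<close>
  also have "\<dots> \<le> hausdorff_measure k (E \<inter> range (flat_map D g z))"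
    unfolding hausdorff_measure_def by (rule SUP_upper2[where i=1]) auto
  finally show ?thesis by (simp add: c_def k_def)
qed

section \<open>Grid cells in the parameter space, a discrete substitute for the flat measure\<close>

definition grid_index ::
  "'a::euclidean_space set \<Rightarrow> ('a \<Rightarrow> 'a) \<Rightarrow> 'a \<Rightarrow> real \<Rightarrow> 'a set \<Rightarrow> ('a \<Rightarrow> int) set" where
  "grid_index D g z \<delta> E =
     (\<lambda>t. \<lambda>b\<in>D. \<lfloor>t b / \<delta>\<rfloor>) ` {t \<in> PiE D (\<lambda>_. UNIV). flat_map D g z t \<in> E}"

definition grid_cell :: "'a::euclidean_space set \<Rightarrow> real \<Rightarrow> ('a \<Rightarrow> int) \<Rightarrow> ('a \<Rightarrow> real) set" where
  "grid_cell D \<delta> j = PiE D (\<lambda>b. {\<delta> * j b..<\<delta> * (j b + 1)})"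

lemma grid_cell_iff:
  assumes "\<delta> > 0"
  shows "t \<in> grid_cell D \<delta> j \<longleftrightarrow> t \<in> PiE D (\<lambda>_. UNIV) \<and> (\<forall>b\<in>D. \<lfloor>t b / \<delta>\<rfloor> = j b)"
  using assms
  by (auto simp: grid_cell_def PiE_iff floor_eq_iff field_simps)

lemma emeasure_grid_cell:
  assumes "finite D" "\<delta> > 0"
  shows "emeasure (PiM D (\<lambda>_. lborel)) (grid_cell D \<delta> j) = ennreal (\<delta> ^ card D)"
  unfolding grid_cell_def using assms
  by (subst emeasure_PiM_lborel_box) (auto simp: algebra_simps)

lemma sets_grid_cell: "finite D \<Longrightarrow> grid_cell D \<delta> j \<in> sets (PiM D (\<lambda>_. lborel))"
  unfolding grid_cell_def by (intro sets_PiM_I_finite) auto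

lemma emeasure_Union_grid_cell:
  assumes "finite D" "\<delta> > 0" "finite J" "J \<subseteq> PiE D (\<lambda>_. UNIV)"
  shows "emeasure (PiM D (\<lambda>_. lborel)) (\<Union>j\<in>J. grid_cell D \<delta> j) = ennreal (real (card J) * \<delta> ^ card D)"
proof -
  have "disjoint_family_on (grid_cell D \<delta>) J"
  proof (unfold disjoint_family_on_def, intro ballI impI equals0I)
    fix i j t assume ij: "i \<in> J" "j \<in> J" "i \<noteq> j" and "t \<in> grid_cell D \<delta> i \<inter> grid_cell D \<delta> j"
    then have "\<forall>b\<in>D. i b = j b" using assms(2) by (auto simp: grid_cell_iff)
    then have "i = j" using ij assms(4) by (intro PiE_ext[of i D "\<lambda>_. UNIV" j]) auto
    then show False using ij by simp
  qed
  then have "emeasure (PiM D (\<lambda>_. lborel)) (\<Union>j\<in>J. grid_cell D \<delta> j)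
     = (\<Sum>j\<in>J. emeasure (PiM D (\<lambda>_. lborel)) (grid_cell D \<delta> j))"
    by (intro sum_emeasure[symmetric]) (auto simp: assms sets_grid_cell)
  then show ?thesis using assms
    by (simp add: emeasure_grid_cell ennreal_mult ennreal_of_nat_eq_real_of_nat)
qed

lemma grid_index_subset: "grid_index D g z \<delta> E \<subseteq> PiE D (\<lambda>_. UNIV)"
  by (auto simp: grid_index_def)

lemma grid_index_iff:
  assumes "\<delta> > 0"
  shows "j \<in> grid_index D g z \<delta> E \<longleftrightarrow>
    j \<in> PiE D (\<lambda>_. UNIV) \<and> (\<exists>t\<in>grid_cell D \<delta> j. flat_map D g z t \<in> E)"
proof
  assume "j \<in> grid_index D g z \<delta> E"
  then show "j \<in> PiE D (\<lambda>_. UNIV) \<and> (\<exists>t\<in>grid_cell D \<delta> j. flat_map D g z t \<in> E)"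
    using assms by (auto simp: grid_index_def grid_cell_iff)
next
  assume a: "j \<in> PiE D (\<lambda>_. UNIV) \<and> (\<exists>t\<in>grid_cell D \<delta> j. flat_map D g z t \<in> E)"
  then obtain t where t: "t \<in> PiE D (\<lambda>_. UNIV)" "\<forall>b\<in>D. \<lfloor>t b / \<delta>\<rfloor> = j b" "flat_map D g z t \<in> E"
    using assms by (auto simp: grid_cell_iff)
  have "j = (\<lambda>b\<in>D. \<lfloor>t b / \<delta>\<rfloor>)"
    using a t(2) by (intro PiE_ext[of j D "\<lambda>_. UNIV"]) auto
  then show "j \<in> grid_index D g z \<delta> E" using t unfolding grid_index_def by blast
qed

lemma grid_cell_coord_diff:
  assumes "\<delta> > 0" "t \<in> grid_cell D \<delta> j" "t' \<in> grid_cell D \<delta> j" "b \<in> D"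
  shows "\<bar>t b - t' b\<bar> \<le> \<delta>"
proof -
  have "\<delta> * j b \<le> t b \<and> t b < \<delta> * j b + \<delta>" "\<delta> * j b \<le> t' b \<and> t' b < \<delta> * j b + \<delta>"
    using assms by (auto simp: grid_cell_def PiE_iff algebra_simps)
  then show ?thesis by linarith
qed

lemma finite_grid_index:
  assumes g: "orthogonal_transformation g" and D: "D \<subseteq> Basis" and "\<delta> > 0" and E: "bounded E"
  shows "finite (grid_index D g z \<delta> E)"
proof -
  have fin: "finite D" using D finite_subset finite_Basis by blast
  obtain B where B: "\<And>x. x \<in> E \<Longrightarrow> dist z x \<le> B" using E bounded_any_center by metis
  have g0: "g 0 = 0" using orthogonal_transformation_imp_linear[OF g] by (rule linear_0)
  have "grid_index D g z \<delta> E \<subseteq> PiE D (\<lambda>_. {\<lfloor>-B / \<delta>\<rfloor>..\<lfloor>B / \<delta>\<rfloor>})"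
  proof
    fix j assume "j \<in> grid_index D g z \<delta> E"
    then obtain t where t: "flat_map D g z t \<in> E" "j = (\<lambda>b\<in>D. \<lfloor>t b / \<delta>\<rfloor>)"
      by (auto simp: grid_index_def)
    have "\<bar>t b\<bar> \<le> B" if "b \<in> D" for b
      using abs_coord_le_flat_dist[OF g D that, of t "\<lambda>_. 0" z] B[OF t(1)]
      by (simp add: flat_map_def dist_commute g0)
    then have "- B / \<delta> \<le> t b / \<delta> \<and> t b / \<delta> \<le> B / \<delta>" if "b \<in> D" for b
      using that \<open>\<delta> > 0\<close> by (intro conjI divide_right_mono) (auto simp: abs_le_iff minus_le_iff)
    then show "j \<in> PiE D (\<lambda>_. {\<lfloor>-B / \<delta>\<rfloor>..\<lfloor>B / \<delta>\<rfloor>})"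
      unfolding t(2) by (auto intro!: floor_mono)
  qed
  then show ?thesis using fin by (meson finite_PiE finite_atLeastAtMost_int finite_subset)
qed

lemma open_open_nbhd: "open (open_nbhd A r)"
proof -
  have "open_nbhd A r = (\<Union>a\<in>A. ball a r)" by (auto simp: open_nbhd_def dist_commute)
  then show ?thesis by auto
qed

text \<open>A cell meeting the preimage of \<open>E\<close> has an image of diameter at most
  k\<delta> < \<eta>, so that this image lies in the \<eta>-neighbourhood of \<open>E\<close>; the
  cells are disjoint and each has measure \<delta>^k.\<close>

lemma card_grid_index_le:
  assumes g: "orthogonal_transformation g" and D: "D \<subseteq> Basis" and "\<delta> > 0" and E: "bounded E"
    and \<eta>: "real (card D) * \<delta> < \<eta>"
  shows "ennreal (real (card (grid_index D g z \<delta> E)) * \<delta> ^ card D)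
    \<le> emeasure (flat_measure D g z) (open_nbhd E \<eta>)"
proof -
  have fin: "finite D" using D finite_subset finite_Basis by blast
  note lin = orthogonal_transformation_imp_linear[OF g]
  let ?J = "grid_index D g z \<delta> E"
  have op: "open_nbhd E \<eta> \<in> sets borel" by (simp add: open_open_nbhd)
  have "ennreal (real (card ?J) * \<delta> ^ card D) = emeasure (PiM D (\<lambda>_. lborel)) (\<Union>j\<in>?J. grid_cell D \<delta> j)"
    by (rule emeasure_Union_grid_cell[OF fin \<open>\<delta> > 0\<close> finite_grid_index[OF g D \<open>\<delta> > 0\<close> E] grid_index_subset, symmetric])
  also have "\<dots> \<le> emeasure (PiM D (\<lambda>_. lborel)) {t \<in> space (PiM D (\<lambda>_. lborel)). flat_map D g z t \<in> open_nbhd E \<eta>}"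
  proof (intro emeasure_mono)
    show "(\<Union>j\<in>?J. grid_cell D \<delta> j) \<subseteq> {t \<in> space (PiM D (\<lambda>_. lborel)). flat_map D g z t \<in> open_nbhd E \<eta>}"
    proof
      fix t assume "t \<in> (\<Union>j\<in>?J. grid_cell D \<delta> j)"
      then obtain j s where j: "t \<in> grid_cell D \<delta> j" "s \<in> grid_cell D \<delta> j" "flat_map D g z s \<in> E"
        using \<open>\<delta> > 0\<close> by (auto simp: grid_index_iff)
      have "dist (flat_map D g z t) (flat_map D g z s) \<le> real (card D) * \<delta>"
        by (intro flat_dist_le g D grid_cell_coord_diff[OF \<open>\<delta> > 0\<close> j(1,2)])
      then show "t \<in> {t \<in> space (PiM D (\<lambda>_. lborel)). flat_map D g z t \<in> open_nbhd E \<eta>}"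
        using j \<eta> \<open>\<delta> > 0\<close> by (auto simp: open_nbhd_def space_PiM grid_cell_iff intro!: bexI[of _ "flat_map D g z s"])
    qed
  qed (use op flat_map_measurable[OF lin, of D z] in measurable)
  also have "\<dots> = emeasure (flat_measure D g z) (open_nbhd E \<eta>)"
    by (simp add: emeasure_flat_measure[OF lin op])
  finally show ?thesis .
qed

lemma flat_measure_le_card_grid_index:
  assumes g: "orthogonal_transformation g" and D: "D \<subseteq> Basis" and "\<delta> > 0" and E: "E \<in> sets borel" "bounded E"
  shows "emeasure (flat_measure D g z) E \<le> ennreal (real (card (grid_index D g z \<delta> E)) * \<delta> ^ card D)"
proof -
  have fin: "finite D" using D finite_subset finite_Basis by blast
  note lin = orthogonal_transformation_imp_linear[OF g]
  let ?J = "grid_index D g z \<delta> E"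
  have fJ: "finite ?J" by (intro finite_grid_index g D E \<open>\<delta> > 0\<close>)
  have "emeasure (flat_measure D g z) E \<le> emeasure (PiM D (\<lambda>_. lborel)) (\<Union>j\<in>?J. grid_cell D \<delta> j)"
    unfolding emeasure_flat_measure[OF lin E(1)]
  proof (intro emeasure_mono)
    show "{t \<in> space (PiM D (\<lambda>_. lborel)). flat_map D g z t \<in> E} \<subseteq> (\<Union>j\<in>?J. grid_cell D \<delta> j)"
      using \<open>\<delta> > 0\<close> by (auto simp: grid_index_def grid_cell_iff space_PiM)
  qed (use fJ sets_grid_cell[OF fin] in auto)
  also have "\<dots> = ennreal (real (card ?J) * \<delta> ^ card D)"
    by (rule emeasure_Union_grid_cell[OF fin \<open>\<delta> > 0\<close> fJ grid_index_subset])
  finally show ?thesis .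
qed

lemma grid_cover:
  assumes "\<delta> > 0"
  shows "E \<inter> range (flat_map D g z) \<subseteq> (\<Union>j\<in>grid_index D g z \<delta> E. flat_map D g z ` grid_cell D \<delta> j)"
proof
  fix x assume x: "x \<in> E \<inter> range (flat_map D g z)"
  then obtain t where t: "x = flat_map D g z t" by blast
  let ?t = "\<lambda>b\<in>D. t b" and ?j = "\<lambda>b\<in>D. \<lfloor>t b / \<delta>\<rfloor>"
  have eq: "x = flat_map D g z ?t" unfolding t flat_map_def by (simp cong: sum.cong)
  have "?j \<in> grid_index D g z \<delta> E" "?t \<in> grid_cell D \<delta> ?j"
    using x eq assms by (auto simp: grid_index_iff grid_cell_iff intro!: bexI[of _ ?t])
  then show "x \<in> (\<Union>j\<in>grid_index D g z \<delta> E. flat_map D g z ` grid_cell D \<delta> j)"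
    using eq by blast
qed

text \<open>The images of the grid cells meeting \<open>E\<close> form an admissible cover, and the
  flat measure of a neighbourhood bounds their number. The neighbourhood pays for the cells that
  \<open>E\<close> barely touches.\<close>

lemma hausdorff_measure_le_flat_measure:
  fixes D :: "'a::euclidean_space set"
  assumes g: "orthogonal_transformation g" and D: "D \<subseteq> Basis" and E: "bounded E" and "\<eta> > 0"
    and k: "1 \<le> card D"
  shows "hausdorff_measure (card D) (E \<inter> range (flat_map D g z))
    \<le> ennreal (unit_ball_vol (card D) / 2 ^ card D * real (card D) ^ card D) *
       emeasure (flat_measure D g z) (open_nbhd E \<eta>)"
proof -
  let ?k = "card D"
  let ?c = "unit_ball_vol ?k / 2 ^ ?k"
  have c: "?c \<ge> 0" by (simp add: less_imp_le)
  have "(INF U\<in>{U::nat \<Rightarrow> 'a set. E \<inter> range (flat_map D g z) \<subseteq> (\<Union>i. U i) \<and>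
                                  (\<forall>i. bounded (U i) \<and> diameter (U i) \<le> r)}.
        (\<Sum>i. ennreal (?c * diameter (U i) ^ ?k)))
      \<le> ennreal (?c * real ?k ^ ?k) * emeasure (flat_measure D g z) (open_nbhd E \<eta>)" if r: "r > 0" for r
  proof -
    \<comment> \<open>The first entry makes the images of the cells admissible at scale
      \<open>r\<close>, the second keeps them inside the \<eta>-neighbourhood. The resulting bound
      does not depend on \<open>r\<close>, so it survives the supremum.\<close>
    define \<delta> where "\<delta> = min (r / ?k) (\<eta> / (2 * ?k))"
    have \<delta>: "\<delta> > 0" "?k * \<delta> \<le> r" "?k * \<delta> < \<eta>"
      using r k \<open>\<eta> > 0\<close> by (auto simp: \<delta>_def min_def field_simps)
    let ?J = "grid_index D g z \<delta> E"
    define T where "T j = flat_map D g z ` grid_cell D \<delta> j" for j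
    have fJ: "finite ?J" by (intro finite_grid_index g D E \<delta>)
    obtain f where f: "bij_betw f {0..<card ?J} ?J" using ex_bij_betw_nat_finite[OF fJ] by blast
    define U where "U i = (if i < card ?J then T (f i) else {})" for i
    have dT: "dist x y \<le> ?k * \<delta>" if "x \<in> T j" "y \<in> T j" for x y j
      using that \<delta> unfolding T_def by (auto intro!: flat_dist_le g D intro: grid_cell_coord_diff[OF \<open>\<delta> > 0\<close>])
    have bT: "bounded (T j)" for j
      using dT unfolding bounded_two_points by blast
    have diT: "diameter (T j) \<le> ?k * \<delta>" for j
      using dT[of _ j] \<delta> by (intro diameter_le) (auto simp: dist_norm)
    have "(\<Union>i. U i) = (\<Union>j\<in>?J. T j)"
      using f unfolding U_def bij_betw_def by (auto split: if_splits) (metis atLeastLessThan_iff imageE zero_le)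
    then have cov: "E \<inter> range (flat_map D g z) \<subseteq> (\<Union>i. U i)"
      using grid_cover[OF \<delta>(1), of E D g z] by (simp add: T_def)
    have "(INF U\<in>{U::nat \<Rightarrow> 'a set. E \<inter> range (flat_map D g z) \<subseteq> (\<Union>i. U i) \<and>
                                  (\<forall>i. bounded (U i) \<and> diameter (U i) \<le> r)}.
        (\<Sum>i. ennreal (?c * diameter (U i) ^ ?k))) \<le> (\<Sum>i. ennreal (?c * diameter (U i) ^ ?k))"
    proof (rule INF_lower, intro CollectI conjI allI cov)
      show "bounded (U i)" "diameter (U i) \<le> r" for i
        using bT diT[of "f i"] \<delta> r by (auto simp: U_def)
    qed
    also have "\<dots> = (\<Sum>i<card ?J. ennreal (?c * diameter (U i) ^ ?k))"
      using k by (intro suminf_finite) (auto simp: U_def)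
    also have "\<dots> \<le> (\<Sum>i<card ?J. ennreal (?c * (?k * \<delta>) ^ ?k))"
      using diT c bT by (intro sum_mono ennreal_leI mult_left_mono power_mono) (auto simp: U_def diameter_ge_0)
    also have "\<dots> = ennreal (?c * real ?k ^ ?k) * ennreal (real (card ?J) * \<delta> ^ ?k)"
      using c \<delta> by (simp add: ennreal_mult[symmetric] ennreal_of_nat_eq_real_of_nat power_mult_distrib mult_ac)
    also have "\<dots> \<le> ennreal (?c * real ?k ^ ?k) * emeasure (flat_measure D g z) (open_nbhd E \<eta>)"
      by (intro mult_left_mono card_grid_index_le g D \<delta> E) simp
    finally show ?thesis .
  qed
  then show ?thesis unfolding hausdorff_measure_def by (intro SUP_least) simp
qed

text \<open>An orthonormal basis of the direction space is matched with \<open>D\<close>, one of the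
  orthogonal complement with the other basis vectors, and \<open>g\<close> is the orthogonal map so
  obtained. The base point may be any point of \<open>V\<close>; choosing it in the bounded set
  under study keeps the parameters bounded.\<close>

lemma affine_plane_flat_map:
  fixes D :: "'a::euclidean_space set"
  assumes V: "V \<in> affine_planes (card D)" and x: "x \<in> V" and D: "D \<subseteq> Basis"
  obtains g where "orthogonal_transformation g" "V = range (flat_map D g x)"
proof -
  have aff: "affine V" and dim: "aff_dim V = int (card D)" using V by (auto simp: affine_planes_def)
  define S where "S = (\<lambda>y. y - x) ` V"
  have S: "subspace S" unfolding S_def by (rule affine_diffs_subspace_subtract[OF aff x])
  have dS: "dim S = card D"
    using aff_dim_eq_dim_subtract[of x V] x dim by (simp add: S_def hull_inc)
  obtain B where B: "B \<subseteq> S" "pairwise orthogonal B" "\<And>x. x \<in> B \<Longrightarrow> norm x = 1"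
      "independent B" "card B = dim S" "span B = S"
    using orthonormal_basis_subspace[OF S] by metis
  define S' where "S' = {y. \<forall>x\<in>S. orthogonal x y}"
  have S': "subspace S'" unfolding S'_def by (rule subspace_orthogonal_to_vectors)
  have dS': "dim S' + card D = DIM('a)"
    using dim_subspace_orthogonal_to_vectors[OF S subspace_UNIV] by (simp add: S'_def dS)
  obtain B' where B': "B' \<subseteq> S'" "pairwise orthogonal B'" "\<And>x. x \<in> B' \<Longrightarrow> norm x = 1"
      "independent B'" "card B' = dim S'" "span B' = S'"
    using orthonormal_basis_subspace[OF S'] by metis
  have fB: "finite B" "finite B'" using B(4) B'(4) independent_imp_finite by auto
  have fD: "finite D" using D finite_subset finite_Basis by blast
  have cross: "b \<bullet> b' = 0" if "b \<in> B" "b' \<in> B'" for b b'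
    using that B(1) B'(1) by (auto simp: S'_def orthogonal_def)
  have disj: "B \<inter> B' = {}"
    using cross B(3) by (metis disjoint_iff inner_eq_zero_iff norm_zero zero_neq_one)
  obtain p where p: "bij_betw p D B"
    using finite_same_card_bij[OF fD fB(1)] B(5) dS by auto
  have "card (Basis - D) = card B'"
    using D fD dS' B'(5) by (simp add: card_Diff_subset)
  then obtain q where q: "bij_betw q (Basis - D) B'"
    using finite_same_card_bij[of "Basis - D" B'] fB by auto
  define r where "r b = (if b \<in> D then p b else q b)" for b
  have rB: "r b \<in> B" if "b \<in> D" for b using that p by (auto simp: r_def bij_betw_def)
  have rB': "r b \<in> B'" if "b \<in> Basis - D" for b using that q by (auto simp: r_def bij_betw_def)
  have orth: "r b \<bullet> r c = (if b = c then 1 else 0)" if "b \<in> Basis" "c \<in> Basis" for b c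
  proof (cases "b = c")
    case True
    then have "norm (r b) = 1" using rB rB' B(3) B'(3) that by (cases "b \<in> D") auto
    then show ?thesis using True by (simp add: norm_eq_1)
  next
    case False
    consider "b \<in> D" "c \<in> D" | "b \<in> D" "c \<in> Basis - D" | "b \<in> Basis - D" "c \<in> D" | "b \<in> Basis - D" "c \<in> Basis - D"
      using \<open>b \<in> Basis\<close> \<open>c \<in> Basis\<close> by blast
    then show ?thesis
    proof cases
      case 1
      then have "r b \<noteq> r c" using p False by (auto simp: r_def bij_betw_def inj_on_def)
      then show ?thesis using B(2) rB 1 False by (auto simp: pairwise_def orthogonal_def)
    next
      case 2 then show ?thesis using cross rB rB' False by auto
    next
      case 3 then show ?thesis using cross[of "r c" "r b"] rB rB' False by (auto simp: inner_commute)
    next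
      case 4
      then have "r b \<noteq> r c" using q False by (auto simp: r_def bij_betw_def inj_on_def)
      then show ?thesis using B'(2) rB' 4 False by (auto simp: pairwise_def orthogonal_def)
    qed
  qed
  define g where "g y = (\<Sum>b\<in>Basis. (y \<bullet> b) *\<^sub>R r b)" for y
  have lin: "linear g"
    by (rule linearI) (auto simp: g_def inner_add_left scaleR_add_left sum.distrib scaleR_sum_right)
  have inner: "g v \<bullet> g w = v \<bullet> w" for v w
  proof -
    have 1: "g v \<bullet> g w = (\<Sum>b\<in>Basis. (v \<bullet> b) * (r b \<bullet> g w))"
      unfolding g_def[of v] inner_sum_left by simp
    have 2: "r b \<bullet> g w = (\<Sum>c\<in>Basis. (w \<bullet> c) * (r b \<bullet> r c))" for b
      unfolding g_def[of w] inner_sum_right by simp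
    have "g v \<bullet> g w = (\<Sum>b\<in>Basis. \<Sum>c\<in>Basis. (v \<bullet> b) * (w \<bullet> c) * (r b \<bullet> r c))"
      unfolding 1 2 by (simp add: sum_distrib_left mult.assoc)
    also have "\<dots> = (\<Sum>b\<in>Basis. \<Sum>c\<in>Basis. if b = c then (v \<bullet> b) * (w \<bullet> b) else 0)"
      by (intro sum.cong refl) (simp add: orth)
    also have "\<dots> = v \<bullet> w" by (simp add: euclidean_inner[of v w])
    finally show ?thesis .
  qed
  have g: "orthogonal_transformation g" by (simp add: orthogonal_transformation_def lin inner)
  have gsum: "g (\<Sum>b\<in>D. t b *\<^sub>R b) = (\<Sum>b\<in>D. t b *\<^sub>R r b)" for t
  proof -
    have "g b = r b" if "b \<in> D" for b
    proof -
      have "g b = (\<Sum>c\<in>Basis. if c = b then r b else 0)"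
        unfolding g_def by (intro sum.cong) (use that D in \<open>auto simp: inner_Basis\<close>)
      then show ?thesis using that D by auto
    qed
    then show ?thesis by (simp add: linear_sum[OF lin] linear_scale[OF lin])
  qed
  have "range (flat_map D g x) = (\<lambda>y. y + x) ` S"
  proof -
    have "(\<lambda>t. \<Sum>b\<in>D. t b *\<^sub>R r b) ` UNIV = S"
    proof -
      have inj: "inj_on r D" and im: "r ` D = B"
        using p by (auto simp: r_def bij_betw_def inj_on_def)
      have "S = range (\<lambda>u. \<Sum>v\<in>B. u v *\<^sub>R v)" using span_finite[OF fB(1)] B(6) by simp
      also have "\<dots> = range (\<lambda>u. \<Sum>b\<in>D. u (r b) *\<^sub>R r b)"
        unfolding im[symmetric] by (simp add: sum.reindex[OF inj] o_def)
      also have "\<dots> = range (\<lambda>t. \<Sum>b\<in>D. t b *\<^sub>R r b)"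
      proof (intro set_eqI iffI)
        fix y assume "y \<in> range (\<lambda>t. \<Sum>b\<in>D. t b *\<^sub>R r b)"
        then obtain t where "y = (\<Sum>b\<in>D. t b *\<^sub>R r b)" by blast
        also have "\<dots> = (\<Sum>b\<in>D. (t \<circ> the_inv_into D r) (r b) *\<^sub>R r b)"
          by (intro sum.cong) (simp_all add: the_inv_into_f_f[OF inj])
        finally show "y \<in> range (\<lambda>u. \<Sum>b\<in>D. u (r b) *\<^sub>R r b)" by blast
      qed auto
      finally show ?thesis by simp
    qed
    then show ?thesis unfolding flat_map_def gsum by (auto simp: image_image)
  qed
  also have "\<dots> = V" by (auto simp: S_def image_image)
  finally show ?thesis using that[OF g] by simp
qed

lemma range_flat_map_affine_plane:
  fixes D :: "'a::euclidean_space set"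
  assumes g: "orthogonal_transformation g" and D: "D \<subseteq> Basis"
  shows "range (flat_map D g z) \<in> affine_planes (card D)"
proof -
  note lin = orthogonal_transformation_imp_linear[OF g]
  have fD: "finite D" using D finite_subset finite_Basis by blast
  have "range (flat_map D g z) = (+) z ` g ` span D"
    unfolding span_finite[OF fD] flat_map_def by (auto simp: image_image add.commute)
  moreover have "inj g" by (rule orthogonal_transformation_inj[OF g])
  moreover have "dim (span D) = card D"
    using D independent_Basis independent_mono dim_span_eq_card_independent by blast
  moreover have "aff_dim (g ` span D) = aff_dim (span D)"
    using lin \<open>inj g\<close> by (rule aff_dim_injective_linear_image)
  moreover have "affine (g ` span D)"
    by (intro subspace_imp_affine linear_subspace_image lin subspace_span)
  ultimately have "affine (range (flat_map D g z))" "aff_dim (range (flat_map D g z)) = int (card D)"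
    using affine_translation[of "g ` span D" z] by (simp_all add: aff_dim_translation_eq aff_dim_subspace)
  then show ?thesis by (simp add: affine_planes_def)
qed

section \<open>Finite nets of planes, of polynomial size\<close>

lemma finite_coordinate_net:
  fixes coord :: "'s \<Rightarrow> 'i \<Rightarrow> real"
  assumes I: "finite I" and bd: "\<And>s i. s \<in> S \<Longrightarrow> i \<in> I \<Longrightarrow> \<bar>coord s i\<bar> \<le> R" and "0 < \<epsilon>" "0 \<le> R"
  obtains T where "T \<subseteq> S" "finite T" "real (card T) \<le> (2 * R / \<epsilon> + 3) ^ card I"
    "\<And>s. s \<in> S \<Longrightarrow> \<exists>t\<in>T. \<forall>i\<in>I. \<bar>coord s i - coord t i\<bar> \<le> \<epsilon>"
proof -
  define fl where "fl s = (\<lambda>i\<in>I. \<lfloor>coord s i / \<epsilon>\<rfloor>)" for s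
  let ?B = "{\<lfloor>-R / \<epsilon>\<rfloor>..\<lfloor>R / \<epsilon>\<rfloor>}"
  have sub: "fl ` S \<subseteq> PiE I (\<lambda>_. ?B)"
  proof
    fix j assume "j \<in> fl ` S"
    then obtain s where s: "s \<in> S" "j = fl s" by blast
    have "- R / \<epsilon> \<le> coord s i / \<epsilon> \<and> coord s i / \<epsilon> \<le> R / \<epsilon>" if "i \<in> I" for i
      using bd[OF s(1) that] \<open>0 < \<epsilon>\<close> by (intro conjI divide_right_mono) (auto simp: abs_le_iff)
    then show "j \<in> PiE I (\<lambda>_. ?B)" unfolding s(2) fl_def by (auto intro!: floor_mono)
  qed
  have fin: "finite (PiE I (\<lambda>_. ?B))" using I by (intro finite_PiE) auto
  have finS: "finite (fl ` S)" by (rule finite_subset[OF sub fin])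
  \<comment> \<open>One representative for each occupied grid cell, taken from \<open>S\<close>
    itself: a net of isometries then consists of isometries.\<close>
  let ?T = "inv_into S fl ` fl ` S"
  show ?thesis
  proof
    show "?T \<subseteq> S" by (auto intro: inv_into_into)
    show "finite ?T" using finS by blast
    have "card ?T \<le> card (fl ` S)" using finS by (rule card_image_le)
    also have "\<dots> \<le> card (PiE I (\<lambda>_. ?B))" by (rule card_mono[OF fin sub])
    also have "\<dots> = card ?B ^ card I" using I by (simp add: card_PiE)
    finally have "real (card ?T) \<le> real (card ?B) ^ card I" by (simp flip: of_nat_power)
    also have "\<dots> \<le> (2 * R / \<epsilon> + 3) ^ card I"
    proof (intro power_mono)
      have "real (card ?B) = real_of_int (\<lfloor>R / \<epsilon>\<rfloor> - \<lfloor>-R / \<epsilon>\<rfloor> + 1)"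
      proof -
        have "\<lfloor>-R / \<epsilon>\<rfloor> \<le> \<lfloor>R / \<epsilon>\<rfloor>" using assms by (intro floor_mono) (simp add: divide_right_mono)
        then show ?thesis by simp
      qed
      also have "\<dots> \<le> R / \<epsilon> - (- R / \<epsilon> - 1) + 1" by linarith
      also have "\<dots> \<le> 2 * R / \<epsilon> + 3" by (simp add: field_simps)
      finally show "real (card ?B) \<le> 2 * R / \<epsilon> + 3" .
    qed auto
    finally show "real (card ?T) \<le> (2 * R / \<epsilon> + 3) ^ card I" .
    fix s assume s: "s \<in> S"
    let ?t = "inv_into S fl (fl s)"
    have eq: "fl ?t = fl s" using s by (intro f_inv_into_f) auto
    have "\<bar>coord s i - coord ?t i\<bar> \<le> \<epsilon>" if "i \<in> I" for i
    proof -
      have "\<lfloor>coord ?t i / \<epsilon>\<rfloor> = \<lfloor>coord s i / \<epsilon>\<rfloor>" using fun_cong[OF eq, of i] that by (simp add: fl_def)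
      then have "\<bar>coord s i / \<epsilon> - coord ?t i / \<epsilon>\<bar> \<le> 1" by linarith
      then have "\<bar>(coord s i - coord ?t i) / \<epsilon>\<bar> \<le> 1" by (simp add: diff_divide_distrib)
      then show ?thesis using \<open>0 < \<epsilon>\<close> by (simp add: abs_divide)
    qed
    then show "\<exists>t\<in>?T. \<forall>i\<in>I. \<bar>coord s i - coord t i\<bar> \<le> \<epsilon>" using s by blast
  qed
qed

text \<open>Base points are confined to a ball because only planes that meet a bounded set matter.
  Closeness of the linear parts is a pointwise bound, equivalent to one on the operator
  norm.\<close>

definition is_flat_net :: "real \<Rightarrow> real \<Rightarrow> (('a::euclidean_space \<Rightarrow> 'a) \<times> 'a) set \<Rightarrow> bool" where
  "is_flat_net R \<epsilon> T \<longleftrightarrow>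
     (\<forall>h\<in>T. orthogonal_transformation (fst h) \<and> norm (snd h) \<le> R) \<and>
     (\<forall>g z. orthogonal_transformation g \<longrightarrow> norm z \<le> R \<longrightarrow>
        (\<exists>h\<in>T. (\<forall>x. norm (g x - fst h x) \<le> \<epsilon> * norm x) \<and> norm (z - snd h) \<le> \<epsilon>))"

lemma flat_net:
  fixes R :: real
  assumes "R \<ge> 1"
  obtains L :: nat and c :: real where "c > 0"
    "\<And>\<epsilon>. 0 < \<epsilon> \<Longrightarrow> \<epsilon> \<le> 1 \<Longrightarrow> \<exists>T :: (('a::euclidean_space \<Rightarrow> 'a) \<times> 'a) set. finite T \<and> real (card T) \<le> c * (1 / \<epsilon>) ^ L \<and>
      is_flat_net R \<epsilon> T"
proof -
  define d where "d = real DIM('a)"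
  have d: "d \<ge> 1" by (simp add: d_def Suc_leI)
  \<comment> \<open>The zero vector, which is not in \<open>Basis\<close>, labels the translation
    part, so that matrix entries and translation coordinates share one index set.\<close>
  define I where "I = (Basis :: 'a set) \<times> insert (0::'a) Basis"
  have fI: "finite I" by (simp add: I_def)
  define coord where "coord s i = (if snd i = 0 then snd s \<bullet> fst i else fst s (snd i) \<bullet> fst i)"
    for s :: "('a \<Rightarrow> 'a) \<times> 'a" and i :: "'a \<times> 'a"
  define S where "S = {s :: ('a \<Rightarrow> 'a) \<times> 'a. orthogonal_transformation (fst s) \<and> norm (snd s) \<le> R}"
  have bd: "\<bar>coord s i\<bar> \<le> R" if "s \<in> S" "i \<in> I" for s i
  proof (cases "snd i = 0")
    case True
    then have "\<bar>coord s i\<bar> \<le> norm (snd s)"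
      using Basis_le_norm[of "fst i" "snd s"] that by (auto simp: coord_def I_def)
    then show ?thesis using that by (auto simp: S_def)
  next
    case False
    then have "\<bar>coord s i\<bar> \<le> norm (fst s (snd i))"
      using Basis_le_norm[of "fst i" "fst s (snd i)"] that by (auto simp: coord_def I_def)
    also have "\<dots> = norm (snd i)" using that by (auto simp: S_def orthogonal_transformation_norm)
    also have "\<dots> = 1" using that False by (auto simp: I_def)
    finally show ?thesis using assms by simp
  qed
  show ?thesis
  proof (rule that[of "(2 * R * d\<^sup>2 + 3) ^ card I" "card I"])
    show "(2 * R * d\<^sup>2 + 3) ^ card I > 0" using assms by (intro zero_less_power add_nonneg_pos) auto
    fix \<epsilon> :: real assume \<epsilon>: "0 < \<epsilon>" "\<epsilon> \<le> 1"
    \<comment> \<open>Mesh \<epsilon>/d^2: one factor d is lost in the l1-bound for a column,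
      another in the sum over the columns.\<close>
    have "0 < \<epsilon> / d\<^sup>2" using \<epsilon> d by simp
    then obtain T where T: "T \<subseteq> S" "finite T" "real (card T) \<le> (2 * R / (\<epsilon> / d\<^sup>2) + 3) ^ card I"
      "\<And>s. s \<in> S \<Longrightarrow> \<exists>t\<in>T. \<forall>i\<in>I. \<bar>coord s i - coord t i\<bar> \<le> \<epsilon> / d\<^sup>2"
      using finite_coordinate_net[of I S coord R "\<epsilon> / d\<^sup>2"] fI bd assms by (smt (verit, best))
    have "(2 * R / (\<epsilon> / d\<^sup>2) + 3) \<le> (2 * R * d\<^sup>2 + 3) * (1 / \<epsilon>)"
      using \<epsilon> assms by (simp add: field_simps)
    then have "(2 * R / (\<epsilon> / d\<^sup>2) + 3) ^ card I \<le> ((2 * R * d\<^sup>2 + 3) * (1 / \<epsilon>)) ^ card I"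
      using \<epsilon> assms by (intro power_mono) auto
    then have card: "real (card T) \<le> (2 * R * d\<^sup>2 + 3) ^ card I * (1 / \<epsilon>) ^ card I"
      using T(3) unfolding power_mult_distrib by linarith
    have net: "\<exists>h\<in>T. (\<forall>x. norm (g x - fst h x) \<le> \<epsilon> * norm x) \<and> norm (z - snd h) \<le> \<epsilon>"
      if gz: "orthogonal_transformation g" "norm z \<le> R" for g z
    proof -
      have "(g, z) \<in> S" using gz by (simp add: S_def)
      then obtain t where t: "t \<in> T" "\<And>i. i \<in> I \<Longrightarrow> \<bar>coord (g, z) i - coord t i\<bar> \<le> \<epsilon> / d\<^sup>2"
        using T(4) by blast
      obtain g' z' where t': "t = (g', z')" by (cases t)
      have g': "orthogonal_transformation g'" using t(1) t' T(1) by (auto simp: S_def)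
      have c1: "\<bar>(z - z') \<bullet> b\<bar> \<le> \<epsilon> / d\<^sup>2" if "b \<in> Basis" for b
        using t(2)[of "(b, 0)"] that by (simp add: I_def coord_def t' inner_diff_left)
      have c2: "\<bar>(g c - g' c) \<bullet> b\<bar> \<le> \<epsilon> / d\<^sup>2" if "b \<in> Basis" "c \<in> Basis" for b c
        using t(2)[of "(b, c)"] that nonzero_Basis[OF that(2)] by (simp add: I_def coord_def t' inner_diff_left)
      have "norm (z - z') \<le> (\<Sum>b\<in>Basis. \<bar>(z - z') \<bullet> b\<bar>)" by (rule norm_le_l1)
      also have "\<dots> \<le> d * (\<epsilon> / d\<^sup>2)" unfolding d_def using c1 by (intro sum_bounded_above) (simp add: d_def)
      also have "\<dots> \<le> \<epsilon>" using d \<epsilon> by (simp add: power2_eq_square field_simps)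
      finally have 1: "norm (z - z') \<le> \<epsilon>" .
      have 2: "norm (g c - g' c) \<le> d * (\<epsilon> / d\<^sup>2)" if "c \<in> Basis" for c
        using norm_le_l1[of "g c - g' c"]
          sum_bounded_above[of Basis "\<lambda>b. \<bar>(g c - g' c) \<bullet> b\<bar>" "\<epsilon> / d\<^sup>2"] c2[OF _ that] by (auto simp: d_def)
      have "norm (g x - g' x) \<le> \<epsilon> * norm x" for x
      proof -
        have lin: "linear g" "linear g'" using gz g' by (auto intro: orthogonal_transformation_imp_linear)
        have "g x - g' x = (\<Sum>c\<in>Basis. (x \<bullet> c) *\<^sub>R (g c - g' c))"
        proof -
          have "h x = (\<Sum>c\<in>Basis. (x \<bullet> c) *\<^sub>R h c)" if "linear h" for h :: "'a \<Rightarrow> 'a"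
          proof -
            have "h x = h (\<Sum>c\<in>Basis. (x \<bullet> c) *\<^sub>R c)" by (simp add: euclidean_representation)
            also have "\<dots> = (\<Sum>c\<in>Basis. (x \<bullet> c) *\<^sub>R h c)"
              by (simp add: linear_sum[OF that] linear_scale[OF that])
            finally show ?thesis .
          qed
          from this[OF lin(1)] this[OF lin(2)]
          show ?thesis by (simp add: scaleR_diff_right sum_subtractf)
        qed
        also have "norm \<dots> \<le> (\<Sum>c\<in>(Basis::'a set). norm x * (d * (\<epsilon> / d\<^sup>2)))"
        proof (rule sum_norm_le)
          fix c :: 'a assume c: "c \<in> Basis"
          show "norm ((x \<bullet> c) *\<^sub>R (g c - g' c)) \<le> norm x * (d * (\<epsilon> / d\<^sup>2))"
            unfolding norm_scaleR using Basis_le_norm[OF c, of x] 2[OF c] by (intro mult_mono) auto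
        qed
        also have "\<dots> = d * (norm x * (d * (\<epsilon> / d\<^sup>2)))" by (simp add: d_def)
        also have "\<dots> = \<epsilon> * norm x" using d by (simp add: power2_eq_square)
        finally show ?thesis .
      qed
      with 1 show ?thesis by (intro bexI[OF _ t(1)]) (simp add: t')
    qed
    show "\<exists>T :: (('a \<Rightarrow> 'a) \<times> 'a) set. finite T \<and> real (card T) \<le> (2 * R * d\<^sup>2 + 3) ^ card I * (1 / \<epsilon>) ^ card I \<and>
      is_flat_net R \<epsilon> T"
      using T(1,2) card unfolding is_flat_net_def
      by (intro exI[of _ T] conjI allI impI net) (auto simp: S_def)
  qed
qed

section \<open>Covering numbers of slices\<close>

lemma cover_number_le:
  assumes "finite C" "E \<subseteq> (\<Union>c\<in>C. cball c r)"
  shows "cover_number E r \<le> card C"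
proof -
  have "card C \<in> {card C | C. finite C \<and> E \<subseteq> (\<Union>c\<in>C. cball c r)}" using assms by blast
  then show ?thesis unfolding cover_number_def by (intro cInf_lower bdd_belowI[of _ 0]) auto
qed

lemma cover_number_grid:
  fixes D :: "'a::euclidean_space set"
  assumes g: "orthogonal_transformation g" and D: "D \<subseteq> Basis" and "\<delta> > 0" and E: "bounded E"
    and r: "real (card D) * \<delta> \<le> r" and sub: "E \<subseteq> range (flat_map D g z)"
  shows "cover_number E r \<le> card (grid_index D g z \<delta> E)"
proof -
  let ?J = "grid_index D g z \<delta> E"
  have fJ: "finite ?J" by (intro finite_grid_index g D E \<open>\<delta> > 0\<close>)
  define p where "p j = (SOME t. t \<in> grid_cell D \<delta> j)" for j
  have p: "p j \<in> grid_cell D \<delta> j" if "j \<in> ?J" for j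
  proof -
    have "\<exists>t. t \<in> grid_cell D \<delta> j" using that unfolding grid_index_iff[OF \<open>\<delta> > 0\<close>] by blast
    then show ?thesis unfolding p_def by (rule someI_ex)
  qed
  have "E \<subseteq> (\<Union>c\<in>(\<lambda>j. flat_map D g z (p j)) ` ?J. cball c r)"
  proof
    fix x assume "x \<in> E"
    then obtain j t where j: "j \<in> ?J" "t \<in> grid_cell D \<delta> j" "x = flat_map D g z t"
      using grid_cover[OF \<open>\<delta> > 0\<close>, of E D g z] sub by blast
    have "dist (flat_map D g z (p j)) x \<le> real (card D) * \<delta>"
      unfolding j(3) by (rule flat_dist_le[OF g D grid_cell_coord_diff[OF \<open>\<delta> > 0\<close> p[OF j(1)] j(2)]])
    then have "x \<in> cball (flat_map D g z (p j)) r" using r by simp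
    then show "x \<in> (\<Union>c\<in>(\<lambda>j. flat_map D g z (p j)) ` ?J. cball c r)" using j(1) by blast
  qed
  then have "cover_number E r \<le> card ((\<lambda>j. flat_map D g z (p j)) ` ?J)" using fJ by (intro cover_number_le) auto
  also have "\<dots> \<le> card ?J" using fJ by (rule card_image_le)
  finally show ?thesis .
qed

section \<open>Box dimension and averaging over translates\<close>

text \<open>The hypothesis concerns slices of a whole neighbourhood of \<open>A\<close>. At a mesh
  comparable to 2^-n the cells meeting the slice are disjoint with images in that neighbourhood, so
  there are at most a constant times 2^((k - s) n) of them. A bound for \<open>A\<close> alone would
  not count cells.\<close>

lemma upper_box_dim_le:
  fixes A :: "'a::euclidean_space set"
  assumes k: "1 \<le> k" and kd: "k \<le> DIM('a)" and V: "V \<in> affine_planes k" and A: "bounded A" and s: "s \<le> real k"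
    and H: "\<And>n. hausdorff_measure k (open_nbhd A (2 powr (- real n)) \<inter> V) \<le> ennreal (K * 2 powr (- s * real n))"
  shows "upper_box_dim (V \<inter> A) \<le> ereal (real k - s)"
proof (cases "V \<inter> A = {}")
  case True
  then show ?thesis by (simp add: upper_box_dim_def)
next
  case False
  define E where "E = V \<inter> A"
  obtain x where x: "x \<in> V" using False by blast
  obtain D :: "'a set" where D: "D \<subseteq> Basis" "card D = k" using kd by (metis obtain_subset_with_card_n)
  obtain g where g: "orthogonal_transformation g" and Vg: "V = range (flat_map D g x)"
    using affine_plane_flat_map[of V D x] V x D by auto
  have E: "bounded E" using A bounded_subset by (auto simp: E_def)
  define c where "c = unit_ball_vol (real k) / 4 ^ k"
  have c: "c > 0" by (simp add: c_def)
  \<comment> \<open>\<open>K\<close> may be negative, and \<open>ennreal\<close> truncates negative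
    values to 0.\<close>
  define K1 where "K1 = max K 1"
  define K2 where "K2 = max 1 (K1 / c * (2 * real k) ^ k)"
  have K2: "K2 \<ge> 1" by (simp add: K2_def)
  have N: "real (cover_number E r) \<le> K2 * 2 powr ((real k - s) * real n)" if r: "2 powr (- real n) / 2 \<le> r" for r n
  proof -
    define \<eta> where "\<eta> = (2::real) powr (- real n)"
    define \<delta> where "\<delta> = \<eta> / (2 * real k)"
    have \<delta>: "\<delta> > 0" "real k * \<delta> = \<eta> / 2" "\<eta> > 0" using k by (auto simp: \<delta>_def \<eta>_def)
    let ?J = "grid_index D g x \<delta> E"
    have "cover_number E r \<le> card ?J"
      using r \<delta> D g E Vg by (intro cover_number_grid) (auto simp: \<eta>_def E_def)
    then have 1: "real (cover_number E r) \<le> real (card ?J)" by simp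
    have "ennreal c * ennreal (real (card ?J) * \<delta> ^ k) \<le> ennreal c * emeasure (flat_measure D g x) (open_nbhd E \<eta>)"
      using card_grid_index_le[OF g D(1) \<delta>(1) E, of \<eta> x] \<delta> D by (intro mult_left_mono) auto
    also have "\<dots> \<le> hausdorff_measure k (open_nbhd E \<eta> \<inter> V)"
      using flat_measure_le_hausdorff_measure[OF g D(1), of "open_nbhd E \<eta>" x]
      by (simp add: D(2) Vg c_def open_open_nbhd)
    also have "\<dots> \<le> hausdorff_measure k (open_nbhd A \<eta> \<inter> V)"
      by (intro hausdorff_measure_mono) (auto simp: open_nbhd_def E_def)
    also have "\<dots> \<le> ennreal (K * 2 powr (- s * real n))" unfolding \<eta>_def by (rule H)
    also have "\<dots> \<le> ennreal (K1 * 2 powr (- s * real n))"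
      by (intro ennreal_leI mult_right_mono) (auto simp: K1_def)
    finally have "ennreal (c * (real (card ?J) * \<delta> ^ k)) \<le> ennreal (K1 * 2 powr (- s * real n))"
      using c by (simp add: ennreal_mult')
    then have "c * (real (card ?J) * \<delta> ^ k) \<le> K1 * 2 powr (- s * real n)"
      by (subst (asm) ennreal_le_iff) (auto simp: K1_def)
    then have "real (card ?J) \<le> K1 * 2 powr (- s * real n) / (c * \<delta> ^ k)"
      using c \<delta> by (simp add: pos_le_divide_eq mult_ac)
    also have "\<dots> = K1 / c * (2 * real k) ^ k * (2 powr (- s * real n) / \<eta> ^ k)"
      using k by (simp add: \<delta>_def power_divide)
    also have "2 powr (- s * real n) / \<eta> ^ k = 2 powr ((real k - s) * real n)"
      by (simp add: \<eta>_def powr_power powr_diff[symmetric] algebra_simps)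
    also have "K1 / c * (2 * real k) ^ k * 2 powr ((real k - s) * real n) \<le> K2 * 2 powr ((real k - s) * real n)"
      by (intro mult_right_mono) (auto simp: K2_def)
    finally show ?thesis using 1 by linarith
  qed
  have bound: "ln (real (cover_number E r)) / - ln r \<le> (real k - s) + ln K2 * (1 / - ln r)" if r: "0 < r" "r < 1 / 2" for r
  proof -
    have lr: "- ln r > 0" using r by simp
    have lg: "- log 2 r > 0" using r by (simp add: log_def divide_neg_pos)
    \<comment> \<open>The dyadic scale with 2^-(n+1) < r \<le> 2^-n; the factor 2 between
      neighbouring scales is allowed for in the fact \<open>N\<close>.\<close>
    define n where "n = nat \<lfloor>- log 2 r\<rfloor>"
    have n: "real n \<le> - log 2 r" "- log 2 r < real n + 1" using lg by (auto simp: n_def)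
    have "2 powr (- real n) / 2 = 2 powr (- real n - 1)" by (simp add: powr_diff)
    also have "\<dots> \<le> 2 powr (log 2 r)" using n by (intro powr_mono) auto
    finally have "2 powr (- real n) / 2 \<le> r" using r by simp
    from N[OF this] have "real (cover_number E r) \<le> K2 * 2 powr ((real k - s) * real n)" .
    also have "\<dots> \<le> K2 * 2 powr ((real k - s) * (- log 2 r))"
      using n s K2 by (intro mult_left_mono powr_mono) auto
    also have "\<dots> = exp (ln K2 + (real k - s) * (- ln r))"
      using K2 unfolding exp_add by (simp add: powr_def log_def)
    finally have le: "real (cover_number E r) \<le> exp (ln K2 + (real k - s) * (- ln r))" .
    have "ln (real (cover_number E r)) \<le> ln K2 + (real k - s) * (- ln r)"
    proof (cases "cover_number E r = 0")
      \<comment> \<open>Here \<open>ln\<close> takes its default value 0.\<close>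
      case True
      moreover have "0 \<le> ln K2" "0 \<le> (real k - s) * (- ln r)" using K2 s lr by (simp, intro mult_nonneg_nonneg, auto)
      ultimately show ?thesis by simp
    next
      case False
      then have "exp (ln (real (cover_number E r))) \<le> exp (ln K2 + (real k - s) * (- ln r))" using le by simp
      then show ?thesis by (simp only: exp_le_cancel_iff)
    qed
    then have "ln (real (cover_number E r)) / - ln r \<le> (ln K2 + (real k - s) * (- ln r)) / - ln r"
      using lr by (intro divide_right_mono) auto
    also have "\<dots> = (real k - s) + ln K2 * (1 / - ln r)" using lr by (simp add: field_simps)
    finally show ?thesis .
  qed
  have lim: "((\<lambda>r. ereal ((real k - s) + ln K2 * (1 / - ln r))) \<longlongrightarrow> ereal ((real k - s) + ln K2 * 0)) (at_right (0::real))"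
  proof (intro tendsto_intros)
    have "filterlim (\<lambda>r::real. - ln r) at_top (at_right 0)"
      using ln_at_0 by (simp add: filterlim_uminus_at_top)
    then show "((\<lambda>r::real. 1 / - ln r) \<longlongrightarrow> 0) (at_right 0)"
      by (intro tendsto_divide_0[OF tendsto_const] filterlim_at_top_imp_at_infinity)
  qed
  have "upper_box_dim E = Limsup (at_right 0) (\<lambda>r. ereal (ln (real (cover_number E r)) / - ln r))"
    using False by (simp add: upper_box_dim_def E_def)
  also have "\<dots> \<le> Limsup (at_right 0) (\<lambda>r. ereal ((real k - s) + ln K2 * (1 / - ln r)))"
  proof (rule Limsup_mono)
    have "eventually (\<lambda>r. r \<in> {0<..<1/2}) (at_right (0::real))"
      by (rule eventually_at_right_real) simp
    then show "\<forall>\<^sub>F r in at_right 0. ereal (ln (real (cover_number E r)) / - ln r) \<le> ereal ((real k - s) + ln K2 * (1 / - ln r))"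
      by (rule eventually_mono) (use bound in simp)
  qed
  also have "\<dots> = ereal (real k - s)"
    using lim_imp_Limsup[OF _ lim] by (simp add: trivial_limit_at_right_real)
  finally show ?thesis by (simp add: E_def)
qed

section \<open>Averaging the flat measure over translated planes\<close>

lemma emeasure_flat_measure_nn_integral:
  assumes "linear g" "E \<in> sets borel"
  shows "emeasure (flat_measure D g z) E = (\<integral>\<^sup>+t. indicator E (flat_map D g z t) \<partial>PiM D (\<lambda>_. lborel))"
proof -
  have "emeasure (flat_measure D g z) E = integral\<^sup>N (flat_measure D g z) (indicator E)"
    using assms by simp
  also have "\<dots> = (\<integral>\<^sup>+t. indicator E (flat_map D g z t) \<partial>PiM D (\<lambda>_. lborel))"
    unfolding flat_measure_def using assms flat_map_measurable by (intro nn_integral_distr) auto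
  finally show ?thesis .
qed

text \<open>Double counting: the flat measures of \<open>S\<close> on all planes translated by less
  than \<rho> are integrated; by Fubini every parameter mapped into \<open>E\<close> contributes the
  volume of \<open>S\<close> near its image point, at least \<open>v\<close>. This serves when
  \<open>E\<close> is not contained in \<open>S\<close> but \<open>S\<close> fills a part of the
  volume near each point of \<open>E\<close>.\<close>

lemma flat_measure_average:
  fixes S :: "'a::euclidean_space set"
  assumes g: "orthogonal_transformation g" and D: "D \<subseteq> Basis"
    and S: "S \<in> sets borel" and E: "E \<in> sets borel" and m: "0 \<le> m"
    and S': "\<And>x. x \<in> E \<Longrightarrow> ennreal v \<le> emeasure lborel (S \<inter> ball x \<rho>)"
    and sup: "\<And>w. norm w < \<rho> \<Longrightarrow> emeasure (flat_measure D g (z + w)) S \<le> ennreal m"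
  shows "ennreal v * emeasure (flat_measure D g z) E \<le> emeasure lborel (ball (0::'a) \<rho>) * ennreal m"
proof -
  have fD: "finite D" using D finite_subset finite_Basis by blast
  note lin = orthogonal_transformation_imp_linear[OF g]
  interpret P: product_sigma_finite "\<lambda>_::'a. lborel :: real measure" by unfold_locales
  interpret PD: sigma_finite_measure "PiM D (\<lambda>_. lborel :: real measure)" by (rule P.sigma_finite[OF fD])
  interpret pair_sigma_finite "PiM D (\<lambda>_. lborel :: real measure)" "lborel :: 'a measure" by unfold_locales
  have [measurable]: "flat_map D g z \<in> borel_measurable (PiM D (\<lambda>_. lborel))" for z
    by (rule flat_map_measurable[OF lin])
  have ball [measurable]: "ball (0::'a) \<rho> \<in> sets borel" by simp
  note [measurable] = S E
  have shift: "flat_map D g (z + w) t = flat_map D g z t + w" for w t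
    by (simp add: flat_map_def)
  have "ennreal v * emeasure (flat_measure D g z) E
      = (\<integral>\<^sup>+t. ennreal v * indicator E (flat_map D g z t) \<partial>PiM D (\<lambda>_. lborel))"
    unfolding emeasure_flat_measure_nn_integral[OF lin E]
    by (rule nn_integral_cmult[symmetric]) measurable
  also have "\<dots> \<le> (\<integral>\<^sup>+t. (\<integral>\<^sup>+w. indicator (ball 0 \<rho>) w * indicator S (flat_map D g z t + w) \<partial>lborel) \<partial>PiM D (\<lambda>_. lborel))"
  proof (rule nn_integral_mono)
    fix t
    let ?x = "flat_map D g z t"
    have "(\<integral>\<^sup>+w. indicator (ball 0 \<rho>) w * indicator S (?x + w) \<partial>lborel)
        = (\<integral>\<^sup>+w. indicator (S \<inter> ball ?x \<rho>) (?x + w) \<partial>lborel)"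
      by (intro nn_integral_cong) (auto simp: indicator_def dist_norm norm_minus_commute)
    also have "\<dots> = (\<integral>\<^sup>+y. indicator (S \<inter> ball ?x \<rho>) y \<partial>distr lborel borel ((+) ?x))"
      using S by (intro nn_integral_distr[symmetric] borel_measurable_indicator) simp_all
    also have "\<dots> = emeasure lborel (S \<inter> ball ?x \<rho>)"
      using S by (simp add: lborel_distr_plus)
    finally show "ennreal v * indicator E ?x \<le> (\<integral>\<^sup>+w. indicator (ball 0 \<rho>) w * indicator S (?x + w) \<partial>lborel)"
      using S'[of ?x] by (auto simp: indicator_def)
  qed
  also have "\<dots> = (\<integral>\<^sup>+w. (\<integral>\<^sup>+t. indicator (ball 0 \<rho>) w * indicator S (flat_map D g z t + w) \<partial>PiM D (\<lambda>_. lborel)) \<partial>lborel)"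
    using S ball by (intro Fubini'[symmetric]) measurable
  also have "\<dots> = (\<integral>\<^sup>+w. indicator (ball 0 \<rho>) w * emeasure (flat_measure D g (z + w)) S \<partial>lborel)"
  proof (intro nn_integral_cong)
    fix w :: 'a
    have "(\<integral>\<^sup>+t. indicator S (flat_map D g z t + w) \<partial>PiM D (\<lambda>_. lborel)) = emeasure (flat_measure D g (z + w)) S"
      unfolding emeasure_flat_measure_nn_integral[OF lin S] shift ..
    then show "(\<integral>\<^sup>+t. indicator (ball 0 \<rho>) w * indicator S (flat_map D g z t + w) \<partial>PiM D (\<lambda>_. lborel))
        = indicator (ball 0 \<rho>) w * emeasure (flat_measure D g (z + w)) S"
      by (subst nn_integral_cmult) auto
  qed
  also have "\<dots> \<le> (\<integral>\<^sup>+w. indicator (ball (0::'a) \<rho>) w * ennreal m \<partial>lborel)"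
    using sup by (intro nn_integral_mono) (auto simp: indicator_def)
  also have "\<dots> = emeasure lborel (ball (0::'a) \<rho>) * ennreal m"
    using ball by (subst nn_integral_multc) (auto intro!: borel_measurable_indicator)
  finally show ?thesis .
qed

section \<open>Conditionally independent weights\<close>

text \<open>For y = -u < 0 the claim reads 1 \<le> (1 - u + u^2) exp u, and the bound 1 + u + u^2/2
  \<le> exp u reduces it to a polynomial whose coefficients are nonnegative.\<close>

lemma exp_le_quadratic:
  fixes y :: real
  assumes "\<bar>y\<bar> \<le> 1"
  shows "exp y \<le> 1 + y + y\<^sup>2"
proof (cases "0 \<le> y")
  case True
  then show ?thesis using assms by (intro exp_bound) auto
next
  case False
  define u where "u = - y"
  have u: "0 \<le> u" using False by (simp add: u_def)
  have e: "1 + u + u\<^sup>2 / 2 \<le> exp u" by (rule exp_lower_Taylor_quadratic[OF u])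
  have "1 \<le> (1 - u + u\<^sup>2) * (1 + u + u\<^sup>2 / 2)"
  proof -
    have "(1 - u + u\<^sup>2) * (1 + u + u\<^sup>2 / 2) = 1 + u\<^sup>2 / 2 + u ^ 3 / 2 + u ^ 4 / 2"
      by (simp add: power2_eq_square power3_eq_cube power4_eq_xxxx field_simps)
    then show ?thesis using u by simp
  qed
  also have "\<dots> \<le> (1 - u + u\<^sup>2) * exp u"
  proof (intro mult_left_mono e)
    have "0 \<le> (1 - u)\<^sup>2 + u" using u by simp
    then show "0 \<le> 1 - u + u\<^sup>2" using u by (simp add: power2_eq_square algebra_simps)
  qed
  finally have "exp (- u) \<le> 1 - u + u\<^sup>2" by (simp add: exp_minus field_simps)
  then show ?thesis by (simp add: u_def)
qed

text \<open>Layer-cake sum of mesh 1/(m+1): a bounded number becomes a finite combination of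
  indicators of level sets, up to one mesh. Its purpose is that \<open>cond_indep\<close> speaks of
  events only.\<close>

lemma dyadic_layers:
  fixes x :: real
  assumes "0 \<le> x" "x \<le> real n"
  shows "(\<Sum>i\<in>{1..n * Suc m}. 1 / real (Suc m) * of_bool (real i * (1 / real (Suc m)) \<le> x)) \<le> x"
    and "x - 1 / real (Suc m) \<le> (\<Sum>i\<in>{1..n * Suc m}. 1 / real (Suc m) * of_bool (real i * (1 / real (Suc m)) \<le> x))"
proof -
  define q where "q = real (Suc m)"
  have q: "q > 0" by (simp add: q_def)
  define f where "f = nat \<lfloor>x * q\<rfloor>"
  have f: "real f \<le> x * q" "x * q < real f + 1" using assms q by (auto simp: f_def)
  have "{i \<in> {1..n * Suc m}. real i * (1 / q) \<le> x} = {1..f}"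
  proof (intro set_eqI iffI; clarsimp)
    fix i assume "real i / q \<le> x" "Suc 0 \<le> i"
    then have "real i \<le> x * q" using q by (simp add: field_simps)
    then show "i \<le> f" using f by linarith
  next
    fix i assume i: "i \<le> f" "Suc 0 \<le> i"
    have "real f \<le> real n * q" using f(1) mult_right_mono[OF assms(2), of q] q by linarith
    then have "real f \<le> real (n * Suc m)" by (simp add: q_def algebra_simps)
    then have "f \<le> n * Suc m" by (simp only: of_nat_le_iff)
    moreover have "real i \<le> x * q" using i f by linarith
    ultimately show "i \<le> n + n * m \<and> real i / q \<le> x" using i q by (simp add: field_simps)
  qed
  then have eq: "(\<Sum>i\<in>{1..n * Suc m}. 1 / q * of_bool (real i * (1 / q) \<le> x)) = real f / q"
    by (simp add: of_bool_def sum.If_cases Int_def sum_distrib_left[symmetric] flip: sum_divide_distrib)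
  show "(\<Sum>i\<in>{1..n * Suc m}. 1 / real (Suc m) * of_bool (real i * (1 / real (Suc m)) \<le> x)) \<le> x"
    and "x - 1 / real (Suc m) \<le> (\<Sum>i\<in>{1..n * Suc m}. 1 / real (Suc m) * of_bool (real i * (1 / real (Suc m)) \<le> x))"
    unfolding q_def[symmetric] eq using f q
    by (simp_all add: pos_divide_le_eq pos_le_divide_eq diff_le_eq add_divide_distrib[symmetric] mult.commute add.commute)
qed

text \<open>Each \<open>X j\<close> is replaced by its layer sum, the product is multiplied out into
  events that all \<open>X j\<close> exceed given levels, and conditional independence factorises
  their conditional probabilities. As the mesh tends to 0, the conditional expectations of the layer
  sums tend to 1. The weight \<open>Z\<close> allows for coefficients that depend on the
  past.\<close>

lemma cond_indep_prod_expectation: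
  fixes X :: "'i \<Rightarrow> 'w \<Rightarrow> real"
  assumes M: "prob_space M" and sub: "subalgebra M G" and J: "finite J" and ci: "cond_indep M G X J"
    and X [measurable]: "\<And>j. j \<in> J \<Longrightarrow> X j \<in> borel_measurable M"
    and bd: "\<And>j \<omega>. j \<in> J \<Longrightarrow> \<omega> \<in> space M \<Longrightarrow> 0 \<le> X j \<omega> \<and> X j \<omega> \<le> C"
    and mean: "\<And>j. j \<in> J \<Longrightarrow> AE \<omega> in M. real_cond_exp M G (X j) \<omega> = 1"
    and Z [measurable]: "Z \<in> borel_measurable G" and ZB: "\<And>\<omega>. \<omega> \<in> space M \<Longrightarrow> \<bar>Z \<omega>\<bar> \<le> B"
  shows "(\<integral>\<omega>. Z \<omega> * (\<Prod>j\<in>J. X j \<omega>) \<partial>M) = (\<integral>\<omega>. Z \<omega> \<partial>M)"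
proof -
  interpret prob_space M by (rule M)
  interpret finite_measure_subalgebra M G by unfold_locales (rule sub)
  have [measurable]: "Z \<in> borel_measurable M" by (rule measurable_from_subalg[OF sub Z])
  have rceM [measurable]: "real_cond_exp M G f \<in> borel_measurable M" for f by simp
  define n0 where "n0 = nat \<lceil>C\<rceil>"
  define N where "N m = n0 * Suc m" for m
  define \<delta> where "\<delta> m = 1 / real (Suc m)" for m
  define I where "I m j i = (indicator (X j -` {real i * \<delta> m..} \<inter> space M) :: 'w \<Rightarrow> real)" for m j and i :: nat
  define Xm where "Xm m j \<omega> = (\<Sum>i\<in>{1..N m}. \<delta> m * I m j i \<omega>)" for m j \<omega>
  have \<delta>: "\<delta> m > 0" for m by (simp add: \<delta>_def)
  have [measurable]: "I m j i \<in> borel_measurable M" if "j \<in> J" for m j i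
    unfolding I_def by (intro borel_measurable_indicator measurable_sets[OF X[OF that]]) simp
  have [measurable]: "Xm m j \<in> borel_measurable M" if "j \<in> J" for m j
    unfolding Xm_def using that by measurable
  have I01: "0 \<le> I m j i \<omega>" "I m j i \<omega> \<le> 1" for m j i \<omega> by (auto simp: I_def)
  have intI: "integrable M (I m j i)" if "j \<in> J" for m j i
    using that by (intro integrable_const_bound[of _ 1]) (auto simp: I01 abs_le_iff intro: order_trans[OF _ I01(1)])
  have approx: "X j \<omega> - \<delta> m \<le> Xm m j \<omega>" "Xm m j \<omega> \<le> X j \<omega>" if "j \<in> J" "\<omega> \<in> space M" for m j \<omega>
  proof -
    have "X j \<omega> \<le> real n0" using bd[OF that] unfolding n0_def by linarith
    moreover have "Xm m j \<omega> = (\<Sum>i\<in>{1..n0 * Suc m}. 1 / real (Suc m) * of_bool (real i * (1 / real (Suc m)) \<le> X j \<omega>))"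
      unfolding Xm_def N_def \<delta>_def I_def using that by (intro sum.cong) (auto simp: indicator_def)
    ultimately show "X j \<omega> - \<delta> m \<le> Xm m j \<omega>" "Xm m j \<omega> \<le> X j \<omega>"
      using dyadic_layers[of "X j \<omega>" n0 m] bd[OF that] by (auto simp: \<delta>_def)
  qed
  have Xm0: "0 \<le> Xm m j \<omega>" for m j \<omega> unfolding Xm_def using \<delta>[of m] I01 by (intro sum_nonneg) auto
  have XmC: "Xm m j \<omega> \<le> C" if "j \<in> J" "\<omega> \<in> space M" for m j \<omega>
    using approx(2)[OF that, of m] bd[OF that] by simp
  have intX: "integrable M (X j)" "integrable M (Xm m j)" if "j \<in> J" for j m
    using that bd XmC Xm0 by (auto intro!: integrable_const_bound[of _ C])
  have prod_bd: "\<bar>\<Prod>j\<in>J. f j\<bar> \<le> (max C 1) ^ card J" if "\<And>j. j \<in> J \<Longrightarrow> 0 \<le> f j \<and> f j \<le> C" for f :: "'i \<Rightarrow> real"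
  proof -
    have "\<bar>\<Prod>j\<in>J. f j\<bar> = (\<Prod>j\<in>J. \<bar>f j\<bar>)" by (rule abs_prod)
    also have "\<dots> \<le> (\<Prod>j\<in>J. max C 1)" using that by (intro prod_mono) fastforce
    finally show ?thesis by simp
  qed
  have cond: "AE \<omega> in M. real_cond_exp M G (\<lambda>\<omega>. \<Prod>j\<in>J. Xm m j \<omega>) \<omega> = (\<Prod>j\<in>J. real_cond_exp M G (Xm m j) \<omega>)" for m
  proof -
    \<comment> \<open>A function \<phi> chooses one layer for each \<open>j\<close>; distributivity
      turns the product of sums into a sum over these choices.\<close>
    let ?\<Phi> = "PiE J (\<lambda>_. {1..N m})"
    have fin: "finite ?\<Phi>" using J by (intro finite_PiE) auto
    define IJ where "IJ \<phi> = (indicator ((\<Inter>j\<in>J. X j -` {real (\<phi> j) * \<delta> m..}) \<inter> space M) :: 'w \<Rightarrow> real)" for \<phi> :: "'i \<Rightarrow> nat"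
    have IJset: "(\<Inter>j\<in>J. X j -` {real (\<phi> j) * \<delta> m..}) \<inter> space M \<in> sets M" for \<phi> :: "'i \<Rightarrow> nat"
    proof -
      have "(\<Inter>j\<in>J. X j -` {real (\<phi> j) * \<delta> m..}) \<inter> space M = {\<omega>\<in>space M. \<forall>j\<in>J. real (\<phi> j) * \<delta> m \<le> X j \<omega>}" by auto
      also have "\<dots> \<in> sets M" using J X by measurable
      finally show ?thesis .
    qed
    have [measurable]: "IJ \<phi> \<in> borel_measurable M" for \<phi>
      unfolding IJ_def using IJset by (intro borel_measurable_indicator) auto
    have intIJ: "integrable M (IJ \<phi>)" for \<phi>
      unfolding IJ_def using IJset by (intro integrable_real_indicator) (auto simp: emeasure_eq_measure)
    have expand: "(\<Prod>j\<in>J. Xm m j \<omega>) = (\<Sum>\<phi>\<in>?\<Phi>. \<delta> m ^ card J * IJ \<phi> \<omega>)" if "\<omega> \<in> space M" for \<omega>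
    proof -
      have "(\<Prod>j\<in>J. Xm m j \<omega>) = (\<Sum>\<phi>\<in>?\<Phi>. \<Prod>j\<in>J. \<delta> m * I m j (\<phi> j) \<omega>)"
        unfolding Xm_def using J by (subst prod_sum_PiE) auto
      also have "\<dots> = (\<Sum>\<phi>\<in>?\<Phi>. \<delta> m ^ card J * IJ \<phi> \<omega>)"
      proof (intro sum.cong refl)
        fix \<phi>
        have "(\<Prod>j\<in>K. I m j (\<phi> j) \<omega>) = indicator ((\<Inter>j\<in>K. X j -` {real (\<phi> j) * \<delta> m..}) \<inter> space M) \<omega>"
          if "finite K" for K
          using that \<open>\<omega> \<in> space M\<close> by (induction K rule: finite_induct) (auto simp: I_def indicator_def)
        from this[OF J] have "(\<Prod>j\<in>J. I m j (\<phi> j) \<omega>) = IJ \<phi> \<omega>" by (simp add: IJ_def)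
        then show "(\<Prod>j\<in>J. \<delta> m * I m j (\<phi> j) \<omega>) = \<delta> m ^ card J * IJ \<phi> \<omega>"
          by (simp add: prod.distrib)
      qed
      finally show ?thesis .
    qed
    have 1: "AE \<omega> in M. real_cond_exp M G (\<lambda>\<omega>. \<Prod>j\<in>J. Xm m j \<omega>) \<omega> = real_cond_exp M G (\<lambda>\<omega>. \<Sum>\<phi>\<in>?\<Phi>. \<delta> m ^ card J * IJ \<phi> \<omega>) \<omega>"
      by (intro real_cond_exp_cong) (auto simp: expand intro!: AE_I2)
    have 2: "AE \<omega> in M. real_cond_exp M G (\<lambda>\<omega>. \<Sum>\<phi>\<in>?\<Phi>. \<delta> m ^ card J * IJ \<phi> \<omega>) \<omega>
        = (\<Sum>\<phi>\<in>?\<Phi>. real_cond_exp M G (\<lambda>\<omega>. \<delta> m ^ card J * IJ \<phi> \<omega>) \<omega>)"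
      by (intro real_cond_exp_sum) (auto intro: intIJ)
    have 3: "AE \<omega> in M. \<forall>\<phi>\<in>?\<Phi>. real_cond_exp M G (\<lambda>\<omega>. \<delta> m ^ card J * IJ \<phi> \<omega>) \<omega>
        = \<delta> m ^ card J * real_cond_exp M G (IJ \<phi>) \<omega>"
      using fin intIJ by (intro AE_finite_allI) auto
    have 4: "AE \<omega> in M. \<forall>\<phi>\<in>?\<Phi>. real_cond_exp M G (IJ \<phi>) \<omega> = (\<Prod>j\<in>J. real_cond_exp M G (I m j (\<phi> j)) \<omega>)"
    proof (intro AE_finite_allI fin)
      fix \<phi> assume "\<phi> \<in> ?\<Phi>"
      show "AE \<omega> in M. real_cond_exp M G (IJ \<phi>) \<omega> = (\<Prod>j\<in>J. real_cond_exp M G (I m j (\<phi> j)) \<omega>)"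
        using ci[unfolded cond_indep_def, rule_format, of "\<lambda>j. {real (\<phi> j) * \<delta> m..}"]
        unfolding IJ_def I_def by auto
    qed
    have 5: "AE \<omega> in M. \<forall>j\<in>J. real_cond_exp M G (Xm m j) \<omega> = (\<Sum>i\<in>{1..N m}. \<delta> m * real_cond_exp M G (I m j i) \<omega>)"
    proof (intro AE_finite_allI J)
      fix j assume j: "j \<in> J"
      have a: "AE \<omega> in M. real_cond_exp M G (Xm m j) \<omega> = (\<Sum>i\<in>{1..N m}. real_cond_exp M G (\<lambda>\<omega>. \<delta> m * I m j i \<omega>) \<omega>)"
        unfolding Xm_def using intI[OF j] by (intro real_cond_exp_sum) auto
      have b: "AE \<omega> in M. \<forall>i\<in>{1..N m}. real_cond_exp M G (\<lambda>\<omega>. \<delta> m * I m j i \<omega>) \<omega> = \<delta> m * real_cond_exp M G (I m j i) \<omega>"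
        using intI[OF j] by (intro AE_finite_allI) auto
      show "AE \<omega> in M. real_cond_exp M G (Xm m j) \<omega> = (\<Sum>i\<in>{1..N m}. \<delta> m * real_cond_exp M G (I m j i) \<omega>)"
        using a b by eventually_elim simp
    qed
    show ?thesis using 1 2 3 4 5
    proof eventually_elim
      case (elim \<omega>)
      have "(\<Prod>j\<in>J. real_cond_exp M G (Xm m j) \<omega>) = (\<Prod>j\<in>J. \<Sum>i\<in>{1..N m}. \<delta> m * real_cond_exp M G (I m j i) \<omega>)"
        using elim(5) by simp
      also have "\<dots> = (\<Sum>\<phi>\<in>?\<Phi>. \<Prod>j\<in>J. \<delta> m * real_cond_exp M G (I m j (\<phi> j)) \<omega>)"
        using J by (subst prod_sum_PiE) auto
      also have "\<dots> = (\<Sum>\<phi>\<in>?\<Phi>. \<delta> m ^ card J * real_cond_exp M G (IJ \<phi>) \<omega>)"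
        using elim(4) by (intro sum.cong) (auto simp: prod.distrib)
      also have "\<dots> = real_cond_exp M G (\<lambda>\<omega>. \<Prod>j\<in>J. Xm m j \<omega>) \<omega>"
        using elim(1-3) by simp
      finally show ?case by simp
    qed
  qed
  have eq: "(\<integral>\<omega>. Z \<omega> * (\<Prod>j\<in>J. Xm m j \<omega>) \<partial>M) = (\<integral>\<omega>. Z \<omega> * (\<Prod>j\<in>J. real_cond_exp M G (Xm m j) \<omega>) \<partial>M)" for m
  proof -
    have int: "integrable M (\<lambda>\<omega>. Z \<omega> * (\<Prod>j\<in>J. Xm m j \<omega>))"
    proof (rule integrable_const_bound[of _ "B * max C 1 ^ card J"])
      show "AE \<omega> in M. norm (Z \<omega> * (\<Prod>j\<in>J. Xm m j \<omega>)) \<le> B * max C 1 ^ card J"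
      proof (rule AE_I2)
        fix \<omega> assume \<omega>: "\<omega> \<in> space M"
        show "norm (Z \<omega> * (\<Prod>j\<in>J. Xm m j \<omega>)) \<le> B * max C 1 ^ card J"
          unfolding real_norm_def abs_mult using ZB[OF \<omega>] \<omega>
          by (intro mult_mono prod_bd) (auto simp: Xm0 XmC)
      qed
    qed measurable
    have "(\<integral>\<omega>. Z \<omega> * (\<Prod>j\<in>J. Xm m j \<omega>) \<partial>M) = (\<integral>\<omega>. Z \<omega> * real_cond_exp M G (\<lambda>\<omega>. \<Prod>j\<in>J. Xm m j \<omega>) \<omega> \<partial>M)"
      by (intro real_cond_exp_intg(2)[symmetric] int) measurable
    also have "\<dots> = (\<integral>\<omega>. Z \<omega> * (\<Prod>j\<in>J. real_cond_exp M G (Xm m j) \<omega>) \<partial>M)"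
      using cond[of m] by (intro integral_cong_AE) (auto elim!: eventually_mono)
    finally show ?thesis .
  qed
  have \<delta>0: "\<delta> \<longlonglongrightarrow> 0" unfolding \<delta>_def using LIMSEQ_inverse_real_of_nat by (simp add: inverse_eq_divide)
  have lim1: "(\<lambda>m. \<integral>\<omega>. Z \<omega> * (\<Prod>j\<in>J. Xm m j \<omega>) \<partial>M) \<longlonglongrightarrow> (\<integral>\<omega>. Z \<omega> * (\<Prod>j\<in>J. X j \<omega>) \<partial>M)"
  proof (rule integral_dominated_convergence[where w="\<lambda>_. B * max C 1 ^ card J"])
    show "AE \<omega> in M. (\<lambda>m. Z \<omega> * (\<Prod>j\<in>J. Xm m j \<omega>)) \<longlonglongrightarrow> Z \<omega> * (\<Prod>j\<in>J. X j \<omega>)"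
    proof (rule AE_I2, intro tendsto_mult tendsto_const tendsto_prod)
      fix \<omega> j assume "\<omega> \<in> space M" "j \<in> J"
      show "(\<lambda>m. Xm m j \<omega>) \<longlonglongrightarrow> X j \<omega>"
      proof (rule real_tendsto_sandwich)
        show "(\<lambda>m. X j \<omega> - \<delta> m) \<longlonglongrightarrow> X j \<omega>" using tendsto_diff[OF tendsto_const \<delta>0, of "X j \<omega>"] by simp
        show "(\<lambda>m. X j \<omega>) \<longlonglongrightarrow> X j \<omega>" by simp
      qed (auto intro!: always_eventually approx \<open>\<omega> \<in> space M\<close> \<open>j \<in> J\<close>)
    qed
    show "AE \<omega> in M. norm (Z \<omega> * (\<Prod>j\<in>J. Xm m j \<omega>)) \<le> B * max C 1 ^ card J" for m
    proof (rule AE_I2)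
      fix \<omega> assume \<omega>: "\<omega> \<in> space M"
      show "norm (Z \<omega> * (\<Prod>j\<in>J. Xm m j \<omega>)) \<le> B * max C 1 ^ card J"
        unfolding real_norm_def abs_mult using ZB[OF \<omega>] \<omega>
        by (intro mult_mono prod_bd) (auto simp: Xm0 XmC)
    qed
  qed measurable
  \<comment> \<open>The layer sums lie between \<open>X j - \<delta> m\<close> and
    \<open>X j\<close>, whose conditional mean is 1. This gives both the limit and the domination
    for the right-hand sides.\<close>
  have rce: "AE \<omega> in M. \<forall>m. \<forall>j\<in>J. 1 - \<delta> m \<le> real_cond_exp M G (Xm m j) \<omega> \<and> real_cond_exp M G (Xm m j) \<omega> \<le> 1"
  proof (unfold AE_all_countable, intro allI AE_finite_allI J)
    fix m j assume j: "j \<in> J"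
    have c: "AE \<omega> in M. real_cond_exp M G (\<lambda>_. \<delta> m) \<omega> = \<delta> m"
      by (rule real_cond_exp_F_meas) auto
    have d: "AE \<omega> in M. real_cond_exp M G (\<lambda>\<omega>. X j \<omega> - \<delta> m) \<omega> = real_cond_exp M G (X j) \<omega> - real_cond_exp M G (\<lambda>_. \<delta> m) \<omega>"
      using intX[OF j] by (intro real_cond_exp_diff) auto
    have u: "AE \<omega> in M. real_cond_exp M G (\<lambda>\<omega>. X j \<omega> - \<delta> m) \<omega> \<le> real_cond_exp M G (Xm m j) \<omega>"
      using intX[OF j] approx(1)[OF j] by (intro real_cond_exp_mono) (auto intro!: AE_I2)
    have l: "AE \<omega> in M. real_cond_exp M G (Xm m j) \<omega> \<le> real_cond_exp M G (X j) \<omega>"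
      using intX[OF j] approx(2)[OF j] by (intro real_cond_exp_mono) (auto intro!: AE_I2)
    show "AE \<omega> in M. 1 - \<delta> m \<le> real_cond_exp M G (Xm m j) \<omega> \<and> real_cond_exp M G (Xm m j) \<omega> \<le> 1"
      using c d u l mean[OF j] by eventually_elim auto
  qed
  have lim2: "(\<lambda>m. \<integral>\<omega>. Z \<omega> * (\<Prod>j\<in>J. real_cond_exp M G (Xm m j) \<omega>) \<partial>M) \<longlonglongrightarrow> (\<integral>\<omega>. Z \<omega> * (\<Prod>j\<in>J. 1) \<partial>M)"
  proof (rule integral_dominated_convergence[where w="\<lambda>_. B"])
    show "AE \<omega> in M. (\<lambda>m. Z \<omega> * (\<Prod>j\<in>J. real_cond_exp M G (Xm m j) \<omega>)) \<longlonglongrightarrow> Z \<omega> * (\<Prod>j\<in>J. 1)"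
      using rce
    proof eventually_elim
      case (elim \<omega>)
      show ?case
      proof (intro tendsto_mult tendsto_const tendsto_prod)
        fix j assume "j \<in> J"
        show "(\<lambda>m. real_cond_exp M G (Xm m j) \<omega>) \<longlonglongrightarrow> 1"
        proof (rule real_tendsto_sandwich)
          show "(\<lambda>m. 1 - \<delta> m) \<longlonglongrightarrow> 1" using tendsto_diff[OF tendsto_const \<delta>0, of 1] by simp
          show "(\<lambda>m. 1) \<longlonglongrightarrow> (1::real)" by simp
        qed (use elim \<open>j \<in> J\<close> in \<open>auto intro!: always_eventually\<close>)
      qed
    qed
    show "AE \<omega> in M. norm (Z \<omega> * (\<Prod>j\<in>J. real_cond_exp M G (Xm m j) \<omega>)) \<le> B" for m
      using rce AE_space
    proof eventually_elim
      case (elim \<omega>)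
      have \<delta>1: "\<delta> m \<le> 1" by (simp add: \<delta>_def)
      have r: "0 \<le> real_cond_exp M G (Xm m j) \<omega>" "real_cond_exp M G (Xm m j) \<omega> \<le> 1" if "j \<in> J" for j
      proof -
        have "1 - \<delta> m \<le> real_cond_exp M G (Xm m j) \<omega>" "real_cond_exp M G (Xm m j) \<omega> \<le> 1" using elim(1) that by auto
        then show "0 \<le> real_cond_exp M G (Xm m j) \<omega>" "real_cond_exp M G (Xm m j) \<omega> \<le> 1" using \<delta>1 by auto
      qed
      have p1: "(\<Prod>j\<in>J. real_cond_exp M G (Xm m j) \<omega>) \<le> 1" by (intro prod_le_1) (auto simp: r)
      have p0: "0 \<le> (\<Prod>j\<in>J. real_cond_exp M G (Xm m j) \<omega>)" by (intro prod_nonneg) (auto simp: r)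
      have "norm (Z \<omega> * (\<Prod>j\<in>J. real_cond_exp M G (Xm m j) \<omega>)) = \<bar>Z \<omega>\<bar> * (\<Prod>j\<in>J. real_cond_exp M G (Xm m j) \<omega>)"
        unfolding real_norm_def abs_mult using p0 by simp
      also have "\<dots> \<le> \<bar>Z \<omega>\<bar> * 1" by (intro mult_left_mono p1) simp
      finally show ?case using ZB[OF elim(2)] by linarith
    qed
  qed measurable
  show ?thesis
    using LIMSEQ_unique[OF lim1[unfolded eq] lim2] by simp
qed

text \<open>The factors are written as cX + (1 - c) and expanded over subsets. Each term keeps its
  expectation when its variables are replaced by 1, and the expansion then collapses to the product
  of c + (1 - c) = 1. The range [0,1] of the coefficients keeps all terms bounded.\<close>

lemma cond_indep_affine_product:
  fixes X :: "'i \<Rightarrow> 'w \<Rightarrow> real"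
  assumes M: "prob_space M" and sub: "subalgebra M G" and J: "finite J"
    and ci: "\<And>K. K \<subseteq> J \<Longrightarrow> cond_indep M G X K"
    and X: "\<And>j. j \<in> J \<Longrightarrow> X j \<in> borel_measurable M"
    and bd: "\<And>j \<omega>. j \<in> J \<Longrightarrow> \<omega> \<in> space M \<Longrightarrow> 0 \<le> X j \<omega> \<and> X j \<omega> \<le> C"
    and mean: "\<And>j. j \<in> J \<Longrightarrow> AE \<omega> in M. real_cond_exp M G (X j) \<omega> = 1"
    and c: "\<And>j. j \<in> J \<Longrightarrow> c j \<in> borel_measurable G"
    and cb: "\<And>j \<omega>. j \<in> J \<Longrightarrow> \<omega> \<in> space M \<Longrightarrow> 0 \<le> c j \<omega> \<and> c j \<omega> \<le> 1"
  shows "(\<integral>\<omega>. (\<Prod>j\<in>J. 1 + c j \<omega> * (X j \<omega> - 1)) \<partial>M) = 1"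
proof -
  interpret prob_space M by (rule M)
  have cM: "c j \<in> borel_measurable M" if "j \<in> J" for j
    by (rule measurable_from_subalg[OF sub c[OF that]])
  define Z where "Z B \<omega> = (\<Prod>j\<in>B. c j \<omega>) * (\<Prod>j\<in>J - B. 1 - c j \<omega>)" for B \<omega>
  have ZG: "Z B \<in> borel_measurable G" if "B \<subseteq> J" for B
    unfolding Z_def using c that by (intro borel_measurable_times borel_measurable_prod borel_measurable_diff) auto
  have ZM: "Z B \<in> borel_measurable M" if "B \<subseteq> J" for B
    by (rule measurable_from_subalg[OF sub ZG[OF that]])
  have Zb: "\<bar>Z B \<omega>\<bar> \<le> 1" if "B \<subseteq> J" "\<omega> \<in> space M" for B \<omega>
  proof -
    have "0 \<le> (\<Prod>j\<in>B. c j \<omega>)" "(\<Prod>j\<in>B. c j \<omega>) \<le> 1"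
      using cb that by (auto intro!: prod_nonneg prod_le_1)
    moreover have "0 \<le> (\<Prod>j\<in>J - B. 1 - c j \<omega>)" "(\<Prod>j\<in>J - B. 1 - c j \<omega>) \<le> 1"
      using cb that by (auto intro!: prod_nonneg prod_le_1)
    ultimately show ?thesis unfolding Z_def abs_mult by (intro mult_le_one) auto
  qed
  have XB: "\<bar>\<Prod>j\<in>B. X j \<omega>\<bar> \<le> max C 1 ^ card J" if "B \<subseteq> J" "\<omega> \<in> space M" for B \<omega>
  proof -
    have "\<bar>\<Prod>j\<in>B. X j \<omega>\<bar> = (\<Prod>j\<in>B. \<bar>X j \<omega>\<bar>)" by (rule abs_prod)
    also have "\<dots> \<le> (\<Prod>j\<in>B. max C 1)" using that bd by (intro prod_mono) fastforce
    also have "\<dots> = max C 1 ^ card B" by simp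
    also have "\<dots> \<le> max C 1 ^ card J" using that J by (intro power_increasing card_mono) auto
    finally show ?thesis .
  qed
  have Zint: "integrable M (\<lambda>\<omega>. Z B \<omega>)" if "B \<subseteq> J" for B
    using that Zb ZM by (intro integrable_const_bound[of _ 1]) auto
  have ZXint: "integrable M (\<lambda>\<omega>. Z B \<omega> * (\<Prod>j\<in>B. X j \<omega>))" if "B \<subseteq> J" for B
  proof (rule integrable_const_bound[of _ "1 * max C 1 ^ card J"])
    show "AE \<omega> in M. norm (Z B \<omega> * (\<Prod>j\<in>B. X j \<omega>)) \<le> 1 * max C 1 ^ card J"
      unfolding real_norm_def abs_mult using that by (intro AE_I2 mult_mono Zb XB) auto
    show "(\<lambda>\<omega>. Z B \<omega> * (\<Prod>j\<in>B. X j \<omega>)) \<in> borel_measurable M"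
      using that X by (intro borel_measurable_times ZM borel_measurable_prod) auto
  qed
  have "(\<integral>\<omega>. (\<Prod>j\<in>J. 1 + c j \<omega> * (X j \<omega> - 1)) \<partial>M) = (\<integral>\<omega>. (\<Sum>B\<in>Pow J. Z B \<omega> * (\<Prod>j\<in>B. X j \<omega>)) \<partial>M)"
  proof (intro Bochner_Integration.integral_cong refl)
    fix \<omega>
    have "(\<Prod>j\<in>J. 1 + c j \<omega> * (X j \<omega> - 1)) = (\<Prod>j\<in>J. c j \<omega> * X j \<omega> + (1 - c j \<omega>))"
      by (intro prod.cong) (auto simp: algebra_simps)
    also have "\<dots> = (\<Sum>B\<in>Pow J. Z B \<omega> * (\<Prod>j\<in>B. X j \<omega>))"
      unfolding prod_add[OF J] Z_def by (simp add: prod.distrib mult_ac)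
    finally show "(\<Prod>j\<in>J. 1 + c j \<omega> * (X j \<omega> - 1)) = (\<Sum>B\<in>Pow J. Z B \<omega> * (\<Prod>j\<in>B. X j \<omega>))" .
  qed
  also have "\<dots> = (\<Sum>B\<in>Pow J. \<integral>\<omega>. Z B \<omega> * (\<Prod>j\<in>B. X j \<omega>) \<partial>M)"
    using ZXint by (intro Bochner_Integration.integral_sum) auto
  also have "\<dots> = (\<Sum>B\<in>Pow J. \<integral>\<omega>. Z B \<omega> \<partial>M)"
  proof (intro sum.cong refl)
    fix B assume "B \<in> Pow J"
    then have B: "B \<subseteq> J" by simp
    have fB: "finite B" using B J by (rule finite_subset)
    show "(\<integral>\<omega>. Z B \<omega> * (\<Prod>j\<in>B. X j \<omega>) \<partial>M) = (\<integral>\<omega>. Z B \<omega> \<partial>M)"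
      by (rule cond_indep_prod_expectation[OF M sub fB ci[OF B], where C=C and B=1])
        (use B X bd mean ZG Zb in auto)
  qed
  also have "\<dots> = (\<integral>\<omega>. (\<Sum>B\<in>Pow J. Z B \<omega>) \<partial>M)"
    using Zint by (intro Bochner_Integration.integral_sum[symmetric]) auto
  also have "\<dots> = (\<integral>\<omega>. 1 \<partial>M)"
  proof (intro Bochner_Integration.integral_cong refl)
    fix \<omega>
    have "(\<Sum>B\<in>Pow J. Z B \<omega>) = (\<Prod>j\<in>J. c j \<omega> + (1 - c j \<omega>))"
      unfolding prod_add[OF J] Z_def by simp
    then show "(\<Sum>B\<in>Pow J. Z B \<omega>) = 1" by simp
  qed
  finally show ?thesis by (simp add: prob_space)
qed

text \<open>With a random coefficient b known from the past, exp(b (w - 1)) is not a function of the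
  weight alone, whereas a bound affine in \<open>w\<close> fits the affine product formula. The
  correction s = C^2 b^2 dominates the square of b (w - 1), and the division by 1 + s comes from
  exp(-s) \<le> 1/(1 + s).\<close>

lemma exp_le_affine:
  fixes b w C :: real
  assumes "0 \<le> b" "b * C \<le> 1" "0 \<le> w" "w \<le> C" "1 \<le> C"
  shows "exp (b * (w - 1) - C\<^sup>2 * b\<^sup>2) \<le> 1 + b / (1 + C\<^sup>2 * b\<^sup>2) * (w - 1)"
proof -
  define y s where "y = b * (w - 1)" and "s = C\<^sup>2 * b\<^sup>2"
  have "\<bar>w - 1\<bar> \<le> C" using assms by linarith
  then have "\<bar>y\<bar> \<le> b * C" unfolding y_def abs_mult using assms by (simp add: mult_left_mono)
  then have y: "\<bar>y\<bar> \<le> 1" "y\<^sup>2 \<le> s"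
    using assms power_mono[of "\<bar>y\<bar>" "b * C" 2] by (auto simp: s_def power_mult_distrib mult.commute)
  have s: "0 \<le> s" by (simp add: s_def)
  have p: "0 \<le> 1 + y + s" using y s by linarith
  have "exp (y - s) = exp y * exp (- s)" by (simp flip: exp_add)
  also have "\<dots> \<le> (1 + y + s) * exp (- s)"
    using exp_le_quadratic[OF y(1)] y(2) by (intro mult_right_mono) auto
  also have "\<dots> \<le> (1 + y + s) * (1 / (1 + s))"
  proof (intro mult_left_mono p)
    have "1 + s \<le> exp s" by (rule exp_ge_add_one_self)
    then show "exp (- s) \<le> 1 / (1 + s)" using s by (simp add: exp_minus inverse_eq_divide frac_le)
  qed
  also have "\<dots> = 1 + b / (1 + s) * (w - 1)" using s by (simp add: y_def field_simps)
  finally show ?thesis by (simp add: y_def s_def)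
qed

text \<open>Independence is only available within a colour class. Convexity of the exponential reduces
  the sum over all classes to the classes, at the price of the factor \<^term>\<open>N\<close>.\<close>

lemma cond_indep_exp_moment:
  fixes X :: "'i \<Rightarrow> 'w \<Rightarrow> real" and col :: "'i \<Rightarrow> nat"
  assumes M: "prob_space M" and sub: "subalgebra M G" and J: "finite J"
    and N: "1 \<le> N" and col: "\<And>j. j \<in> J \<Longrightarrow> col j < N"
    and ci: "\<And>K i. K \<subseteq> {j \<in> J. col j = i} \<Longrightarrow> cond_indep M G X K"
    and X: "\<And>j. j \<in> J \<Longrightarrow> X j \<in> borel_measurable M"
    and C: "1 \<le> C" and bd: "\<And>j \<omega>. j \<in> J \<Longrightarrow> \<omega> \<in> space M \<Longrightarrow> 0 \<le> X j \<omega> \<and> X j \<omega> \<le> C"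
    and mean: "\<And>j. j \<in> J \<Longrightarrow> AE \<omega> in M. real_cond_exp M G (X j) \<omega> = 1"
    and a: "\<And>j. j \<in> J \<Longrightarrow> a j \<in> borel_measurable G"
    and ab: "\<And>j \<omega>. j \<in> J \<Longrightarrow> \<omega> \<in> space M \<Longrightarrow> 0 \<le> a j \<omega> \<and> real N * a j \<omega> * C \<le> 1"
  shows "integrable M (\<lambda>\<omega>. exp ((\<Sum>j\<in>J. a j \<omega> * (X j \<omega> - 1)) - real N * C\<^sup>2 * (\<Sum>j\<in>J. (a j \<omega>)\<^sup>2)))"
    and "(\<integral>\<omega>. exp ((\<Sum>j\<in>J. a j \<omega> * (X j \<omega> - 1)) - real N * C\<^sup>2 * (\<Sum>j\<in>J. (a j \<omega>)\<^sup>2)) \<partial>M) \<le> 1"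
proof -
  interpret prob_space M by (rule M)
  \<comment> \<open>Jensen with N weights 1/N multiplies the coefficients by N; the term N C^2 a^2
    of the claim is C^2 b^2 / N.\<close>
  define b where "b j \<omega> = real N * a j \<omega>" for j \<omega>
  define c where "c j \<omega> = b j \<omega> / (1 + C\<^sup>2 * (b j \<omega>)\<^sup>2)" for j \<omega>
  define Ji where "Ji i = {j \<in> J. col j = i}" for i
  define P where "P i \<omega> = (\<Prod>j\<in>Ji i. 1 + c j \<omega> * (X j \<omega> - 1))" for i \<omega>
  define S where "S \<omega> = (\<Sum>j\<in>J. a j \<omega> * (X j \<omega> - 1)) - real N * C\<^sup>2 * (\<Sum>j\<in>J. (a j \<omega>)\<^sup>2)" for \<omega>
  define Si where "Si i \<omega> = (\<Sum>j\<in>Ji i. b j \<omega> * (X j \<omega> - 1) - C\<^sup>2 * (b j \<omega>)\<^sup>2)" for i \<omega>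
  have fJi: "finite (Ji i)" for i using J by (simp add: Ji_def)
  have aM: "a j \<in> borel_measurable M" if "j \<in> J" for j
    by (rule measurable_from_subalg[OF sub a[OF that]])
  have b: "0 \<le> b j \<omega>" "b j \<omega> * C \<le> 1" if "j \<in> J" "\<omega> \<in> space M" for j \<omega>
    using ab[OF that] by (auto simp: b_def)
  have cG: "c j \<in> borel_measurable G" if "j \<in> J" for j
    unfolding c_def b_def using a[OF that] by measurable
  have cM: "c j \<in> borel_measurable M" if "j \<in> J" for j
    by (rule measurable_from_subalg[OF sub cG[OF that]])
  have c01: "0 \<le> c j \<omega> \<and> c j \<omega> \<le> 1" if "j \<in> J" "\<omega> \<in> space M" for j \<omega>
  proof -
    have "b j \<omega> * 1 \<le> b j \<omega> * C" using b[OF that] C by (intro mult_left_mono) auto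
    then have "b j \<omega> \<le> 1" using b[OF that] by simp
    moreover have "0 \<le> C\<^sup>2 * (b j \<omega>)\<^sup>2" by simp
    ultimately have "b j \<omega> \<le> 1 + C\<^sup>2 * (b j \<omega>)\<^sup>2" "0 < 1 + C\<^sup>2 * (b j \<omega>)\<^sup>2" by linarith+
    then show ?thesis using b[OF that] by (simp add: c_def)
  qed
  have Pint: "integrable M (P i)" for i
  proof (rule integrable_const_bound[of _ "(1 + C) ^ card (Ji i)"])
    show "AE \<omega> in M. norm (P i \<omega>) \<le> (1 + C) ^ card (Ji i)"
    proof (rule AE_I2)
      fix \<omega> assume \<omega>: "\<omega> \<in> space M"
      have "\<bar>1 + c j \<omega> * (X j \<omega> - 1)\<bar> \<le> 1 + C" if "j \<in> Ji i" for j
      proof -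
        have j: "j \<in> J" using that by (simp add: Ji_def)
        have "\<bar>X j \<omega> - 1\<bar> \<le> C" using bd[OF j \<omega>] C by linarith
        then have "\<bar>c j \<omega>\<bar> * \<bar>X j \<omega> - 1\<bar> \<le> 1 * C" using c01[OF j \<omega>] by (intro mult_mono) auto
        then have "\<bar>c j \<omega> * (X j \<omega> - 1)\<bar> \<le> C" by (simp add: abs_mult)
        then show ?thesis by linarith
      qed
      then have "(\<Prod>j\<in>Ji i. \<bar>1 + c j \<omega> * (X j \<omega> - 1)\<bar>) \<le> (\<Prod>j\<in>Ji i. 1 + C)"
        by (intro prod_mono) auto
      then show "norm (P i \<omega>) \<le> (1 + C) ^ card (Ji i)" by (simp add: P_def abs_prod)
    qed
    show "P i \<in> borel_measurable M" unfolding P_def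
      using cM X by (intro borel_measurable_prod borel_measurable_add borel_measurable_times borel_measurable_diff) (auto simp: Ji_def)
  qed
  have P1: "(\<integral>\<omega>. P i \<omega> \<partial>M) = 1" for i
    unfolding P_def
    by (rule cond_indep_affine_product[OF M sub fJi ci, where C=C])
      (use X bd mean cG c01 in \<open>auto simp: Ji_def\<close>)
  have expP: "exp (Si i \<omega>) \<le> P i \<omega>" if \<omega>: "\<omega> \<in> space M" for i \<omega>
  proof -
    have "exp (Si i \<omega>) = (\<Prod>j\<in>Ji i. exp (b j \<omega> * (X j \<omega> - 1) - C\<^sup>2 * (b j \<omega>)\<^sup>2))"
      unfolding Si_def by (rule exp_sum[OF fJi])
    also have "\<dots> \<le> P i \<omega>"
      unfolding P_def c_def
    proof (intro prod_mono conjI exp_ge_zero exp_le_affine C)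
      fix j assume "j \<in> Ji i"
      then have j: "j \<in> J" by (simp add: Ji_def)
      show "0 \<le> b j \<omega>" "b j \<omega> * C \<le> 1" "0 \<le> X j \<omega>" "X j \<omega> \<le> C"
        using b[OF j \<omega>] bd[OF j \<omega>] by auto
    qed
    finally show ?thesis .
  qed
  have Seq: "S \<omega> = (\<Sum>i<N. (1 / real N) * Si i \<omega>)" for \<omega>
  proof -
    have "(\<Sum>i<N. Si i \<omega>) = (\<Sum>j\<in>J. b j \<omega> * (X j \<omega> - 1) - C\<^sup>2 * (b j \<omega>)\<^sup>2)"
      unfolding Si_def Ji_def using col J by (intro sum.group) auto
    also have "\<dots> = real N * S \<omega>"
      by (simp add: S_def b_def sum_subtractf sum_distrib_left right_diff_distrib power2_eq_square mult_ac)
    finally have "(\<Sum>i<N. Si i \<omega>) = real N * S \<omega>" .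
    then show ?thesis using N unfolding sum_distrib_left[symmetric] by simp
  qed
  have expS: "exp (S \<omega>) \<le> (\<Sum>i<N. (1 / real N) * P i \<omega>)" if \<omega>: "\<omega> \<in> space M" for \<omega>
  proof -
    have "exp (S \<omega>) \<le> (\<Sum>i<N. (1 / real N) * exp (Si i \<omega>))"
      using convex_on_sum[of "{..<N}" UNIV exp "\<lambda>_. 1 / real N" "\<lambda>i. Si i \<omega>"] N exp_convex
      by (auto simp: Seq lessThan_empty_iff)
    also have "\<dots> \<le> (\<Sum>i<N. (1 / real N) * P i \<omega>)"
      using expP[OF \<omega>] by (intro sum_mono mult_left_mono) auto
    finally show ?thesis .
  qed
  have intP: "integrable M (\<lambda>\<omega>. \<Sum>i<N. (1 / real N) * P i \<omega>)" using Pint by auto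
  have SM: "(\<lambda>\<omega>. exp (S \<omega>)) \<in> borel_measurable M"
    unfolding S_def using aM X
    by (intro borel_measurable_exp[THEN measurable_compose_rev] borel_measurable_diff borel_measurable_times borel_measurable_sum borel_measurable_power) auto
  have intS: "integrable M (\<lambda>\<omega>. exp (S \<omega>))"
  proof (rule Bochner_Integration.integrable_bound[OF intP SM], rule AE_I2)
    fix \<omega> assume "\<omega> \<in> space M"
    from expS[OF this] show "norm (exp (S \<omega>)) \<le> norm (\<Sum>i<N. (1 / real N) * P i \<omega>)" by simp
  qed
  have "(\<integral>\<omega>. exp (S \<omega>) \<partial>M) \<le> (\<integral>\<omega>. (\<Sum>i<N. (1 / real N) * P i \<omega>) \<partial>M)"
    using expS by (intro integral_mono intS intP) auto
  also have "\<dots> = (\<Sum>i<N. (1 / real N) * (\<integral>\<omega>. P i \<omega> \<partial>M))"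
    using Pint by simp
  also have "\<dots> = 1" using N by (simp add: P1)
  finally show "(\<integral>\<omega>. exp ((\<Sum>j\<in>J. a j \<omega> * (X j \<omega> - 1)) - real N * C\<^sup>2 * (\<Sum>j\<in>J. (a j \<omega>)\<^sup>2)) \<partial>M) \<le> 1"
    by (simp add: S_def)
  show "integrable M (\<lambda>\<omega>. exp ((\<Sum>j\<in>J. a j \<omega> * (X j \<omega> - 1)) - real N * C\<^sup>2 * (\<Sum>j\<in>J. (a j \<omega>)\<^sup>2)))"
    using intS by (simp add: S_def)
qed

text \<open>Comparison of volumes. It serves twice: for the number of children of a cell, bounded
  uniformly in the level, and for the exponential growth of the number of cells.\<close>

lemma card_disjoint_balls_le:
  fixes \<G> :: "'a::euclidean_space set set"
  assumes fin: "finite \<G>" and dis: "disjoint \<G>" and meas: "\<And>F. F \<in> \<G> \<Longrightarrow> F \<in> sets borel"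
    and b: "\<And>F. F \<in> \<G> \<Longrightarrow> \<exists>x. ball x r \<subseteq> F" and r: "0 < r" and sub: "\<Union>\<G> \<subseteq> ball c \<rho>" and \<rho>: "0 \<le> \<rho>"
  shows "real (card \<G>) \<le> (\<rho> / r) ^ DIM('a)"
proof -
  let ?v = "unit_ball_vol (real DIM('a))"
  have v: "?v > 0" by simp
  have "ennreal (real (card \<G>) * (?v * r ^ DIM('a))) = (\<Sum>F\<in>\<G>. ennreal (?v * r ^ DIM('a)))"
    using v r by (simp add: ennreal_mult ennreal_of_nat_eq_real_of_nat)
  also have "\<dots> \<le> (\<Sum>F\<in>\<G>. emeasure lborel F)"
  proof (intro sum_mono)
    fix F assume F: "F \<in> \<G>"
    obtain x where "ball x r \<subseteq> F" using b[OF F] by blast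
    then have "emeasure lborel (ball x r) \<le> emeasure lborel F" using meas[OF F] by (intro emeasure_mono) auto
    then show "ennreal (?v * r ^ DIM('a)) \<le> emeasure lborel F" using r by (simp add: emeasure_ball)
  qed
  also have "\<dots> = emeasure lborel (\<Union>F\<in>\<G>. F)"
    using fin dis meas by (intro sum_emeasure) (auto simp: disjoint_family_on_def disjoint_def)
  also have "\<dots> \<le> emeasure lborel (ball c \<rho>)" using sub by (intro emeasure_mono) auto
  also have "\<dots> = ennreal (?v * \<rho> ^ DIM('a))" using \<rho> by (simp add: emeasure_ball)
  finally have "real (card \<G>) * (?v * r ^ DIM('a)) \<le> ?v * \<rho> ^ DIM('a)"
    using v \<rho> by (subst (asm) ennreal_le_iff) auto
  then have "real (card \<G>) * r ^ DIM('a) \<le> \<rho> ^ DIM('a)" using v by simp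
  then show ?thesis using r by (simp add: power_divide pos_le_divide_eq)
qed

section \<open>Subdivision martingales\<close>

text \<open>The set \<open>D\<close> of basis vectors stands for the dimension k. The constants of
  non-flatness and of the comparison between density and support are fixed here, which makes the
  bounds below uniform in the plane.\<close>

locale nonflat_subdivision =
  fixes M :: "'w measure" and F0 :: "'a::euclidean_space set" and cells :: "nat \<Rightarrow> 'a set set"
    and W :: "nat \<Rightarrow> 'a set \<Rightarrow> 'w \<Rightarrow> real" and C :: real and D :: "'a set"
    and \<alpha> C1 C2 \<gamma> Cn :: real
  assumes SM: "subdivision_martingale M F0 cells W C"
    and D: "D \<subseteq> Basis" and D1: "1 \<le> card D" and \<alpha>k: "\<alpha> < real (card D)"
    and \<gamma>: "\<gamma> > 0" and Cn: "Cn > 0"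
    and nf: "\<And>\<Lambda> n. \<Lambda> \<in> cells n \<Longrightarrow> nf_bound (card D) \<gamma> Cn \<Lambda>"
    and C1: "C1 > 0" and C2: "C2 > 0"
    and comp1: "\<And>\<omega> n x. \<omega> \<in> space M \<Longrightarrow> C1 * sm_mu cells F0 W n \<omega> x
            \<le> 2 powr (\<alpha> * real n) * indicator {y. sm_mu cells F0 W n \<omega> y \<noteq> 0} x"
    and comp2: "\<And>\<omega> n x. \<omega> \<in> space M \<Longrightarrow> 2 powr (\<alpha> * real n) * indicator {y. sm_mu cells F0 W n \<omega> y \<noteq> 0} x
            \<le> C2 * sm_mu cells F0 W n \<omega> x"
begin

abbreviation "k \<equiv> card D"
abbreviation "G \<equiv> sm_filtr M cells W"
abbreviation "mu \<equiv> sm_mu cells F0 W"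

section \<open>The axioms of a subdivision martingale as separate facts\<close>

lemma prob: "prob_space M" and C: "1 \<le> C" and F0: "F0 \<in> sets borel" "bounded F0"
  and cells0: "cells 0 = {F0}"
  by (rule SM[unfolded subdivision_martingale_def, THEN conjunct1], rule SM[unfolded subdivision_martingale_def, THEN conjunct2, THEN conjunct1], rule SM[unfolded subdivision_martingale_def, THEN conjunct2, THEN conjunct2, THEN conjunct1],
    rule SM[unfolded subdivision_martingale_def, THEN conjunct2, THEN conjunct2, THEN conjunct2, THEN conjunct1], rule SM[unfolded subdivision_martingale_def, THEN conjunct2, THEN conjunct2, THEN conjunct2, THEN conjunct2, THEN conjunct1])

sublocale prob_space M by (rule prob)

lemma finite_cells: "finite (cells n)"
  and Union_cells: "\<Union>(cells n) = F0" and disjoint_cells: "disjoint (cells n)"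
  and cell_borel: "F \<in> cells n \<Longrightarrow> F \<in> sets borel" and cell_nonempty: "F \<in> cells n \<Longrightarrow> F \<noteq> {}"
  and cell_parent: "F \<in> cells (Suc n) \<Longrightarrow> \<exists>P\<in>cells n. F \<subseteq> P"
  and W_measurable: "F \<in> cells n \<Longrightarrow> W n F \<in> borel_measurable M"
  and W_bounds: "F \<in> cells n \<Longrightarrow> \<omega> \<in> space M \<Longrightarrow> 0 \<le> W n F \<omega> \<and> W n F \<omega> \<le> C"
  and W_mean: "F \<in> cells (Suc n) \<Longrightarrow> AE \<omega> in M. real_cond_exp M (G n) (W (Suc n) F) \<omega> = 1"
  and W_indep: "J \<subseteq> cells (Suc n) \<Longrightarrow> (\<And>F F'. F \<in> J \<Longrightarrow> F' \<in> J \<Longrightarrow> F \<noteq> F' \<Longrightarrow> \<not> (\<exists>P\<in>cells n. F \<subseteq> P \<and> F' \<subseteq> P))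
      \<Longrightarrow> cond_indep M (G n) (W (Suc n)) J"
  and cell_ball: "F \<in> cells n \<Longrightarrow> \<exists>x r. ball x r \<subseteq> F \<and> 2 powr (- real n) / C \<le> diameter (ball x r) \<and>
                             diameter F \<le> C * 2 powr (- real n)"
proof -
  have "\<forall>n. finite (cells n) \<and> (\<forall>F\<in>cells n. F \<in> sets borel \<and> F \<noteq> {}) \<and> \<Union>(cells n) = F0 \<and> disjoint (cells n)"
    by (rule SM[unfolded subdivision_martingale_def, THEN conjunct2, THEN conjunct2, THEN conjunct2, THEN conjunct2, THEN conjunct2, THEN conjunct1])
  then show "finite (cells n)" "\<Union>(cells n) = F0" "disjoint (cells n)"
    "F \<in> cells n \<Longrightarrow> F \<in> sets borel" "F \<in> cells n \<Longrightarrow> F \<noteq> {}" by blast+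
  have "\<forall>n. \<forall>F\<in>cells (Suc n). \<exists>P\<in>cells n. F \<subseteq> P"
    by (rule SM[unfolded subdivision_martingale_def, THEN conjunct2, THEN conjunct2, THEN conjunct2, THEN conjunct2, THEN conjunct2, THEN conjunct2, THEN conjunct1])
  then show "F \<in> cells (Suc n) \<Longrightarrow> \<exists>P\<in>cells n. F \<subseteq> P" by blast
  have "\<forall>n. \<forall>F\<in>cells n. W n F \<in> borel_measurable M"
    by (rule SM[unfolded subdivision_martingale_def, THEN conjunct2, THEN conjunct2, THEN conjunct2, THEN conjunct2, THEN conjunct2, THEN conjunct2, THEN conjunct2, THEN conjunct1])
  then show "F \<in> cells n \<Longrightarrow> W n F \<in> borel_measurable M" by blast
  have "\<forall>n. \<forall>F\<in>cells n. \<forall>\<omega>\<in>space M. 0 \<le> W n F \<omega> \<and> W n F \<omega> \<le> C"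
    by (rule SM[unfolded subdivision_martingale_def, THEN conjunct2, THEN conjunct2, THEN conjunct2, THEN conjunct2, THEN conjunct2, THEN conjunct2, THEN conjunct2, THEN conjunct2, THEN conjunct2, THEN conjunct1])
  then show "F \<in> cells n \<Longrightarrow> \<omega> \<in> space M \<Longrightarrow> 0 \<le> W n F \<omega> \<and> W n F \<omega> \<le> C" by blast
  have "\<forall>n. \<forall>F\<in>cells (Suc n). AE \<omega> in M. real_cond_exp M (G n) (W (Suc n) F) \<omega> = 1"
    by (rule SM[unfolded subdivision_martingale_def, THEN conjunct2, THEN conjunct2, THEN conjunct2, THEN conjunct2, THEN conjunct2, THEN conjunct2, THEN conjunct2, THEN conjunct2, THEN conjunct2, THEN conjunct2, THEN conjunct1])
  then show "F \<in> cells (Suc n) \<Longrightarrow> AE \<omega> in M. real_cond_exp M (G n) (W (Suc n) F) \<omega> = 1" by blast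
  have "\<forall>n. \<forall>F\<in>cells n. \<exists>x r. ball x r \<subseteq> F \<and> 2 powr (- real n) / C \<le> diameter (ball x r) \<and>
                             diameter F \<le> C * 2 powr (- real n)"
    by (rule SM[unfolded subdivision_martingale_def, THEN conjunct2, THEN conjunct2, THEN conjunct2, THEN conjunct2, THEN conjunct2, THEN conjunct2, THEN conjunct2, THEN conjunct2, THEN conjunct2, THEN conjunct2, THEN conjunct2, THEN conjunct2])
  then show "F \<in> cells n \<Longrightarrow> \<exists>x r. ball x r \<subseteq> F \<and> 2 powr (- real n) / C \<le> diameter (ball x r) \<and>
                             diameter F \<le> C * 2 powr (- real n)" by blast
  have ind: "\<forall>n J. J \<subseteq> cells (Suc n) \<and> (\<forall>F\<in>J. \<forall>G\<in>J. F \<noteq> G \<longrightarrow> \<not> (\<exists>P\<in>cells n. F \<subseteq> P \<and> G \<subseteq> P))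
          \<longrightarrow> cond_indep M (G n) (W (Suc n)) J"
    by (rule SM[unfolded subdivision_martingale_def, THEN conjunct2, THEN conjunct2, THEN conjunct2, THEN conjunct2, THEN conjunct2, THEN conjunct2, THEN conjunct2, THEN conjunct2, THEN conjunct2, THEN conjunct2, THEN conjunct2, THEN conjunct1])
  show "cond_indep M (G n) (W (Suc n)) J" if "J \<subseteq> cells (Suc n)"
    "\<And>F F'. F \<in> J \<Longrightarrow> F' \<in> J \<Longrightarrow> F \<noteq> F' \<Longrightarrow> \<not> (\<exists>P\<in>cells n. F \<subseteq> P \<and> F' \<subseteq> P)"
    by (rule ind[rule_format]) (use that in simp)
qed

lemma cell_unique: "F \<in> cells n \<Longrightarrow> F' \<in> cells n \<Longrightarrow> x \<in> F \<Longrightarrow> x \<in> F' \<Longrightarrow> F = F'"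
  using disjoint_cells[of n] unfolding disjoint_def by blast

lemma cell_subset: "F \<in> cells n \<Longrightarrow> F \<subseteq> F0"
  using Union_cells[of n] by blast

lemma bounded_cell: "F \<in> cells n \<Longrightarrow> bounded F"
  by (rule bounded_subset[OF F0(2) cell_subset])

lemma cell_eq: "F \<in> cells n \<Longrightarrow> x \<in> F \<Longrightarrow> cell cells n x = F"
  unfolding cell_def by (rule the_equality) (use cell_unique in blast)+

text \<open>The density of level n is constant on the cells of level n, so its value on a cell can
  be read off at one chosen point.\<close>

definition pt :: "'a set \<Rightarrow> 'a" where "pt F = (SOME x. x \<in> F)"

lemma pt: "F \<in> cells n \<Longrightarrow> pt F \<in> F"
  using cell_nonempty unfolding pt_def by (metis some_in_eq)

text \<open>The level is an argument because one set may be a cell of several levels.\<close>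

definition par :: "nat \<Rightarrow> 'a set \<Rightarrow> 'a set" where "par n F = cell cells n (pt F)"

lemma par:
  assumes F: "F \<in> cells (Suc n)"
  shows "par n F \<in> cells n" "F \<subseteq> par n F"
proof -
  obtain P where P: "P \<in> cells n" "F \<subseteq> P" using cell_parent[OF F] by blast
  then have "par n F = P" using pt[OF F] cell_eq[OF P(1)] by (auto simp: par_def)
  then show "par n F \<in> cells n" "F \<subseteq> par n F" using P by auto
qed

lemma par_unique: "F \<in> cells (Suc n) \<Longrightarrow> P \<in> cells n \<Longrightarrow> F \<subseteq> P \<Longrightarrow> par n F = P"
  unfolding par_def using pt cell_eq by blast

lemma mu_cell: "F \<in> cells n \<Longrightarrow> x \<in> F \<Longrightarrow> y \<in> F \<Longrightarrow> mu n \<omega> x = mu n \<omega> y"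
proof (induction n arbitrary: F)
  case 0
  then show ?case by (simp add: cells0)
next
  case (Suc n)
  have "mu n \<omega> x = mu n \<omega> y"
    using Suc.IH[OF par(1)[OF Suc.prems(1)]] par(2)[OF Suc.prems(1)] Suc.prems by blast
  moreover have "x \<in> F0" "y \<in> F0" using Suc.prems cell_subset by blast+
  ultimately show ?case using Suc.prems by (simp add: cell_eq)
qed

lemma mu_Suc: "F \<in> cells (Suc n) \<Longrightarrow> x \<in> F \<Longrightarrow> mu (Suc n) \<omega> x = W (Suc n) F \<omega> * mu n \<omega> x"
  using cell_subset by (auto simp: cell_eq)

lemma cell_in: "x \<in> F0 \<Longrightarrow> cell cells n x \<in> cells n" "x \<in> F0 \<Longrightarrow> x \<in> cell cells n x"
  using Union_cells[of n] cell_eq[of _ n x] by auto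

lemma mu_nonneg: "\<omega> \<in> space M \<Longrightarrow> 0 \<le> mu n \<omega> x"
proof (induction n)
  case (Suc n)
  then show ?case using W_bounds[of "cell cells (Suc n) x" "Suc n" \<omega>] cell_in(1)[of x "Suc n"] by auto
qed simp

lemma mu_le: "\<omega> \<in> space M \<Longrightarrow> mu n \<omega> x \<le> 2 powr (\<alpha> * real n) / C1"
proof -
  assume "\<omega> \<in> space M"
  from comp1[OF this, of n x] have "C1 * mu n \<omega> x \<le> 2 powr (\<alpha> * real n)"
    by (rule order_trans) (auto simp: indicator_def)
  then show ?thesis using C1 by (simp add: pos_le_divide_eq mult.commute)
qed

lemma mu_outside: "x \<notin> F0 \<Longrightarrow> mu n \<omega> x = 0"
  by (induction n) auto

section \<open>The filtration generated by the weights\<close>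

lemma gens: "(\<Union>j\<in>{..n}. \<Union>F\<in>cells j. {W j F -` A \<inter> space M | A. A \<in> sets (borel :: real measure)}) \<subseteq> Pow (space M)"
  by auto

lemma space_G: "space (G n) = space M"
  unfolding sm_filtr_def by (rule space_measure_of[OF gens])

lemma sets_G: "sets (G n) = sigma_sets (space M) (\<Union>j\<in>{..n}. \<Union>F\<in>cells j. {W j F -` A \<inter> space M | A. A \<in> sets (borel :: real measure)})"
  unfolding sm_filtr_def by (rule sets_measure_of[OF gens])

lemma subalg_G: "subalgebra M (G n)"
proof -
  have "(\<Union>j\<in>{..n}. \<Union>F\<in>cells j. {W j F -` A \<inter> space M | A. A \<in> sets (borel :: real measure)}) \<subseteq> sets M"
    using measurable_sets[OF W_measurable] by auto
  then show ?thesis unfolding subalgebra_def sets_G space_G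
    by (intro conjI refl sets.sigma_sets_subset)
qed

lemma W_measurable_G: "j \<le> n \<Longrightarrow> F \<in> cells j \<Longrightarrow> W j F \<in> borel_measurable (G n)"
proof (rule measurableI)
  fix A assume "j \<le> n" "F \<in> cells j" "A \<in> sets (borel :: real measure)"
  then show "W j F -` A \<inter> space (G n) \<in> sets (G n)"
    unfolding sets_G space_G by (intro sigma_sets.Basic) blast
qed simp

lemma mu_measurable_G:
  assumes "x \<in> F0" "m \<le> n"
  shows "(\<lambda>\<omega>. mu m \<omega> x) \<in> borel_measurable (G n)"
  using assms(2)
proof (induction m)
  case (Suc m)
  have "W (Suc m) (cell cells (Suc m) x) \<in> borel_measurable (G n)"
    using Suc.prems cell_in(1)[OF assms(1)] by (intro W_measurable_G) auto
  then show ?case using Suc assms(1) by simp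
qed simp

section \<open>The mass of the densities on a plane\<close>

definition nu :: "('a \<Rightarrow> 'a) \<Rightarrow> 'a \<Rightarrow> 'a set \<Rightarrow> real" where
  "nu g z E = measure (flat_measure D g z) E"

lemma emeasure_flat_finite:
  assumes "orthogonal_transformation g" "E \<in> sets borel" "bounded E"
  shows "emeasure (flat_measure D g z) E < \<infinity>"
proof -
  have "dist x y \<le> diameter E" if "x \<in> E" "y \<in> E" for x y
    using diameter_bounded_bound[OF assms(3) that] .
  then have "emeasure (flat_measure D g z) E \<le> ennreal ((2 * diameter E) ^ card D)"
    by (intro flat_measure_le_diameter assms D) (auto simp: diameter_ge_0 assms)
  also have "\<dots> < \<infinity>" by simp
  finally show ?thesis .
qed

lemma emeasure_eq_nu:
  assumes "orthogonal_transformation g" "E \<in> sets borel" "bounded E"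
  shows "emeasure (flat_measure D g z) E = ennreal (nu g z E)"
  unfolding nu_def using emeasure_flat_finite[OF assms, of z]
  by (intro emeasure_eq_ennreal_measure) (simp add: less_top)

lemma nu_nonneg: "0 \<le> nu g z E" by (simp add: nu_def)

lemma nu_le_diameter:
  assumes "orthogonal_transformation g" "E \<in> sets borel" "bounded E" "diameter E \<le> r"
  shows "nu g z E \<le> (2 * r) ^ k"
proof -
  have r: "0 \<le> r" using assms diameter_ge_0[of E] by linarith
  have "dist x y \<le> r" if "x \<in> E" "y \<in> E" for x y
    using diameter_bounded_bound[OF assms(3) that] assms(4) by simp
  then have "emeasure (flat_measure D g z) E \<le> ennreal ((2 * r) ^ card D)"
    by (intro flat_measure_le_diameter assms D r)
  then show ?thesis unfolding emeasure_eq_nu[OF assms(1-3)] using r by (subst (asm) ennreal_le_iff) auto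
qed

lemma nu_Union:
  assumes "orthogonal_transformation g" "finite \<G>" "disjoint \<G>" "\<And>F. F \<in> \<G> \<Longrightarrow> F \<in> sets borel \<and> bounded F"
  shows "nu g z (\<Union>\<G>) = (\<Sum>F\<in>\<G>. nu g z F)"
proof -
  have "nu g z (\<Union>F\<in>\<G>. F) = (\<Sum>F\<in>\<G>. nu g z F)"
    unfolding nu_def using assms emeasure_flat_finite[OF assms(1)]
    by (intro measure_finite_Union) (auto simp: disjoint_family_on_def disjoint_def less_top[symmetric])
  then show ?thesis by simp
qed

definition X :: "nat \<Rightarrow> ('a \<Rightarrow> 'a) \<Rightarrow> 'a \<Rightarrow> 'w \<Rightarrow> real" where
  "X n g z \<omega> = (\<Sum>F\<in>cells n. mu n \<omega> (pt F) * nu g z F)"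

text \<open>Meant for \<open>F\<close> of level n + 1: the part of \<open>X n\<close> carried by
  \<open>F\<close>. It uses the density of level n only, hence is known before the weights of level
  n + 1.\<close>

definition coef :: "nat \<Rightarrow> ('a \<Rightarrow> 'a) \<Rightarrow> 'a \<Rightarrow> 'a set \<Rightarrow> 'w \<Rightarrow> real" where
  "coef n g z F \<omega> = mu n \<omega> (pt F) * nu g z F"

lemma children_Union: "P \<in> cells n \<Longrightarrow> \<Union>{F \<in> cells (Suc n). par n F = P} = P"
proof (intro equalityI subsetI)
  fix x assume P: "P \<in> cells n" and x: "x \<in> P"
  then have x0: "x \<in> F0" using cell_subset by blast
  let ?F = "cell cells (Suc n) x"
  have F: "?F \<in> cells (Suc n)" "x \<in> ?F" using cell_in[OF x0] by auto
  have "par n ?F = P" using par[OF F(1)] F(2) P x cell_unique by blast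
  then show "x \<in> \<Union>{F \<in> cells (Suc n). par n F = P}" using F by blast
qed (use par in blast)

text \<open>A cell of level n is the disjoint union of its children, and the density of level n is
  constant on it. This writes X n and X (n + 1) as sums over the same index set.\<close>

lemma X_refine:
  assumes g: "orthogonal_transformation g"
  shows "X n g z \<omega> = (\<Sum>F\<in>cells (Suc n). coef n g z F \<omega>)"
proof -
  have "(\<Sum>F\<in>cells (Suc n). coef n g z F \<omega>) = (\<Sum>P\<in>cells n. \<Sum>F\<in>{F \<in> cells (Suc n). par n F = P}. coef n g z F \<omega>)"
    by (rule sum.group[symmetric]) (use finite_cells par in auto)
  also have "\<dots> = (\<Sum>P\<in>cells n. mu n \<omega> (pt P) * nu g z P)"
  proof (intro sum.cong refl)
    fix P assume P: "P \<in> cells n"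
    let ?ch = "{F \<in> cells (Suc n). par n F = P}"
    have "(\<Sum>F\<in>?ch. coef n g z F \<omega>) = (\<Sum>F\<in>?ch. mu n \<omega> (pt P) * nu g z F)"
    proof (intro sum.cong refl)
      fix F assume F: "F \<in> ?ch"
      then have "pt F \<in> P" using pt[of F "Suc n"] par(2)[of F n] by auto
      then have "mu n \<omega> (pt F) = mu n \<omega> (pt P)" using mu_cell[OF P] pt[OF P] by blast
      then show "coef n g z F \<omega> = mu n \<omega> (pt P) * nu g z F" by (simp add: coef_def)
    qed
    also have "\<dots> = mu n \<omega> (pt P) * nu g z (\<Union>?ch)"
    proof -
      have "disjoint ?ch" using disjoint_cells[of "Suc n"] by (auto simp: disjoint_def)
      then have "nu g z (\<Union>?ch) = (\<Sum>F\<in>?ch. nu g z F)"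
        by (intro nu_Union[OF g]) (use finite_cells[of "Suc n"] cell_borel bounded_cell in auto)
      then show ?thesis by (simp add: sum_distrib_left)
    qed
    finally show "(\<Sum>F\<in>?ch. coef n g z F \<omega>) = mu n \<omega> (pt P) * nu g z P" by (simp add: children_Union[OF P])
  qed
  finally show ?thesis by (simp add: X_def)
qed

lemma X_Suc: "X (Suc n) g z \<omega> = (\<Sum>F\<in>cells (Suc n). coef n g z F \<omega> * W (Suc n) F \<omega>)"
  unfolding X_def coef_def using pt by (intro sum.cong) (auto simp: mu_Suc mult_ac simp del: sm_mu.simps)

text \<open>Martingale increment: coefficients known from the past times centred weights, the form
  that the exponential moment estimate requires.\<close>

lemma X_step:
  assumes g: "orthogonal_transformation g"
  shows "X (Suc n) g z \<omega> - X n g z \<omega> = (\<Sum>F\<in>cells (Suc n). coef n g z F \<omega> * (W (Suc n) F \<omega> - 1))"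
  unfolding X_Suc[of n] X_refine[OF g, of n] by (simp add: right_diff_distrib sum_subtractf)

lemma X_measurable: "X n g z \<in> borel_measurable M"
proof -
  have "(\<lambda>\<omega>. mu n \<omega> (pt F)) \<in> borel_measurable M" if "F \<in> cells n" for F
    by (rule measurable_from_subalg[OF subalg_G[of n] mu_measurable_G])
      (use pt[OF that] cell_subset[OF that] in auto)
  then show ?thesis unfolding X_def by (intro borel_measurable_sum borel_measurable_times) auto
qed

section \<open>Geometry of the cells and colouring of siblings\<close>

lemma cell_ball_radius:
  assumes F: "F \<in> cells n"
  shows "\<exists>x. ball x (2 powr (- real n) / (2 * C)) \<subseteq> F" "diameter F \<le> C * 2 powr (- real n)"
proof -
  obtain x r where xr: "ball x r \<subseteq> F" "2 powr (- real n) / C \<le> diameter (ball x r)" "diameter F \<le> C * 2 powr (- real n)"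
    using cell_ball[OF F] by blast
  have "0 < 2 powr (- real n) / C" using C by simp
  then have "2 powr (- real n) / C \<le> 2 * r" "0 < r" using xr(2) by (auto simp: diameter_ball split: if_splits)
  then have "2 powr (- real n) / (2 * C) \<le> r" using C by (simp add: field_simps)
  then show "\<exists>x. ball x (2 powr (- real n) / (2 * C)) \<subseteq> F" "diameter F \<le> C * 2 powr (- real n)"
    using xr subset_ball by blast+
qed

text \<open>A cell lies in a ball of radius 2C 2^-n, and each child contains a ball of radius
  2^-(n+1)/(2C); the ratio of the radii is 8 C^2.\<close>

lemma card_children:
  assumes P: "P \<in> cells n"
  shows "real (card {F \<in> cells (Suc n). par n F = P}) \<le> (8 * C\<^sup>2) ^ DIM('a)"
proof -
  let ?ch = "{F \<in> cells (Suc n). par n F = P}" and ?r = "2 powr (- real (Suc n)) / (2 * C)" and ?\<rho> = "2 * C * 2 powr (- real n)"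
  have Pb: "P \<subseteq> ball (pt P) ?\<rho>"
  proof
    fix x assume "x \<in> P"
    then have "dist (pt P) x \<le> diameter P"
      using diameter_bounded_bound[OF bounded_cell[OF P] pt[OF P]] by blast
    also have "\<dots> \<le> C * 2 powr (- real n)" by (rule cell_ball_radius(2)[OF P])
    also have "\<dots> < ?\<rho>" using C by simp
    finally show "x \<in> ball (pt P) ?\<rho>" by simp
  qed
  have "real (card ?ch) \<le> (?\<rho> / ?r) ^ DIM('a)"
  proof (rule card_disjoint_balls_le)
    show "finite ?ch" using finite_cells by simp
    show "disjoint ?ch" using disjoint_cells[of "Suc n"] by (auto simp: disjoint_def)
    show "\<Union>?ch \<subseteq> ball (pt P) ?\<rho>" using children_Union[OF P] Pb by simp
    show "F \<in> sets borel" if "F \<in> ?ch" for F using that cell_borel by blast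
    show "\<exists>x. ball x ?r \<subseteq> F" if "F \<in> ?ch" for F using that cell_ball_radius(1) by blast
  qed (use C in auto)
  also have "?\<rho> / ?r = 8 * C\<^sup>2"
  proof -
    have "2 powr (- real (Suc n)) = 2 powr (- real n - 1)" by (rule arg_cong[where f="\<lambda>x. 2 powr x"]) simp
    also have "\<dots> = 2 powr (- real n) / 2" by (subst powr_diff) simp
    finally show ?thesis using C by (simp add: power2_eq_square field_simps)
  qed
  finally show ?thesis .
qed

lemma card_cells: "\<exists>c>0. \<forall>n. real (card (cells n)) \<le> c * 2 powr (real DIM('a) * real n)"
proof -
  obtain B where B: "B > 0" "F0 \<subseteq> ball 0 B" using bounded_subset_ballD[OF F0(2), of 0] by auto
  have "real (card (cells n)) \<le> (2 * B * C) ^ DIM('a) * 2 powr (real DIM('a) * real n)" for n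
  proof -
    let ?r = "2 powr (- real n) / (2 * C)"
    have "real (card (cells n)) \<le> (B / ?r) ^ DIM('a)"
    proof (rule card_disjoint_balls_le)
      show "\<Union>(cells n) \<subseteq> ball 0 B" using B Union_cells by simp
      show "\<exists>x. ball x ?r \<subseteq> F" if "F \<in> cells n" for F using that cell_ball_radius(1) by blast
    qed (use finite_cells disjoint_cells cell_borel C B in auto)
    also have "B / ?r = 2 * B * C * 2 powr (real n)" using C by (simp add: powr_minus field_simps)
    also have "(2 * B * C * 2 powr (real n)) ^ DIM('a) = (2 * B * C) ^ DIM('a) * 2 powr (real DIM('a) * real n)"
      by (simp add: power_mult_distrib powr_power mult.commute)
    finally show ?thesis .
  qed
  then show ?thesis using B C by (intro exI[of _ "(2 * B * C) ^ DIM('a)"]) auto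
qed

text \<open>(SD4) gives independence only for cells with different parents. Siblings receive
  different colours, so the cells of one colour have different parents. The number of colours is
  independent of the level because the number of children is bounded.\<close>

lemma colouring:
  obtains N where "1 \<le> N" "\<And>n. \<exists>col. (\<forall>F\<in>cells (Suc n). col F < N) \<and>
    (\<forall>F\<in>cells (Suc n). \<forall>F'\<in>cells (Suc n). F \<noteq> F' \<longrightarrow> par n F = par n F' \<longrightarrow> col F \<noteq> (col F' :: nat))"
proof -
  \<comment> \<open>The added 1 gives the strict bound and \<open>1 \<le> N\<close>.\<close>
  define N where "N = nat \<lceil>(8 * C\<^sup>2) ^ DIM('a)\<rceil> + 1"
  have "\<exists>col. (\<forall>F\<in>cells (Suc n). col F < N) \<and>
    (\<forall>F\<in>cells (Suc n). \<forall>F'\<in>cells (Suc n). F \<noteq> F' \<longrightarrow> par n F = par n F' \<longrightarrow> col F \<noteq> (col F' :: nat))" for n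
  proof -
    define ch where "ch P = {F \<in> cells (Suc n). par n F = P}" for P
    have fch: "finite (ch P)" for P using finite_cells by (simp add: ch_def)
    have "\<exists>e. bij_betw e (ch P) {0..<card (ch P)}" for P using ex_bij_betw_finite_nat[OF fch] .
    then obtain e where e: "\<And>P. bij_betw (e P) (ch P) {0..<card (ch P)}" by metis
    have cN: "card (ch P) < N" if "P \<in> cells n" for P
    proof -
      have "real (card (ch P)) \<le> (8 * C\<^sup>2) ^ DIM('a)" unfolding ch_def by (rule card_children[OF that])
      also have "\<dots> < real N" unfolding N_def by linarith
      finally show ?thesis by simp
    qed
    show ?thesis
    proof (intro exI[of _ "\<lambda>F. e (par n F) F"] conjI ballI impI)
      fix F assume F: "F \<in> cells (Suc n)"
      then have "e (par n F) F < card (ch (par n F))"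
        using e[of "par n F"] by (auto simp: bij_betw_def ch_def)
      then show "e (par n F) F < N" using cN[OF par(1)[OF F]] by simp
    next
      fix F F' assume "F \<in> cells (Suc n)" "F' \<in> cells (Suc n)" "F \<noteq> F'" "par n F = par n F'"
      then show "e (par n F) F \<noteq> e (par n F') F'"
        using e[of "par n F"] by (auto simp: bij_betw_def inj_on_def ch_def)
    qed
  qed
  then show ?thesis using that[of N] by (simp add: N_def)
qed

text \<open>The density is at most a constant times 2^(\<alpha> n), the flat measure of a cell at
  most a constant times 2^(-k n). The product is written as a square because its root is the scale
  of the increments.\<close>

lemma coef_bounds:
  assumes g: "orthogonal_transformation g" and F: "F \<in> cells (Suc n)" and \<omega>: "\<omega> \<in> space M"
  shows "0 \<le> coef n g z F \<omega>" "coef n g z F \<omega> \<le> (2 * C) ^ k / C1 * (2 powr (- ((real k - \<alpha>) / 2) * real n))\<^sup>2"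
proof -
  show "0 \<le> coef n g z F \<omega>" unfolding coef_def using mu_nonneg[OF \<omega>] nu_nonneg by (intro mult_nonneg_nonneg)
  have "diameter F \<le> C * 2 powr (- real (Suc n))" by (rule cell_ball_radius(2)[OF F])
  also have "\<dots> \<le> C * 2 powr (- real n)" using C by (intro mult_left_mono powr_mono) auto
  finally have "nu g z F \<le> (2 * (C * 2 powr (- real n))) ^ k"
    by (intro nu_le_diameter g cell_borel[OF F] bounded_cell[OF F])
  then have "coef n g z F \<omega> \<le> 2 powr (\<alpha> * real n) / C1 * (2 * (C * 2 powr (- real n))) ^ k"
    unfolding coef_def using mu_le[OF \<omega>] C1 by (intro mult_mono) (auto simp: nu_nonneg)
  also have "\<dots> = (2 * C) ^ k / C1 * (2 powr (\<alpha> * real n) * 2 powr (- real n * real k))"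
    by (simp add: power_mult_distrib powr_power mult_ac)
  also have "2 powr (\<alpha> * real n) * 2 powr (- real n * real k) = (2 powr (- ((real k - \<alpha>) / 2) * real n))\<^sup>2"
    unfolding power2_eq_square powr_add[symmetric] by (rule arg_cong[where f="\<lambda>x. 2 powr x"]) (simp add: field_simps)
  finally show "coef n g z F \<omega> \<le> (2 * C) ^ k / C1 * (2 powr (- ((real k - \<alpha>) / 2) * real n))\<^sup>2" .
qed

text \<open>Chernoff bound with exponent \<theta>/q for q = 2^(-(k - \<alpha>) n / 2). Each
  coefficient is at most A0 q^2, hence the sum of their squares is at most A0 q^2 times X n. The
  variance is thus proportional to the mass and enters as the factor 1 + A q instead of as a fixed
  additive error.\<close>

lemma bad_event:
  obtains \<theta> A where "\<theta> > 0" "A > 0"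
    "\<And>n g z t. orthogonal_transformation g \<Longrightarrow>
      measure M {\<omega> \<in> space M. X (Suc n) g z \<omega> > X n g z \<omega> * (1 + A * 2 powr (- ((real k - \<alpha>) / 2) * real n))
         + t * 2 powr (- ((real k - \<alpha>) / 2) * real n) / \<theta>} \<le> exp (- t)"
proof -
  obtain N where N: "1 \<le> N" and colex: "\<And>n. \<exists>col. (\<forall>F\<in>cells (Suc n). col F < N) \<and>
    (\<forall>F\<in>cells (Suc n). \<forall>F'\<in>cells (Suc n). F \<noteq> F' \<longrightarrow> par n F = par n F' \<longrightarrow> col F \<noteq> (col F' :: nat))"
    using colouring by blast
  define A0 where "A0 = (2 * C) ^ k / C1"
  have A0: "A0 > 0" using C C1 by (simp add: A0_def)
  \<comment> \<open>As q \<le> 1, this value guarantees N a C \<le> 1 for the scaled coefficients,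
    as the exponential moment estimate demands.\<close>
  define \<theta> where "\<theta> = 1 / (real N * A0 * C)"
  have \<theta>: "\<theta> > 0" using N A0 C by (simp add: \<theta>_def)
  define A where "A = real N * C\<^sup>2 * \<theta> * A0"
  have A: "A > 0" using N C \<theta> A0 by (simp add: A_def)
  define q where "q n = 2 powr (- ((real k - \<alpha>) / 2) * real n)" for n
  have q: "0 < q n" "q n \<le> 1" for n
  proof -
    show "0 < q n" by (simp add: q_def)
    have "- ((real k - \<alpha>) / 2) * real n \<le> 0" using \<alpha>k by (simp add: mult_nonneg_nonneg)
    then show "q n \<le> 1" unfolding q_def using powr_mono[of "- ((real k - \<alpha>) / 2) * real n" 0 2] by simp
  qed
  have "measure M {\<omega> \<in> space M. X (Suc n) g z \<omega> > X n g z \<omega> * (1 + A * q n) + t * q n / \<theta>} \<le> exp (- t)"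
    if g: "orthogonal_transformation g" for n g z t
  proof -
    define lam where "lam = \<theta> / q n"
    have lam: "lam > 0" using \<theta> q by (simp add: lam_def)
    define a where "a F \<omega> = lam * coef n g z F \<omega>" for F \<omega>
    obtain col where col0: "\<forall>F\<in>cells (Suc n). col F < N"
      "\<forall>F\<in>cells (Suc n). \<forall>F'\<in>cells (Suc n). F \<noteq> F' \<longrightarrow> par n F = par n F' \<longrightarrow> col F \<noteq> (col F' :: nat)"
      using colex[of n] by (elim exE conjE)
    have col: "col F < N" if "F \<in> cells (Suc n)" for F using col0(1) that ..
    have cb: "0 \<le> coef n g z F \<omega>" "coef n g z F \<omega> \<le> A0 * (q n)\<^sup>2" if "F \<in> cells (Suc n)" "\<omega> \<in> space M" for F \<omega>
      using coef_bounds[OF g that, of z] by (auto simp: A0_def q_def)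
    define Z where "Z \<omega> = (\<Sum>F\<in>cells (Suc n). a F \<omega> * (W (Suc n) F \<omega> - 1)) - real N * C\<^sup>2 * (\<Sum>F\<in>cells (Suc n). (a F \<omega>)\<^sup>2)" for \<omega>
    have mom: "integrable M (\<lambda>\<omega>. exp (Z \<omega>))" "(\<integral>\<omega>. exp (Z \<omega>) \<partial>M) \<le> 1"
    proof -
      have ci: "cond_indep M (G n) (W (Suc n)) K" if K: "K \<subseteq> {F \<in> cells (Suc n). col F = i}" for K i
      proof (rule W_indep)
        show "K \<subseteq> cells (Suc n)" using K by blast
        fix F F' assume FF: "F \<in> K" "F' \<in> K" "F \<noteq> F'"
        show "\<not> (\<exists>P\<in>cells n. F \<subseteq> P \<and> F' \<subseteq> P)"
        proof
          assume "\<exists>P\<in>cells n. F \<subseteq> P \<and> F' \<subseteq> P"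
          then obtain P where P: "P \<in> cells n" "F \<subseteq> P" "F' \<subseteq> P" by blast
          have F: "F \<in> cells (Suc n)" "F' \<in> cells (Suc n)" "col F = i" "col F' = i" using K FF by auto
          have "par n F = par n F'" using par_unique[OF F(1) P(1,2)] par_unique[OF F(2) P(1,3)] by simp
          then show False using col0(2)[rule_format, OF F(1,2) FF(3)] F by simp
        qed
      qed
      have aG: "a F \<in> borel_measurable (G n)" if F: "F \<in> cells (Suc n)" for F
        unfolding a_def coef_def using mu_measurable_G[of "pt F" n n] pt[OF F] cell_subset[OF F] by auto
      have ab: "0 \<le> a F \<omega> \<and> real N * a F \<omega> * C \<le> 1" if "F \<in> cells (Suc n)" "\<omega> \<in> space M" for F \<omega>
      proof
        show "0 \<le> a F \<omega>" unfolding a_def using cb[OF that] lam by simp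
        have "a F \<omega> \<le> lam * (A0 * (q n)\<^sup>2)" unfolding a_def using cb[OF that] lam by (intro mult_left_mono) auto
        also have "\<dots> = \<theta> * A0 * q n" using q[of n] by (simp add: lam_def power2_eq_square)
        also have "\<dots> \<le> \<theta> * A0 * 1" using q[of n] \<theta> A0 by (intro mult_left_mono) auto
        finally have "real N * a F \<omega> * C \<le> real N * (\<theta> * A0) * C" using C by (intro mult_left_mono mult_right_mono) auto
        also have "\<dots> = 1" using N A0 C by (simp add: \<theta>_def)
        finally show "real N * a F \<omega> * C \<le> 1" .
      qed
      show "integrable M (\<lambda>\<omega>. exp (Z \<omega>))" unfolding Z_def
        by (rule cond_indep_exp_moment(1)[OF prob subalg_G finite_cells N col ci _ C])
          (use W_measurable W_bounds W_mean aG ab in auto)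
      show "(\<integral>\<omega>. exp (Z \<omega>) \<partial>M) \<le> 1" unfolding Z_def
        by (rule cond_indep_exp_moment(2)[OF prob subalg_G finite_cells N col ci _ C])
          (use W_measurable W_bounds W_mean aG ab in auto)
    qed
    have "{\<omega> \<in> space M. X (Suc n) g z \<omega> > X n g z \<omega> * (1 + A * q n) + t * q n / \<theta>} \<subseteq> {\<omega> \<in> space M. exp (Z \<omega>) \<ge> exp t}"
    proof (intro subsetI CollectI conjI; elim CollectE conjE)
      fix \<omega> assume \<omega>: "\<omega> \<in> space M" and gt: "X (Suc n) g z \<omega> > X n g z \<omega> * (1 + A * q n) + t * q n / \<theta>"
      \<comment> \<open>One factor of each square is bounded by the maximal coefficient; the other
        factors add up to \<open>X n\<close>.\<close>
      have "(\<Sum>F\<in>cells (Suc n). (a F \<omega>)\<^sup>2) \<le> (\<Sum>F\<in>cells (Suc n). lam\<^sup>2 * (A0 * (q n)\<^sup>2 * coef n g z F \<omega>))"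
      proof (intro sum_mono)
        fix F assume F: "F \<in> cells (Suc n)"
        have "(coef n g z F \<omega>)\<^sup>2 \<le> A0 * (q n)\<^sup>2 * coef n g z F \<omega>"
          unfolding power2_eq_square[of "coef n g z F \<omega>"] using cb[OF F \<omega>] by (intro mult_right_mono) auto
        then show "(a F \<omega>)\<^sup>2 \<le> lam\<^sup>2 * (A0 * (q n)\<^sup>2 * coef n g z F \<omega>)"
          unfolding a_def power_mult_distrib by (intro mult_left_mono) auto
      qed
      also have "\<dots> = lam\<^sup>2 * A0 * (q n)\<^sup>2 * X n g z \<omega>"
        unfolding X_refine[OF g] by (simp add: sum_distrib_left mult_ac)
      also have "\<dots> = \<theta>\<^sup>2 * A0 * X n g z \<omega>" using q[of n] by (simp add: lam_def power_divide)
      finally have sq: "real N * C\<^sup>2 * (\<Sum>F\<in>cells (Suc n). (a F \<omega>)\<^sup>2) \<le> real N * C\<^sup>2 * (\<theta>\<^sup>2 * A0 * X n g z \<omega>)"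
        by (intro mult_left_mono) auto
      have lin: "(\<Sum>F\<in>cells (Suc n). a F \<omega> * (W (Suc n) F \<omega> - 1)) = lam * (X (Suc n) g z \<omega> - X n g z \<omega>)"
        unfolding X_step[OF g] a_def by (simp add: sum_distrib_left mult_ac)
      have "lam * (X (Suc n) g z \<omega> - X n g z \<omega>) > lam * (A * q n * X n g z \<omega> + t * q n / \<theta>)"
        using gt lam by (intro mult_strict_left_mono) (auto simp: algebra_simps)
      also have "lam * (A * q n * X n g z \<omega> + t * q n / \<theta>) = real N * C\<^sup>2 * (\<theta>\<^sup>2 * A0 * X n g z \<omega>) + t"
        using q[of n] \<theta> by (simp add: lam_def A_def power2_eq_square field_simps)
      finally show "exp t \<le> exp (Z \<omega>)" using sq lin unfolding Z_def by simp
    qed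
    then have "measure M {\<omega> \<in> space M. X (Suc n) g z \<omega> > X n g z \<omega> * (1 + A * q n) + t * q n / \<theta>}
        \<le> measure M {\<omega> \<in> space M. exp (Z \<omega>) \<ge> exp t}"
    proof (intro finite_measure_mono)
      have [measurable]: "(\<lambda>\<omega>. exp (Z \<omega>)) \<in> borel_measurable M" using mom(1) by (rule borel_measurable_integrable)
      show "{\<omega> \<in> space M. exp t \<le> exp (Z \<omega>)} \<in> events" by measurable
    qed
    also have "\<dots> \<le> (\<integral>\<omega>. exp (Z \<omega>) \<partial>M) / exp t"
      by (rule integral_Markov_inequality_measure[OF mom(1), of "{}"]) auto
    also have "\<dots> \<le> 1 / exp t" using mom(2) by (intro divide_right_mono) auto
    finally show ?thesis by (simp add: exp_minus inverse_eq_divide)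
  qed
  then show ?thesis using that[OF \<theta> A] unfolding q_def by blast
qed

text \<open>The isometry f(x) = h x + w carries the plane of (g', z') to that of (g, z), parameter
  by parameter. If a parameter leads into F on the plane of (g, z) but not on that of (g', z'), its
  point on the former lies in F minus f(F), which non-flatness makes small. The sum over the cells
  costs their number, to be compensated by exponentially fine nets.\<close>

lemma X_continuous:
  assumes g: "orthogonal_transformation g" "orthogonal_transformation g'"
    and close: "\<And>x. norm (g x - g' x) \<le> \<epsilon> * norm x" "norm (z - z') \<le> \<epsilon>" and z': "norm z' \<le> R" and \<epsilon>: "\<epsilon> > 0"
    and R: "0 \<le> R" and \<omega>: "\<omega> \<in> space M"
  shows "X n g z \<omega> \<le> X n g' z' \<omega> + real (card (cells n)) *
     (2 powr (\<alpha> * real n) / C1 * (4 ^ k / unit_ball_vol (real k) * (Cn * ((2 + R) * \<epsilon>) powr \<gamma>)))"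
proof -
  note lin = g[THEN orthogonal_transformation_imp_linear]
  define B where "B = 4 ^ k / unit_ball_vol (real k) * (Cn * ((2 + R) * \<epsilon>) powr \<gamma>)"
  have B: "0 \<le> B" using Cn by (simp add: B_def)
  have nu: "nu g z F \<le> nu g' z' F + B" if F: "F \<in> cells n" for F
  proof -
    define i where "i = inv g'"
    have bij: "bij g'" by (rule orthogonal_transformation_bij[OF g(2)])
    have i: "orthogonal_transformation i" unfolding i_def by (rule orthogonal_transformation_inv[OF g(2)])
    have ig: "i (g' x) = x" "g' (i x) = x" for x
      using bij by (simp_all add: i_def bij_is_inj bij_is_surj surj_f_inv_f)
    have linv: "linear i" by (rule orthogonal_transformation_imp_linear[OF i])
    define h where "h = g \<circ> i"
    have h: "orthogonal_transformation h" unfolding h_def by (rule orthogonal_transformation_compose[OF g(1) i])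
    define w where "w = z - h z'"
    have hclose: "norm (h x - x) \<le> \<epsilon> * norm x" for x
      using close(1)[of "i x"] ig(2)[of x] orthogonal_transformation_norm[OF i, of x] by (simp add: h_def)
    have on: "onorm (\<lambda>x. h x - x) \<le> \<epsilon>" using hclose by (rule onorm_le)
    \<comment> \<open>The base points differ by at most \<epsilon>, and \<open>h\<close> moves
      \<open>z'\<close> by at most \<epsilon>R; another \<epsilon> for the linear part gives (2 +
      R)\<epsilon>.\<close>
    have nw: "norm w \<le> \<epsilon> + \<epsilon> * R"
    proof -
      have "norm w \<le> norm (z - z') + norm (h z' - z')"
        unfolding w_def using norm_triangle_ineq4[of "z - z'" "h z' - z'"] by simp
      also have "\<dots> \<le> \<epsilon> + \<epsilon> * R" using close(2) hclose[of z'] mult_left_mono[OF z', of \<epsilon>] \<epsilon> by linarith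
      finally show ?thesis .
    qed
    let ?f = "\<lambda>x. h x + w"
    have tot: "onorm (\<lambda>x. h x - x) + norm w \<le> (2 + R) * \<epsilon>" using on nw by (simp add: algebra_simps)
    have pos: "(2 + R) * \<epsilon> > 0" using R \<epsilon> by simp
    have nfb: "hausdorff_measure k (range (flat_map D g z) \<inter> F - ?f ` F) \<le> ennreal (Cn * ((2 + R) * \<epsilon>) powr \<gamma>)"
      using nf[OF F] range_flat_map_affine_plane[OF g(1) D, of z] h tot pos unfolding nf_bound_def by blast
    \<comment> \<open>The image is rewritten as a preimage under the inverse isometry, which shows
      that it is Borel.\<close>
    have fimg: "?f ` F = (\<lambda>y. g' (inv g (y - z)) + z') -` F"
    proof -
      have bg: "bij g" by (rule orthogonal_transformation_bij[OF g(1)])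
      have lh: "linear h" by (rule orthogonal_transformation_imp_linear[OF h])
      have f1: "?f x = y \<longleftrightarrow> x = g' (inv g (y - z)) + z'" for x y
      proof
        assume "?f x = y"
        then have "y - z = h (x - z')" unfolding w_def by (simp add: linear_diff[OF lh] algebra_simps)
        then have "inv g (y - z) = i (x - z')" using bg by (simp add: h_def bij_is_inj)
        then show "x = g' (inv g (y - z)) + z'" by (simp add: ig)
      next
        assume x: "x = g' (inv g (y - z)) + z'"
        have "?f x = h (x - z') + z" unfolding w_def by (simp add: linear_diff[OF lh])
        also have "\<dots> = y" unfolding x h_def using bg by (simp add: ig bij_is_surj surj_f_inv_f)
        finally show "?f x = y" .
      qed
      show ?thesis
      proof (intro set_eqI iffI)
        fix y assume "y \<in> ?f ` F"
        then obtain x where "x \<in> F" "?f x = y" by blast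
        then show "y \<in> (\<lambda>y. g' (inv g (y - z)) + z') -` F" using f1[of x y] by simp
      next
        fix y assume "y \<in> (\<lambda>y. g' (inv g (y - z)) + z') -` F"
        then have "g' (inv g (y - z)) + z' \<in> F" by simp
        moreover have "?f (g' (inv g (y - z)) + z') = y" using f1 by blast
        ultimately show "y \<in> ?f ` F" by (rule rev_image_eqI[OF _ sym])
      qed
    qed
    have Fb: "F \<in> sets borel" by (rule cell_borel[OF F])
    have "linear (inv g)" by (intro orthogonal_transformation_imp_linear orthogonal_transformation_inv g)
    then have "continuous_on UNIV (\<lambda>y. g' (inv g (y - z)) + z')"
    proof -
      assume "linear (inv g)"
      then have c2: "continuous_on UNIV (inv g)" and c1: "continuous_on UNIV g'"
        using lin(2) linear_continuous_on linear_conv_bounded_linear by blast+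
      have "continuous_on UNIV (\<lambda>y. inv g (y - z))"
        by (rule continuous_on_compose2[OF c2]) (auto intro!: continuous_intros)
      then have "continuous_on UNIV (\<lambda>y. g' (inv g (y - z)))"
        by (rule continuous_on_compose2[OF c1]) auto
      then show ?thesis by (intro continuous_intros)
    qed
    then have "(\<lambda>y. g' (inv g (y - z)) + z') \<in> borel_measurable borel"
      by (rule borel_measurable_continuous_onI)
    from measurable_sets[OF this Fb] have fb: "?f ` F \<in> sets borel" unfolding fimg by simp
    have dif: "F - ?f ` F \<in> sets borel" "bounded (F - ?f ` F)"
      by (rule sets.Diff[OF Fb fb], rule bounded_subset[OF bounded_cell[OF F] Diff_subset])
    have key: "emeasure (flat_measure D g z) F \<le> emeasure (flat_measure D g' z') F + emeasure (flat_measure D g z) (F - ?f ` F)"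
    proof -
      let ?P = "PiM D (\<lambda>_. lborel) :: ('a \<Rightarrow> real) measure"
      let ?A = "{t \<in> space ?P. flat_map D g z t \<in> F}" and ?A' = "{t \<in> space ?P. flat_map D g' z' t \<in> F}"
        and ?A'' = "{t \<in> space ?P. flat_map D g z t \<in> F - ?f ` F}"
      have m: "?A' \<in> sets ?P" "?A'' \<in> sets ?P"
        using measurable_sets[OF flat_map_measurable[OF lin(2), of D z'] Fb]
          measurable_sets[OF flat_map_measurable[OF lin(1), of D z] dif(1)]
        by (simp_all add: vimage_def Int_def conj_commute)
      have sub: "?A \<subseteq> ?A' \<union> ?A''"
      proof
        fix t assume t: "t \<in> ?A"
        have "?f (flat_map D g' z' t) = h (g' (\<Sum>b\<in>D. t b *\<^sub>R b)) + z"
          unfolding flat_map_def w_def linear_add[OF orthogonal_transformation_imp_linear[OF h]] by simp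
        also have "\<dots> = flat_map D g z t" by (simp add: h_def ig flat_map_def)
        finally have eq: "?f (flat_map D g' z' t) = flat_map D g z t" .
        show "t \<in> ?A' \<union> ?A''"
        proof (cases "flat_map D g z t \<in> ?f ` F")
          case True
          then obtain x where x: "x \<in> F" "flat_map D g z t = ?f x" by blast
          then have "h x = h (flat_map D g' z' t)" using eq by simp
          then have "x = flat_map D g' z' t" using orthogonal_transformation_inj[OF h] by (simp add: inj_eq)
          then show ?thesis using x t by simp
        qed (use t in simp)
      qed
      have "emeasure ?P ?A \<le> emeasure ?P (?A' \<union> ?A'')" using m sub by (intro emeasure_mono) auto
      also have "\<dots> \<le> emeasure ?P ?A' + emeasure ?P ?A''" by (rule emeasure_subadditive[OF m])
      finally show ?thesis
        unfolding emeasure_flat_measure[OF lin(1) Fb] emeasure_flat_measure[OF lin(2) Fb] emeasure_flat_measure[OF lin(1) dif(1)] .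
    qed
    have "ennreal (unit_ball_vol (real k) / 4 ^ k) * emeasure (flat_measure D g z) (F - ?f ` F)
       \<le> ennreal (Cn * ((2 + R) * \<epsilon>) powr \<gamma>)"
    proof -
      have "(F - ?f ` F) \<inter> range (flat_map D g z) = range (flat_map D g z) \<inter> F - ?f ` F" by blast
      then show ?thesis using flat_measure_le_hausdorff_measure[OF g(1) D dif(1), of z] nfb by auto
    qed
    then have "ennreal (unit_ball_vol (real k) / 4 ^ k * nu g z (F - ?f ` F)) \<le> ennreal (Cn * ((2 + R) * \<epsilon>) powr \<gamma>)"
      unfolding emeasure_eq_nu[OF g(1) dif] by (subst ennreal_mult') (auto simp: less_imp_le)
    then have "unit_ball_vol (real k) / 4 ^ k * nu g z (F - ?f ` F) \<le> Cn * ((2 + R) * \<epsilon>) powr \<gamma>"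
      using Cn by (subst (asm) ennreal_le_iff) auto
    then have "nu g z (F - ?f ` F) \<le> B" by (simp add: B_def field_simps)
    moreover have "nu g z F \<le> nu g' z' F + nu g z (F - ?f ` F)"
      using key unfolding emeasure_eq_nu[OF g(1) dif] emeasure_eq_nu[OF g(1) Fb bounded_cell[OF F]] emeasure_eq_nu[OF g(2) Fb bounded_cell[OF F]]
      by (simp add: nu_nonneg flip: ennreal_plus)
    ultimately show ?thesis by linarith
  qed
  have "X n g z \<omega> \<le> (\<Sum>F\<in>cells n. mu n \<omega> (pt F) * nu g' z' F + 2 powr (\<alpha> * real n) / C1 * B)"
    unfolding X_def
  proof (intro sum_mono)
    fix F assume F: "F \<in> cells n"
    have "mu n \<omega> (pt F) * nu g z F \<le> mu n \<omega> (pt F) * (nu g' z' F + B)"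
      using nu[OF F] mu_nonneg[OF \<omega>] by (intro mult_left_mono)
    also have "\<dots> \<le> mu n \<omega> (pt F) * nu g' z' F + 2 powr (\<alpha> * real n) / C1 * B"
      unfolding distrib_left using mu_le[OF \<omega>] B by (intro add_left_mono mult_right_mono)
    finally show "mu n \<omega> (pt F) * nu g z F \<le> mu n \<omega> (pt F) * nu g' z' F + 2 powr (\<alpha> * real n) / C1 * B" .
  qed
  also have "\<dots> = X n g' z' \<omega> + real (card (cells n)) * (2 powr (\<alpha> * real n) / C1 * B)"
    by (simp add: sum.distrib X_def)
  finally show ?thesis by (simp add: B_def)
qed

end

context nonflat_subdivision
begin

section \<open>A bound uniform in all planes and levels\<close>

definition Dt :: "nat \<Rightarrow> real" where
  "Dt n = 2 powr (\<bar>\<alpha>\<bar> * real n) / C1 * (2 * diameter F0) ^ k"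

lemma Dt_nonneg: "0 \<le> Dt n"
  using C1 diameter_ge_0[OF F0(2)] by (simp add: Dt_def)

lemma Dt_mono: "m \<le> n \<Longrightarrow> Dt m \<le> Dt n"
  unfolding Dt_def using C1 diameter_ge_0[OF F0(2)]
  by (intro mult_right_mono divide_right_mono powr_mono mult_left_mono) auto

text \<open>A deterministic bound, growing with n but uniform in the plane. It starts the induction
  at the random level after which no bad event occurs, and it covers the levels before. The absolute
  value of \<alpha> in \<open>Dt\<close> makes it monotone in n.\<close>

lemma X_le_Dt:
  assumes g: "orthogonal_transformation g" and \<omega>: "\<omega> \<in> space M"
  shows "X n g z \<omega> \<le> Dt n"
proof -
  have "X n g z \<omega> \<le> (\<Sum>F\<in>cells n. 2 powr (\<alpha> * real n) / C1 * nu g z F)"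
    unfolding X_def using mu_le[OF \<omega>] by (intro sum_mono mult_right_mono nu_nonneg)
  also have "\<dots> = 2 powr (\<alpha> * real n) / C1 * nu g z (\<Union>(cells n))"
    unfolding sum_distrib_left[symmetric]
    by (subst nu_Union[OF g finite_cells disjoint_cells]) (use cell_borel bounded_cell in auto)
  also have "\<dots> \<le> 2 powr (\<bar>\<alpha>\<bar> * real n) / C1 * (2 * diameter F0) ^ k"
  proof (intro mult_mono divide_right_mono powr_mono)
    show "nu g z (\<Union>(cells n)) \<le> (2 * diameter F0) ^ k"
      unfolding Union_cells by (intro nu_le_diameter g F0) simp
  qed (use C1 nu_nonneg in \<open>auto intro: mult_right_mono\<close>)
  finally show ?thesis by (simp add: Dt_def)
qed

text \<open>Outside the bad events a bound S for all planes at level n yields a bound S' at level n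
  + 1 with S' + 1 = (S + 1)(1 + u n) and u summable: variance factor and deviation come from the net
  points, the remainder from Hoelder continuity. This shows finiteness; \<open>K\<close> itself is
  built from a supremum over countably many net points, hence is measurable.\<close>

lemma X_sup_bounded:
  assumes R: "1 \<le> R"
  obtains K where "K \<in> borel_measurable M" "\<And>\<omega>. 0 \<le> K \<omega>"
    "AE \<omega> in M. \<forall>n g z. orthogonal_transformation g \<longrightarrow> norm z \<le> R \<longrightarrow> X n g z \<omega> \<le> K \<omega>"
proof -
  define d where "d = real DIM('a)"
  obtain L :: nat and c :: real where c: "c > 0" and net: "\<And>\<epsilon>. 0 < \<epsilon> \<Longrightarrow> \<epsilon> \<le> 1 \<Longrightarrow>
      \<exists>T :: (('a \<Rightarrow> 'a) \<times> 'a) set. finite T \<and> real (card T) \<le> c * (1 / \<epsilon>) ^ L \<and> is_flat_net R \<epsilon> T"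
    by (rule flat_net[OF R], rule that)
  obtain c0 where c0: "c0 > 0" "\<And>n. real (card (cells n)) \<le> c0 * 2 powr (real DIM('a) * real n)"
    using card_cells by blast
  obtain \<theta> A where \<theta>: "\<theta> > 0" and A: "A > 0" and bad: "\<And>n g z t. orthogonal_transformation g \<Longrightarrow>
      measure M {\<omega> \<in> space M. X (Suc n) g z \<omega> > X n g z \<omega> * (1 + A * 2 powr (- ((real k - \<alpha>) / 2) * real n))
         + t * 2 powr (- ((real k - \<alpha>) / 2) * real n) / \<theta>} \<le> exp (- t)"
    by (rule bad_event, rule that)
  \<comment> \<open>Nets have mesh 2^(-e0 n). The continuity error is multiplied by the number 2^(d
    n) of cells and by the density 2^(\<alpha> n), up to constants; this e0 leaves 2^-n.\<close>
  define e0 where "e0 = (d + \<bar>\<alpha>\<bar> + 1) / \<gamma>"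
  have e0: "e0 > 0" using \<gamma> by (simp add: e0_def d_def add_pos_pos)
  define \<epsilon> where "\<epsilon> n = 2 powr (- e0 * real n)" for n
  have \<epsilon>: "0 < \<epsilon> n" "\<epsilon> n \<le> 1" for n
  proof -
    show "0 < \<epsilon> n" by (simp add: \<epsilon>_def)
    have "- e0 * real n \<le> 0" using e0 by simp
    then show "\<epsilon> n \<le> 1" unfolding \<epsilon>_def using powr_mono[of "- e0 * real n" 0 2] by simp
  qed
  have "\<forall>n. \<exists>T :: (('a \<Rightarrow> 'a) \<times> 'a) set. finite T \<and> real (card T) \<le> c * (1 / \<epsilon> n) ^ L \<and> is_flat_net R (\<epsilon> n) T"
    using net \<epsilon> by blast
  from choice[OF this] obtain T :: "nat \<Rightarrow> (('a \<Rightarrow> 'a) \<times> 'a) set"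
    where T0: "\<forall>n. finite (T n) \<and> real (card (T n)) \<le> c * (1 / \<epsilon> n) ^ L \<and> is_flat_net R (\<epsilon> n) (T n)"
    by (rule exE)
  have T: "finite (T n)" "real (card (T n)) \<le> c * (1 / \<epsilon> n) ^ L" and Tn: "is_flat_net R (\<epsilon> n) (T n)" for n
    using T0 by blast+
  have Th: "orthogonal_transformation (fst h)" "norm (snd h) \<le> R" if "h \<in> T n" for h n
    using Tn[of n] that unfolding is_flat_net_def by blast+
  have Tnet: "\<exists>h\<in>T n. (\<forall>x. norm (g x - fst h x) \<le> \<epsilon> n * norm x) \<and> norm (z - snd h) \<le> \<epsilon> n"
    if "orthogonal_transformation g" "norm z \<le> R" for g z n
    using Tn[of n] that unfolding is_flat_net_def by blast
  define cH where "cH = 4 ^ k / unit_ball_vol (real k)"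
  have cH: "cH > 0" by (simp add: cH_def)
  define c1 where "c1 = c0 * 2 powr (d + \<bar>\<alpha>\<bar>) / C1 * cH * Cn * (2 + R) powr \<gamma>"
  have c1: "c1 > 0" using c0 C1 cH Cn R by (simp add: c1_def)
  have cont: "X (Suc n) g z \<omega> \<le> X (Suc n) (fst h) (snd h) \<omega> + c1 * (1 / 2) ^ n"
    if \<omega>: "\<omega> \<in> space M" and g: "orthogonal_transformation g" and h: "h \<in> T n"
      "\<forall>x. norm (g x - fst h x) \<le> \<epsilon> n * norm x" "norm (z - snd h) \<le> \<epsilon> n" for \<omega> g z h n
  proof -
    let ?B = "2 powr (\<alpha> * real (Suc n)) / C1 * (4 ^ k / unit_ball_vol (real k) * (Cn * ((2 + R) * \<epsilon> n) powr \<gamma>))"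
    have B0: "0 \<le> ?B" using C1 Cn by simp
    have "X (Suc n) g z \<omega> \<le> X (Suc n) (fst h) (snd h) \<omega> + real (card (cells (Suc n))) * ?B"
      by (rule X_continuous[OF g Th(1)[OF h(1)] h(2)[rule_format] h(3) Th(2)[OF h(1)] \<epsilon>(1)]) (use R \<omega> in auto)
    moreover have "real (card (cells (Suc n))) * ?B \<le> c0 * 2 powr (d * real (Suc n)) * ?B"
      using c0(2)[of "Suc n"] B0 by (intro mult_right_mono) (auto simp: d_def)
    moreover have "c0 * 2 powr (d * real (Suc n)) * ?B \<le> c1 * (1 / 2) ^ n"
    proof -
      have eg: "e0 * \<gamma> = d + \<bar>\<alpha>\<bar> + 1" using \<gamma> by (simp add: e0_def)
      have "- e0 * real n * \<gamma> = - (e0 * \<gamma>) * real n" by simp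
      then have e: "(\<epsilon> n) powr \<gamma> = 2 powr (- (d + \<bar>\<alpha>\<bar> + 1) * real n)"
        unfolding \<epsilon>_def powr_powr eg by (rule arg_cong)
      have m: "((2 + R) * \<epsilon> n) powr \<gamma> = (2 + R) powr \<gamma> * 2 powr (- (d + \<bar>\<alpha>\<bar> + 1) * real n)"
        using R \<epsilon>(1)[of n] by (simp add: powr_mult e)
      have "2 powr (d * real (Suc n)) * 2 powr (\<alpha> * real (Suc n)) * 2 powr (- (d + \<bar>\<alpha>\<bar> + 1) * real n)
         = 2 powr (d * real (Suc n) + \<alpha> * real (Suc n) - (d + \<bar>\<alpha>\<bar> + 1) * real n)"
        unfolding powr_add[symmetric] by (rule arg_cong[where f="\<lambda>x. 2 powr x"]) (simp add: algebra_simps)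
      also have "\<dots> \<le> 2 powr (d + \<bar>\<alpha>\<bar> - real n)"
      proof (intro powr_mono)
        have "\<alpha> * real (Suc n) \<le> \<bar>\<alpha>\<bar> * real (Suc n)" by (intro mult_right_mono) auto
        then show "d * real (Suc n) + \<alpha> * real (Suc n) - (d + \<bar>\<alpha>\<bar> + 1) * real n \<le> d + \<bar>\<alpha>\<bar> - real n"
          by (simp add: algebra_simps)
      qed simp
      also have "\<dots> = 2 powr (d + \<bar>\<alpha>\<bar>) * (1 / 2) ^ n"
        by (simp add: powr_diff powr_realpow power_divide)
      finally have p: "2 powr (d * real (Suc n)) * 2 powr (\<alpha> * real (Suc n)) * 2 powr (- (d + \<bar>\<alpha>\<bar> + 1) * real n)
         \<le> 2 powr (d + \<bar>\<alpha>\<bar>) * (1 / 2) ^ n" .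
      have "c0 * 2 powr (d * real (Suc n)) * ?B = (c0 / C1 * cH * Cn * (2 + R) powr \<gamma>) *
          (2 powr (d * real (Suc n)) * 2 powr (\<alpha> * real (Suc n)) * 2 powr (- (d + \<bar>\<alpha>\<bar> + 1) * real n))"
        unfolding m cH_def by (simp add: mult_ac)
      also have "\<dots> \<le> (c0 / C1 * cH * Cn * (2 + R) powr \<gamma>) * (2 powr (d + \<bar>\<alpha>\<bar>) * (1 / 2) ^ n)"
        using c0 C1 cH Cn R by (intro mult_left_mono p) auto
      also have "\<dots> = c1 * (1 / 2) ^ n" by (simp add: c1_def mult_ac)
      finally show ?thesis .
    qed
    ultimately show ?thesis by linarith
  qed
  define q where "q = 2 powr (- ((real k - \<alpha>) / 2))"
  have q: "0 < q" "q < 1"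
  proof -
    show "0 < q" by (simp add: q_def)
    have "2 powr (- ((real k - \<alpha>) / 2)) < 2 powr 0" using \<alpha>k by (intro powr_less_mono) auto
    then show "q < 1" by (simp add: q_def)
  qed
  have qn: "2 powr (- ((real k - \<alpha>) / 2) * real n) = q ^ n" for n
    unfolding q_def by (simp add: powr_power mult.commute)
  \<comment> \<open>exp(- t n) beats the size 2^(e0 L n) of the net by a further 2^-n, while linear
    growth of \<open>t\<close> keeps \<open>t n * q ^ n\<close> summable.\<close>
  define t where "t n = (e0 * real L + 1) * ln 2 * real n" for n
  define Bad where "Bad n = (\<Union>h\<in>T n. {\<omega> \<in> space M. X (Suc n) (fst h) (snd h) \<omega> >
       X n (fst h) (snd h) \<omega> * (1 + A * q ^ n) + t n * q ^ n / \<theta>})" for n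
  have Bad1: "{\<omega> \<in> space M. X (Suc n) g z \<omega> > X n g z \<omega> * (1 + A * q ^ n) + t n * q ^ n / \<theta>} \<in> sets M" for n g z
    using X_measurable[measurable] by measurable
  have BadM: "Bad n \<in> sets M" for n
    unfolding Bad_def by (rule sets.finite_UN[OF T(1) Bad1])
  have BadP: "measure M (Bad n) \<le> c * (1 / 2) ^ n" for n
  proof -
    have "measure M (Bad n) \<le> (\<Sum>h\<in>T n. measure M {\<omega> \<in> space M. X (Suc n) (fst h) (snd h) \<omega> >
       X n (fst h) (snd h) \<omega> * (1 + A * q ^ n) + t n * q ^ n / \<theta>})"
      unfolding Bad_def by (rule finite_measure_subadditive_finite[OF T(1) image_subsetI[OF Bad1]])
    also have "\<dots> \<le> (\<Sum>h\<in>T n. exp (- t n))"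
      using bad[OF Th(1)] unfolding qn by (intro sum_mono) blast
    also have "\<dots> = real (card (T n)) * exp (- t n)" by simp
    also have "\<dots> \<le> c * (1 / \<epsilon> n) ^ L * exp (- t n)" using T(2)[of n] by (intro mult_right_mono) auto
    also have "exp (- t n) = 2 powr (- (e0 * real L + 1) * real n)" unfolding t_def powr_def by (simp add: algebra_simps)
    also have "(1 / \<epsilon> n) ^ L = 2 powr (e0 * real L * real n)"
    proof -
      have "1 / \<epsilon> n = 2 powr (e0 * real n)" by (simp add: \<epsilon>_def powr_minus_divide)
      then show ?thesis by (simp add: powr_power mult_ac)
    qed
    also have "c * 2 powr (e0 * real L * real n) * 2 powr (- (e0 * real L + 1) * real n) = c * 2 powr (- real n)"
      by (simp add: powr_add[symmetric] algebra_simps)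
    also have "2 powr (- real n) = (1 / 2) ^ n" by (simp add: powr_minus_divide powr_realpow power_divide)
    finally show ?thesis .
  qed
  have "summable (\<lambda>n. measure M (Bad n))"
    by (rule summable_comparison_test[of _ "\<lambda>n. c * (1 / 2) ^ n"]) (use BadP in \<open>auto intro: summable_mult summable_geometric\<close>)
  then have BC: "AE \<omega> in M. eventually (\<lambda>n. \<omega> \<in> space M - Bad n) sequentially"
    by (intro borel_cantelli_AE1 BadM) (auto simp: emeasure_eq_measure)
  \<comment> \<open>Variance factor, allowed deviation and continuity error. \<open>Suc n\<close> in
    place of \<open>n\<close> matches the derivative of the geometric series.\<close>
  define u where "u n = A * q ^ n + (e0 * real L + 1) * ln 2 / \<theta> * (real (Suc n) * q ^ n) + c1 * (1 / 2) ^ n" for n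
  have u0: "0 \<le> u n" for n
    unfolding u_def using A q e0 \<theta> c1 by (intro add_nonneg_nonneg mult_nonneg_nonneg divide_nonneg_nonneg) auto
  have usum: "summable u"
    unfolding u_def using q geometric_deriv_sums[of q]
    by (intro summable_add summable_mult summable_geometric) (auto simp: sums_iff)
  have bounded: "\<exists>S. \<forall>n g z. orthogonal_transformation g \<longrightarrow> norm z \<le> R \<longrightarrow> X n g z \<omega> \<le> S"
    if \<omega>: "\<omega> \<in> space M" and ev: "eventually (\<lambda>n. \<omega> \<in> space M - Bad n) sequentially" for \<omega>
  proof -
    obtain n0 where n0: "\<And>n. n \<ge> n0 \<Longrightarrow> \<omega> \<notin> Bad n" using ev by (auto simp: eventually_sequentially)
    \<comment> \<open>Adding 1 on both sides absorbs the additive errors into the factor 1 + u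
      n.\<close>
    have step: "X (Suc n) g z \<omega> + 1 \<le> (S + 1) * (1 + u n)"
      if S: "\<And>g z. orthogonal_transformation g \<Longrightarrow> norm z \<le> R \<Longrightarrow> X n g z \<omega> \<le> S" and "0 \<le> S" "n \<ge> n0"
        and g: "orthogonal_transformation g" "norm z \<le> R" for n S g z
    proof -
      obtain h where h: "h \<in> T n" "\<forall>x. norm (g x - fst h x) \<le> \<epsilon> n * norm x" "norm (z - snd h) \<le> \<epsilon> n"
        using Tnet[OF g, of n] by blast
      have 1: "X (Suc n) g z \<omega> \<le> X (Suc n) (fst h) (snd h) \<omega> + c1 * (1 / 2) ^ n"
        by (rule cont[OF \<omega> g(1) h])
      have 2: "X (Suc n) (fst h) (snd h) \<omega> \<le> X n (fst h) (snd h) \<omega> * (1 + A * q ^ n) + t n * q ^ n / \<theta>"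
        using n0[OF \<open>n \<ge> n0\<close>] h(1) \<omega> unfolding Bad_def by (auto simp: not_less)
      have 3: "X n (fst h) (snd h) \<omega> * (1 + A * q ^ n) \<le> S * (1 + A * q ^ n)"
        using S[OF Th[OF h(1)]] A q by (intro mult_right_mono) auto
      have 4: "t n * q ^ n / \<theta> \<le> (e0 * real L + 1) * ln 2 / \<theta> * (real (Suc n) * q ^ n)"
      proof -
        have "t n * q ^ n / \<theta> = (e0 * real L + 1) * ln 2 / \<theta> * (real n * q ^ n)" by (simp add: t_def)
        also have "\<dots> \<le> (e0 * real L + 1) * ln 2 / \<theta> * (real (Suc n) * q ^ n)"
          using e0 \<theta> q by (intro mult_left_mono mult_right_mono) auto
        finally show ?thesis .
      qed
      have 5: "S * (A * q ^ n) \<le> S * u n"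
      proof (intro mult_left_mono)
        have "0 \<le> (e0 * real L + 1) * ln 2 / \<theta> * (real (Suc n) * q ^ n)" "0 \<le> c1 * (1 / 2) ^ n"
          using e0 \<theta> q c1 by auto
        then show "A * q ^ n \<le> u n" unfolding u_def by linarith
      qed fact
      have 6: "0 \<le> A * q ^ n" using A q by simp
      have "(S + 1) * (1 + u n) = S + S * u n + 1 + u n" by (simp add: algebra_simps)
      moreover have "S * (1 + A * q ^ n) = S + S * (A * q ^ n)" by (simp add: algebra_simps)
      moreover have "u n = A * q ^ n + (e0 * real L + 1) * ln 2 / \<theta> * (real (Suc n) * q ^ n) + c1 * (1 / 2) ^ n"
        by (simp add: u_def)
      ultimately show ?thesis using 1 2 3 4 5 6 by linarith
    qed
    have ind: "X (n0 + m) g z \<omega> + 1 \<le> (Dt n0 + 1) * (\<Prod>i<m. 1 + u (n0 + i))"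
      if "orthogonal_transformation g" "norm z \<le> R" for m g z
      using that
    proof (induction m arbitrary: g z)
      case 0
      then show ?case using X_le_Dt[OF _ \<omega>] by simp
    next
      case (Suc m)
      let ?S = "(Dt n0 + 1) * (\<Prod>i<m. 1 + u (n0 + i)) - 1"
      have "1 \<le> (\<Prod>i<m. 1 + u (n0 + i))" using u0 by (intro prod_ge_1) simp
      then have "1 * 1 \<le> (Dt n0 + 1) * (\<Prod>i<m. 1 + u (n0 + i))" using Dt_nonneg[of n0] by (intro mult_mono) auto
      then have S0: "0 \<le> ?S" by simp
      have "X (Suc (n0 + m)) g z \<omega> + 1 \<le> (?S + 1) * (1 + u (n0 + m))"
      proof (rule step[OF _ S0 _ Suc.prems])
        fix g' :: "'a \<Rightarrow> 'a" and z' :: 'a assume "orthogonal_transformation g'" "norm z' \<le> R"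
        from Suc.IH[OF this] show "X (n0 + m) g' z' \<omega> \<le> ?S" by simp
      qed simp
      then show ?case by (simp add: mult_ac)
    qed
    have prodb: "(\<Prod>i<m. 1 + u (n0 + i)) \<le> exp (suminf u)" for m
    proof -
      have "(\<Prod>i<m. 1 + u (n0 + i)) \<le> (\<Prod>i<m. exp (u (n0 + i)))"
        using u0 exp_ge_add_one_self by (intro prod_mono) (auto intro: add_nonneg_nonneg)
      also have "\<dots> = exp (\<Sum>i<m. u (n0 + i))" by (simp add: exp_sum)
      also have "(\<Sum>i<m. u (n0 + i)) = (\<Sum>i\<in>(+) n0 ` {..<m}. u i)" by (simp add: sum.reindex)
      also have "\<dots> \<le> suminf u" using usum u0 by (intro sum_le_suminf) auto
      finally show ?thesis by simp
    qed
    show ?thesis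
    proof (intro exI[of _ "(Dt n0 + 1) * exp (suminf u)"] allI impI)
      fix n and g :: "'a \<Rightarrow> 'a" and z :: 'a assume gz: "orthogonal_transformation g" "norm z \<le> R"
      have E1: "1 \<le> exp (suminf u)" using suminf_nonneg[OF usum] u0 by simp
      show "X n g z \<omega> \<le> (Dt n0 + 1) * exp (suminf u)"
      proof (cases "n0 \<le> n")
        case True
        then obtain m where n: "n = n0 + m" by (metis le_iff_add)
        have "X n g z \<omega> + 1 \<le> (Dt n0 + 1) * (\<Prod>i<m. 1 + u (n0 + i))" unfolding n by (rule ind[OF gz])
        also have "\<dots> \<le> (Dt n0 + 1) * exp (suminf u)" using Dt_nonneg[of n0] by (intro mult_left_mono prodb) auto
        finally show ?thesis by simp
      next
        case False
        have "X n g z \<omega> \<le> Dt n" by (rule X_le_Dt[OF gz(1) \<omega>])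
        also have "\<dots> \<le> Dt n0 + 1" using Dt_mono[of n n0] False by simp
        also have "\<dots> \<le> (Dt n0 + 1) * exp (suminf u)"
          using mult_left_mono[OF E1, of "Dt n0 + 1"] Dt_nonneg[of n0] by simp
        finally show ?thesis .
      qed
    qed
  qed
  \<comment> \<open>The net of index n is used for the mass of level n + 1. Level 0 is therefore
    missing and enters \<open>K\<close> through \<open>Dt 0\<close>, while \<open>c1\<close> pays
    for moving to a net point.\<close>
  define SX where "SX \<omega> = (SUP n. SUP h\<in>T n. ennreal (X (Suc n) (fst h) (snd h) \<omega>))" for \<omega>
  have SXm: "SX \<in> borel_measurable M"
  proof -
    have inner: "(\<lambda>\<omega>. SUP h\<in>T n. ennreal (X (Suc n) (fst h) (snd h) \<omega>)) \<in> borel_measurable M" for n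
    proof (rule borel_measurable_SUP)
      show "countable (T n)" using T(1) by (rule countable_finite)
      show "(\<lambda>\<omega>. ennreal (X (Suc n) (fst h) (snd h) \<omega>)) \<in> borel_measurable M" for h
        by (rule measurable_compose[OF X_measurable measurable_ennreal])
    qed
    show ?thesis unfolding SX_def[abs_def] by (rule borel_measurable_SUP[OF _ inner]) simp
  qed
  define K where "K \<omega> = enn2real (SX \<omega>) + c1 + Dt 0" for \<omega>
  show ?thesis
  proof (rule that[of K])
    show "K \<in> borel_measurable M" unfolding K_def[abs_def] using SXm by measurable
    show "0 \<le> K \<omega>" for \<omega> using c1 Dt_nonneg[of 0] by (simp add: K_def)
    show "AE \<omega> in M. \<forall>n g z. orthogonal_transformation g \<longrightarrow> norm z \<le> R \<longrightarrow> X n g z \<omega> \<le> K \<omega>"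
      using BC AE_space
    proof eventually_elim
      case (elim \<omega>)
      then obtain S where S: "\<And>n g z. orthogonal_transformation g \<Longrightarrow> norm z \<le> R \<Longrightarrow> X n g z \<omega> \<le> S"
        using bounded[of \<omega>] by blast
      have "SX \<omega> \<le> ennreal S" unfolding SX_def
        by (intro SUP_least ennreal_leI S Th)
      then have fin: "SX \<omega> < \<top>" by (rule le_less_trans) simp
      show ?case
      proof (intro allI impI)
        fix n and g :: "'a \<Rightarrow> 'a" and z :: 'a assume gz: "orthogonal_transformation g" "norm z \<le> R"
        have e0: "0 \<le> enn2real (SX \<omega>)" by simp
        show "X n g z \<omega> \<le> K \<omega>"
        proof (cases n)
          case 0
          then show ?thesis using X_le_Dt[OF gz(1) elim(2), of 0 z] c1 e0 unfolding K_def 0 by linarith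
        next
          case (Suc m)
          obtain h where h: "h \<in> T m" "\<forall>x. norm (g x - fst h x) \<le> \<epsilon> m * norm x" "norm (z - snd h) \<le> \<epsilon> m"
            using Tnet[OF gz, of m] by blast
          have 1: "X (Suc m) g z \<omega> \<le> X (Suc m) (fst h) (snd h) \<omega> + c1 * (1 / 2) ^ m"
            by (rule cont[OF elim(2) gz(1) h])
          have "ennreal (X (Suc m) (fst h) (snd h) \<omega>) \<le> SX \<omega>"
            unfolding SX_def by (intro SUP_upper2[of m] SUP_upper2[of h]) (use h in auto)
          also have "SX \<omega> = ennreal (enn2real (SX \<omega>))" using fin by simp
          finally have 2: "X (Suc m) (fst h) (snd h) \<omega> \<le> enn2real (SX \<omega>)" by (subst (asm) ennreal_le_iff) auto
          have "c1 * (1 / 2) ^ m \<le> c1 * 1" using c1 by (intro mult_left_mono power_le_one) auto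
          then show ?thesis using 1 2 Dt_nonneg[of 0] by (simp add: K_def Suc)
        qed
      qed
    qed
  qed
qed

section \<open>From the supports of the densities to the limit set\<close>

lemma support_borel: "{y. mu n \<omega> y \<noteq> 0} = \<Union>{F \<in> cells n. mu n \<omega> (pt F) \<noteq> 0}"
proof (intro set_eqI iffI; clarify)
  fix y assume y: "mu n \<omega> y \<noteq> 0"
  then have "y \<in> F0" using mu_outside by blast
  then have c: "cell cells n y \<in> cells n" "y \<in> cell cells n y" using cell_in by auto
  then have "mu n \<omega> (pt (cell cells n y)) = mu n \<omega> y" using mu_cell[OF c(1) pt[OF c(1)] c(2)] by simp
  then show "y \<in> \<Union>{F \<in> cells n. mu n \<omega> (pt F) \<noteq> 0}" using c y by auto
next
  fix y F assume "F \<in> cells n" "mu n \<omega> (pt F) \<noteq> 0" "y \<in> F" "mu n \<omega> y = 0"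
  then show False using mu_cell[of F n y "pt F" \<omega>] pt by auto
qed

text \<open>On its support the density is at least 2^(\<alpha> n)/C2, so the indicator of the
  support is at most C2 2^(-\<alpha> n) times the density.\<close>

lemma nu_support_le:
  assumes g: "orthogonal_transformation g" and \<omega>: "\<omega> \<in> space M"
  shows "nu g z {y. mu n \<omega> y \<noteq> 0} \<le> C2 * X n g z \<omega> * 2 powr (- \<alpha> * real n)"
proof -
  let ?S = "{F \<in> cells n. mu n \<omega> (pt F) \<noteq> 0}"
  have "disjoint ?S" using disjoint_cells[of n] by (auto simp: disjoint_def)
  then have "nu g z (\<Union>?S) = (\<Sum>F\<in>?S. nu g z F)"
    by (intro nu_Union[OF g]) (use finite_cells cell_borel bounded_cell in auto)
  also have "\<dots> \<le> (\<Sum>F\<in>?S. C2 * 2 powr (- \<alpha> * real n) * (mu n \<omega> (pt F) * nu g z F))"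
  proof (intro sum_mono)
    fix F assume "F \<in> ?S"
    then have "2 powr (\<alpha> * real n) \<le> C2 * mu n \<omega> (pt F)" using comp2[OF \<omega>, of n "pt F"] by simp
    then have "2 powr (- \<alpha> * real n) * 2 powr (\<alpha> * real n) \<le> 2 powr (- \<alpha> * real n) * (C2 * mu n \<omega> (pt F))"
      by (intro mult_left_mono) auto
    then have "1 \<le> 2 powr (- \<alpha> * real n) * (C2 * mu n \<omega> (pt F))" by (simp add: powr_add[symmetric])
    then have "1 * nu g z F \<le> 2 powr (- \<alpha> * real n) * (C2 * mu n \<omega> (pt F)) * nu g z F"
      by (intro mult_right_mono nu_nonneg)
    then show "nu g z F \<le> C2 * 2 powr (- \<alpha> * real n) * (mu n \<omega> (pt F) * nu g z F)" by (simp add: mult_ac)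
  qed
  also have "\<dots> \<le> (\<Sum>F\<in>cells n. C2 * 2 powr (- \<alpha> * real n) * (mu n \<omega> (pt F) * nu g z F))"
    using finite_cells C2 mu_nonneg[OF \<omega>] nu_nonneg by (intro sum_mono2) auto
  also have "\<dots> = C2 * X n g z \<omega> * 2 powr (- \<alpha> * real n)" by (simp add: X_def sum_distrib_left mult_ac)
  finally show ?thesis by (simp only: support_borel)
qed

lemma limit_subset: "(\<Inter>m. {y. mu m \<omega> y \<noteq> 0}) \<subseteq> F0"
  using mu_outside by blast

text \<open>Within 3 * 2^-n of a point x of the enlarged neighbourhood there is a point of all
  supports. Its cell of level n lies in the support and contains a ball of radius comparable to
  2^-n, so the support fills a fixed proportion of the volume around x. Averaging over translates
  then carries the bound for the supports over to the neighbourhood.\<close>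

theorem hausdorff_slices:
  obtains K where "K \<in> borel_measurable M" "AE \<omega> in M. \<forall>V\<in>affine_planes k. \<forall>n.
      hausdorff_measure k (open_nbhd (closure (\<Inter>m. {y. mu m \<omega> y \<noteq> 0})) (2 powr (- real n)) \<inter> V)
        \<le> ennreal (K \<omega> * 2 powr (- \<alpha> * real n))"
proof -
  obtain B where B: "B > 0" "F0 \<subseteq> ball 0 B" using bounded_subset_ballD[OF F0(2), of 0] by auto
  \<comment> \<open>Base points are within B + 2 of the origin, and translations are shorter than C
    + 3.\<close>
  define R where "R = B + C + 5"
  have "1 \<le> R" using B C by (simp add: R_def)
  then obtain K where K: "K \<in> borel_measurable M" "\<And>\<omega>. 0 \<le> K \<omega>"
    "AE \<omega> in M. \<forall>n g z. orthogonal_transformation g \<longrightarrow> norm z \<le> R \<longrightarrow> X n g z \<omega> \<le> K \<omega>"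
    using X_sup_bounded by blast
  define cU where "cU = unit_ball_vol (real k) / 2 ^ k * real k ^ k"
  have cU: "0 \<le> cU" by (simp add: cU_def less_imp_le)
  define c2 where "c2 = cU * ((2 * C * (C + 3)) ^ DIM('a) * C2)"
  have slice: "hausdorff_measure k (open_nbhd (closure (\<Inter>m. {y. mu m \<omega> y \<noteq> 0})) (2 powr (- real n)) \<inter> V)
        \<le> ennreal (c2 * K \<omega> * 2 powr (- \<alpha> * real n))"
    if \<omega>: "\<omega> \<in> space M" and sup: "\<And>n g z. orthogonal_transformation g \<Longrightarrow> norm z \<le> R \<Longrightarrow> X n g z \<omega> \<le> K \<omega>"
      and V: "V \<in> affine_planes k" for \<omega> V n
  proof -
    define A where "A = closure (\<Inter>m. {y. mu m \<omega> y \<noteq> 0})"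
    define s where "s = 2 powr (- real n)"
    have s: "0 < s" "s \<le> 1" using powr_mono[of "- real n" 0 2] by (auto simp: s_def)
    define E where "E = open_nbhd A s"
    \<comment> \<open>A second neighbourhood, because the Hausdorff measure of a slice of
      \<open>E\<close> is bounded through the flat measure of a neighbourhood of
      \<open>E\<close>.\<close>
    define E2 where "E2 = open_nbhd E s"
    have "A \<subseteq> closure (ball 0 B)" unfolding A_def using limit_subset B by (intro closure_mono) blast
    then have Ab: "A \<subseteq> cball 0 B" using B by (simp add: closure_ball)
    have E2n: "norm x < B + 2 * s" if "x \<in> E2" for x
    proof -
      obtain e a where "a \<in> A" "dist e a < s" "dist x e < s" using \<open>x \<in> E2\<close> by (auto simp: E2_def E_def open_nbhd_def)
      then have "dist x a < 2 * s" "norm a \<le> B" using dist_triangle[of x a e] Ab by auto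
      then show ?thesis using norm_triangle_sub[of x a] by (simp add: dist_norm)
    qed
    have EE2: "E \<subseteq> E2"
    proof
      fix x assume "x \<in> E"
      then show "x \<in> E2" unfolding E2_def open_nbhd_def using s by (intro CollectI bexI[of _ x]) auto
    qed
    have bE2: "bounded E2" using E2n by (intro boundedI[of _ "B + 2 * s"]) (simp add: less_imp_le)
    have bE: "bounded E" by (rule bounded_subset[OF bE2 EE2])
    have E2b: "E2 \<in> sets borel" by (simp add: E2_def open_open_nbhd)
    show ?thesis
    proof (cases "E \<inter> V = {}")
      case True
      then show ?thesis by (simp add: E_def A_def s_def hausdorff_measure_empty[OF D1])
    next
      case False
      then obtain z where z: "z \<in> E" "z \<in> V" by blast
      obtain g where g: "orthogonal_transformation g" and Vg: "V = range (flat_map D g z)"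
        using affine_plane_flat_map[OF V z(2) D] .
      define r \<rho> where "r = s / (2 * C)" and "\<rho> = (C + 3) * s"
      have r: "0 < r" "0 < \<rho>" using s C by (auto simp: r_def \<rho>_def)
      define S where "S = {y. mu n \<omega> y \<noteq> 0}"
      have Sb: "S \<in> sets borel"
        unfolding S_def support_borel using finite_cells cell_borel by (intro sets.finite_Union) auto
      have bS: "bounded S" using mu_outside F0(2) by (intro bounded_subset[OF F0(2)]) (auto simp: S_def)
      define m where "m = C2 * K \<omega> * 2 powr (- \<alpha> * real n)"
      have m: "0 \<le> m" using C2 K(2) by (simp add: m_def)
      define ub where "ub = unit_ball_vol (real DIM('a))"
      have ub: "ub > 0" by (simp add: ub_def)
      have "ennreal (ub * r ^ DIM('a)) * emeasure (flat_measure D g z) E2 \<le> emeasure lborel (ball (0::'a) \<rho>) * ennreal m"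
      proof (rule flat_measure_average[OF g D Sb E2b m])
        fix x assume "x \<in> E2"
        then obtain e a where ea: "a \<in> A" "dist e a < s" "dist x e < s" by (auto simp: E2_def E_def open_nbhd_def)
        then have "dist x a < 2 * s" using dist_triangle[of x a e] by simp
        moreover obtain a' where a': "a' \<in> (\<Inter>m. {y. mu m \<omega> y \<noteq> 0})" "dist a' a < s"
          using ea(1) s unfolding A_def closure_approachable by blast
        ultimately have da': "dist x a' < 3 * s" using dist_triangle[of x a' a] by (simp add: dist_commute)
        have "mu n \<omega> a' \<noteq> 0" using a'(1) by blast
        then obtain F where F: "F \<in> cells n" "mu n \<omega> (pt F) \<noteq> 0" "a' \<in> F" using support_borel[of n \<omega>] by blast
        obtain y where y: "ball y r \<subseteq> F" using cell_ball_radius(1)[OF F(1)] by (auto simp: r_def s_def)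
        have FS: "F \<subseteq> S" unfolding S_def support_borel using F by blast
        have "ball y r \<subseteq> S \<inter> ball x \<rho>"
        proof
          fix w assume w: "w \<in> ball y r"
          then have wF: "w \<in> F" using y by blast
          have "dist a' w \<le> C * s"
            using diameter_bounded_bound[OF bounded_cell[OF F(1)] F(3) wF] cell_ball_radius(2)[OF F(1)] by (simp add: s_def)
          then have "dist x w < \<rho>" using da' dist_triangle[of x w a'] by (simp add: \<rho>_def algebra_simps)
          then show "w \<in> S \<inter> ball x \<rho>" using wF FS by auto
        qed
        then have "emeasure lborel (ball y r) \<le> emeasure lborel (S \<inter> ball x \<rho>)"
          using Sb by (intro emeasure_mono) auto
        then show "ennreal (ub * r ^ DIM('a)) \<le> emeasure lborel (S \<inter> ball x \<rho>)"
          using r by (simp add: emeasure_ball ub_def)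
      next
        fix w :: 'a assume w: "norm w < \<rho>"
        have "norm z < B + 2 * s" using E2n z(1) EE2 by blast
        moreover have "\<rho> \<le> C + 3" using s C by (simp add: \<rho>_def mult_le_cancel_left1)
        ultimately have "norm (z + w) \<le> R" using w s norm_triangle_ineq[of z w] by (simp add: R_def)
        from sup[OF g this, of n] have "C2 * X n g (z + w) \<omega> * 2 powr (- \<alpha> * real n) \<le> m"
          unfolding m_def using C2 by (intro mult_right_mono mult_left_mono) auto
        then have "nu g (z + w) S \<le> m" using nu_support_le[OF g \<omega>, of "z + w" n] unfolding S_def by linarith
        then show "emeasure (flat_measure D g (z + w)) S \<le> ennreal m"
          unfolding emeasure_eq_nu[OF g Sb bS] by (rule ennreal_leI)
      qed
      also have "emeasure lborel (ball (0::'a) \<rho>) = ennreal (ub * \<rho> ^ DIM('a))"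
        using r by (simp add: emeasure_ball ub_def)
      finally have "ennreal (ub * r ^ DIM('a) * nu g z E2) \<le> ennreal (ub * \<rho> ^ DIM('a) * m)"
        unfolding emeasure_eq_nu[OF g E2b bE2] using ub r m by (simp add: ennreal_mult nu_nonneg)
      then have "ub * r ^ DIM('a) * nu g z E2 \<le> ub * \<rho> ^ DIM('a) * m"
        using ub r m by (subst (asm) ennreal_le_iff) auto
      then have "r ^ DIM('a) * nu g z E2 \<le> \<rho> ^ DIM('a) * m" using ub by (simp add: mult.assoc)
      then have "nu g z E2 \<le> \<rho> ^ DIM('a) * m / r ^ DIM('a)" using r by (simp add: pos_le_divide_eq mult.commute)
      also have "\<dots> = (\<rho> / r) ^ DIM('a) * m" by (simp add: power_divide)
      also have "\<rho> / r = 2 * C * (C + 3)" using s C by (simp add: \<rho>_def r_def field_simps)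
      finally have nuE2: "nu g z E2 \<le> (2 * C * (C + 3)) ^ DIM('a) * m" .
      have "hausdorff_measure k (E \<inter> V) \<le> ennreal cU * emeasure (flat_measure D g z) E2"
        unfolding cU_def E2_def Vg by (rule hausdorff_measure_le_flat_measure[OF g D bE s(1) D1])
      also have "\<dots> = ennreal (cU * nu g z E2)"
        unfolding emeasure_eq_nu[OF g E2b bE2] using cU by (simp add: ennreal_mult nu_nonneg)
      also have "\<dots> \<le> ennreal (cU * ((2 * C * (C + 3)) ^ DIM('a) * m))"
        using nuE2 cU by (intro ennreal_leI mult_left_mono)
      also have "cU * ((2 * C * (C + 3)) ^ DIM('a) * m) = c2 * K \<omega> * 2 powr (- \<alpha> * real n)"
        by (simp add: c2_def m_def mult_ac)
      finally show ?thesis by (simp add: E_def A_def s_def)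
    qed
  qed
  show ?thesis
  proof (rule that[of "\<lambda>\<omega>. c2 * K \<omega>"])
    show "(\<lambda>\<omega>. c2 * K \<omega>) \<in> borel_measurable M" using K(1) by measurable
    show "AE \<omega> in M. \<forall>V\<in>affine_planes k. \<forall>n.
      hausdorff_measure k (open_nbhd (closure (\<Inter>m. {y. mu m \<omega> y \<noteq> 0})) (2 powr (- real n)) \<inter> V)
        \<le> ennreal (c2 * K \<omega> * 2 powr (- \<alpha> * real n))"
      using K(3) AE_space by eventually_elim (intro ballI allI slice; blast)
  qed
qed

end

section \<open>The space of compact sets\<close>

text \<open>A positive null sequence. It supplies the radii of countable ball families, the depths
  of cores and the errors of the final limit.\<close>

definition rad :: "nat \<Rightarrow> real" where "rad m = 1 / real (Suc m)"

lemma rad_pos: "0 < rad m" by (simp add: rad_def)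

lemma rad_small: "0 < e \<Longrightarrow> \<exists>m. rad m < e"
  using reals_Archimedean[of e] by (simp add: rad_def inverse_eq_divide)

definition dense_pts :: "'a::euclidean_space set" where
  "dense_pts = (SOME D. countable D \<and> (\<forall>X. open X \<longrightarrow> X \<noteq> {} \<longrightarrow> (\<exists>d\<in>D. d \<in> X)))"

lemma dense_pts: "countable (dense_pts :: 'a::euclidean_space set)"
  "\<And>x e. 0 < e \<Longrightarrow> \<exists>q\<in>dense_pts. dist q (x::'a) < e"
proof -
  have "\<exists>D::'a set. countable D \<and> (\<forall>X. open X \<longrightarrow> X \<noteq> {} \<longrightarrow> (\<exists>d\<in>D. d \<in> X))"
    using countable_dense_setE[where 'a='a] by metis
  from someI_ex[OF this] have D: "countable (dense_pts :: 'a set)"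
    "\<And>X :: 'a set. open X \<Longrightarrow> X \<noteq> {} \<Longrightarrow> \<exists>d\<in>dense_pts. d \<in> X"
    unfolding dense_pts_def by blast+
  show "countable (dense_pts :: 'a set)" by fact
  show "\<exists>q\<in>dense_pts. dist q x < e" if "0 < e" for x :: 'a and e
    using D(2)[of "ball x e"] that by (auto simp: dist_commute)
qed

lemma compacts_gen: "{{K. compact K \<and> K \<inter> U \<noteq> {}} | U. open U} \<subseteq> Pow {K. compact (K :: 'a::euclidean_space set)}"
  by auto

lemma space_compacts: "space (compacts :: 'a::euclidean_space set measure) = {K. compact K}"
  unfolding compacts_def by (rule space_measure_of[OF compacts_gen])

lemma sets_compacts: "sets (compacts :: 'a::euclidean_space set measure)
    = sigma_sets {K. compact K} {{K. compact K \<and> K \<inter> U \<noteq> {}} | U. open U}"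
  unfolding compacts_def by (rule sets_measure_of[OF compacts_gen])

lemma hit_in_sets_compacts: "open U \<Longrightarrow> {K. compact K \<and> K \<inter> U \<noteq> {}} \<in> sets compacts"
  unfolding sets_compacts by (intro sigma_sets.Basic) blast

lemma hit_measurable:
  fixes f :: "'w \<Rightarrow> 'a::euclidean_space set"
  assumes "f \<in> N \<rightarrow>\<^sub>M compacts" "open U"
  shows "{w \<in> space N. f w \<inter> U \<noteq> {}} \<in> sets N"
proof -
  have "f -` {K. compact K \<and> K \<inter> U \<noteq> {}} \<inter> space N \<in> sets N"
    by (rule measurable_sets[OF assms(1) hit_in_sets_compacts[OF assms(2)]])
  also have "f -` {K. compact K \<and> K \<inter> U \<noteq> {}} \<inter> space N = {w \<in> space N. f w \<inter> U \<noteq> {}}"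
    using measurable_space[OF assms(1)] by (auto simp: space_compacts)
  finally show ?thesis .
qed

lemma measurable_into_compacts:
  fixes f :: "'w \<Rightarrow> 'a::euclidean_space set"
  assumes "\<And>w. w \<in> space N \<Longrightarrow> compact (f w)" "\<And>U. open U \<Longrightarrow> {w \<in> space N. f w \<inter> U \<noteq> {}} \<in> sets N"
  shows "f \<in> N \<rightarrow>\<^sub>M compacts"
  unfolding compacts_def
proof (rule measurable_measure_of[OF compacts_gen])
  show "f \<in> space N \<rightarrow> {K. compact K}" using assms(1) by auto
  fix H :: "'a set set" assume "H \<in> {{K. compact K \<and> K \<inter> U \<noteq> {}} | U. open U}"
  then obtain U where U: "open U" "H = {K. compact K \<and> K \<inter> U \<noteq> {}}" by blast
  have "f -` H \<inter> space N = {w \<in> space N. f w \<inter> U \<noteq> {}}" using assms(1) U by auto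
  then show "f -` H \<inter> space N \<in> sets N" using assms(2)[OF U(1)] by simp
qed

text \<open>For a \<ge> 0 the diameter exceeds a iff the set hits two balls of a countable family,
  of equal radius, whose centres are more than a plus twice the radius apart: a countable union of
  hitting events.\<close>

lemma diameter_measurable: "diameter \<in> borel_measurable (compacts :: 'a::euclidean_space set measure)"
  unfolding borel_measurable_iff_greater
proof
  fix a :: real
  show "{K \<in> space (compacts :: 'a set measure). a < diameter K} \<in> sets compacts"
  proof (cases "a < 0")
    case True
    have "{K \<in> space (compacts :: 'a set measure). a < diameter K} = space compacts"
    proof (intro equalityI subsetI CollectI conjI)
      fix K assume K: "K \<in> space (compacts :: 'a set measure)"
      then have "0 \<le> diameter K" by (intro diameter_ge_0 compact_imp_bounded) (simp add: space_compacts)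
      then show "a < diameter K" using True by simp
    qed auto
    then show ?thesis by simp
  next
    case False
    define I where "I = {(q, q', m). q \<in> (dense_pts :: 'a set) \<and> q' \<in> dense_pts \<and> dist q q' - 2 * rad m > a}"
    define H where "H = (\<lambda>(q::'a, q', m). {K. compact K \<and> K \<inter> ball q (rad m) \<noteq> {}} \<inter> {K. compact K \<and> K \<inter> ball q' (rad m) \<noteq> {}})"
    have "countable I"
      by (rule countable_subset[of _ "dense_pts \<times> dense_pts \<times> UNIV"]) (auto simp: I_def dense_pts(1))
    moreover have "H i \<in> sets compacts" for i
      unfolding H_def by (auto split: prod.splits intro!: sets.Int hit_in_sets_compacts)
    ultimately have "(\<Union>i\<in>I. H i) \<in> sets compacts" by (intro sets.countable_UN') auto
    also have "(\<Union>i\<in>I. H i) = {K \<in> space (compacts :: 'a set measure). a < diameter K}"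
    proof (intro equalityI subsetI)
      fix K assume "K \<in> (\<Union>i\<in>I. H i)"
      then obtain q q' m y y' where *: "a < dist q q' - 2 * rad m" "compact K" "y \<in> K" "y' \<in> K"
        "dist q y < rad m" "dist q' y' < rad m"
        unfolding I_def H_def by auto
      have "dist q q' \<le> dist q y + dist y y' + dist q' y'"
        using dist_triangle[of q q' y] dist_triangle[of y q' y'] by (simp add: dist_commute)
      also have "\<dots> < 2 * rad m + dist y y'" using *(5,6) by simp
      finally have "a < dist y y'" using *(1) by linarith
      also have "\<dots> \<le> diameter K" using * by (intro diameter_bounded_bound compact_imp_bounded)
      finally show "K \<in> {K \<in> space (compacts :: 'a set measure). a < diameter K}" using * by (simp add: space_compacts)
    next
      fix K assume "K \<in> {K \<in> space (compacts :: 'a set measure). a < diameter K}"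
      then have K: "compact K" "a < diameter K" by (auto simp: space_compacts)
      then have "K \<noteq> {}" using False by auto
      then obtain y y' where y: "y \<in> K" "y' \<in> K" "dist y y' = diameter K"
        using diameter_compact_attained[OF K(1)] by blast
      obtain m where m: "rad m < (diameter K - a) / 4"
        using K(2) rad_small[of "(diameter K - a) / 4"] by fastforce
      obtain q q' where q: "q \<in> dense_pts" "dist q y < rad m" "q' \<in> dense_pts" "dist q' y' < rad m"
        using dense_pts(2)[OF rad_pos[of m]] by metis
      have "dist y y' \<le> dist q y + dist q q' + dist q' y'"
        using dist_triangle[of y y' q] dist_triangle[of q y' q'] by (simp add: dist_commute)
      moreover have "4 * rad m < diameter K - a" using m by simp
      ultimately have "dist q q' - 2 * rad m > a" using q(2,4) y(3) by linarith
      then have "(q, q', m) \<in> I" "K \<in> H (q, q', m)" using q y K by (auto simp: I_def H_def)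
      then show "K \<in> (\<Union>i\<in>I. H i)" by blast
    qed
    finally show ?thesis .
  qed
qed

text \<open>A closed set contains a point iff it comes arbitrarily close to it; closeness at scale
  \<open>rad m\<close> is tested with a ball around a dense point near that point.\<close>

lemma member_measurable:
  fixes f :: "'w \<Rightarrow> 'a::euclidean_space set"
  assumes f: "f \<in> N \<rightarrow>\<^sub>M compacts" and x: "x \<in> borel_measurable N"
  shows "{w \<in> space N. x w \<in> f w} \<in> sets N"
proof -
  have "{w \<in> space N. x w \<in> f w} = (\<Inter>m. \<Union>q\<in>dense_pts. {w \<in> space N. dist q (x w) < rad m} \<inter>
      {w \<in> space N. f w \<inter> ball q (rad m) \<noteq> {}})" (is "?L = (\<Inter>m. ?R m)")
  proof (intro equalityI subsetI)
    fix w assume w: "w \<in> ?L"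
    show "w \<in> (\<Inter>m. ?R m)"
    proof
      fix m
      obtain q where "q \<in> dense_pts" "dist q (x w) < rad m" using dense_pts(2)[OF rad_pos] by blast
      moreover have "x w \<in> f w \<inter> ball q (rad m)" using w calculation by simp
      ultimately show "w \<in> ?R m" using w by blast
    qed
  next
    fix w assume w: "w \<in> (\<Inter>m. ?R m)"
    then have ws: "w \<in> space N" by auto
    then have "compact (f w)" using measurable_space[OF f] by (simp add: space_compacts)
    then have cl: "closed (f w)" by (rule compact_imp_closed)
    have "\<exists>y\<in>f w. dist y (x w) < e" if "e > 0" for e
    proof -
      have "0 < e / 2" using that by simp
      then obtain m where m: "rad m < e / 2" using rad_small by blast
      have "w \<in> ?R m" using w by blast
      then obtain q y where "dist q (x w) < rad m" "y \<in> f w" "dist q y < rad m" by auto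
      then have "dist y (x w) < e" using m dist_triangle[of y "x w" q] by (simp add: dist_commute)
      then show ?thesis using \<open>y \<in> f w\<close> by blast
    qed
    then have "x w \<in> closure (f w)" by (simp add: closure_approachable)
    then show "w \<in> ?L" using cl ws by simp
  qed
  moreover have "?R m \<in> sets N" for m
  proof (rule sets.countable_UN'[OF dense_pts(1) image_subsetI], rule sets.Int)
    show "{w \<in> space N. dist q (x w) < rad m} \<in> sets N" for q
      using x by measurable
    show "{w \<in> space N. f w \<inter> ball q (rad m) \<noteq> {}} \<in> sets N" for q
      by (rule hit_measurable[OF f open_ball])
  qed
  ultimately show ?thesis by (simp add: sets.countable_INT)
qed

text \<open>The dense points of the open ball have the closed ball as their closure when r > 0. The
  centre is listed separately for r = 0, where no point is at distance less than r.\<close>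

lemma cball_subset_iff_dense:
  fixes K :: "'a::euclidean_space set"
  assumes "closed K" "0 \<le> r"
  shows "cball x r \<subseteq> K \<longleftrightarrow> x \<in> K \<and> (\<forall>q\<in>dense_pts. dist q x < r \<longrightarrow> q \<in> K)"
proof
  assume "cball x r \<subseteq> K"
  then show "x \<in> K \<and> (\<forall>q\<in>dense_pts. dist q x < r \<longrightarrow> q \<in> K)"
    using assms(2) by (auto simp: dist_commute subset_iff)
next
  assume a: "x \<in> K \<and> (\<forall>q\<in>dense_pts. dist q x < r \<longrightarrow> q \<in> K)"
  show "cball x r \<subseteq> K"
  proof (cases "r = 0")
    case True
    then show ?thesis using a by simp
  next
    case False
    have "ball x r \<subseteq> closure K"
    proof
      fix y assume y: "y \<in> ball x r"
      show "y \<in> closure K" unfolding closure_approachable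
      proof (intro allI impI)
        fix e :: real assume "0 < e"
        then have "0 < min e (r - dist x y)" using y by simp
        then obtain q where q: "q \<in> dense_pts" "dist q y < min e (r - dist x y)" using dense_pts(2) by blast
        have "dist q x < r" using q dist_triangle[of q x y] by (simp add: dist_commute)
        then show "\<exists>y'\<in>K. dist y' y < e" using a q by auto
      qed
    qed
    then have "closure (ball x r) \<subseteq> K" using assms(1) closure_minimal by (metis closure_closed)
    then show ?thesis using False assms(2) by (simp add: closure_ball)
  qed
qed

lemma cball_subset_measurable:
  fixes f :: "'w \<Rightarrow> 'a::euclidean_space set"
  assumes f: "f \<in> N \<rightarrow>\<^sub>M compacts" and x: "x \<in> borel_measurable N" and r: "r \<in> borel_measurable N"
    and r0: "\<And>w. w \<in> space N \<Longrightarrow> 0 \<le> r w"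
  shows "{w \<in> space N. cball (x w) (r w) \<subseteq> f w} \<in> sets N"
proof -
  have "{w \<in> space N. cball (x w) (r w) \<subseteq> f w} = {w \<in> space N. x w \<in> f w} \<inter>
    (\<Inter>q\<in>dense_pts. (space N - {w \<in> space N. dist q (x w) < r w}) \<union> {w \<in> space N. q \<in> f w})" (is "?L = ?A \<inter> ?B")
  proof -
    have "cball (x w) (r w) \<subseteq> f w \<longleftrightarrow> x w \<in> f w \<and> (\<forall>q\<in>dense_pts. dist q (x w) < r w \<longrightarrow> q \<in> f w)"
      if "w \<in> space N" for w
      using measurable_space[OF f that] r0[OF that]
      by (intro cball_subset_iff_dense) (auto simp: space_compacts compact_imp_closed)
    then show ?thesis using dense_pts(2)[of 1] by auto
  qed
  moreover have "?A \<in> sets N" by (rule member_measurable[OF f x])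
  moreover have "?B \<in> sets N"
  proof (rule sets.countable_INT'[OF dense_pts(1) _ image_subsetI])
    show "dense_pts \<noteq> ({} :: 'a set)" using dense_pts(2)[of 1] by force
    fix q
    have "{w \<in> space N. dist q (x w) < r w} \<in> sets N" using x r by measurable
    moreover have "{w \<in> space N. q \<in> f w} \<in> sets N" by (rule member_measurable[OF f]) simp
    ultimately show "(space N - {w \<in> space N. dist q (x w) < r w}) \<union> {w \<in> space N. q \<in> f w} \<in> sets N" by auto
  qed
  ultimately show ?thesis by (simp only: sets.Int)
qed

section \<open>Translated and rescaled sets, and their cores\<close>

definition scaled :: "'a::euclidean_space \<times> real \<times> 'a set \<Rightarrow> 'a set" where
  "scaled = (\<lambda>(t, s, \<Lambda>). (\<lambda>x. s *\<^sub>R (x + t)) ` \<Lambda>)"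

text \<open>The image hits U iff the shape hits a small ball whose image stays inside U. For a fixed
  ball the latter is a condition on translation and scale alone: the scaled radius is less than the
  distance of the image of the centre from the complement of U.\<close>

lemma scaled_measurable:
  "scaled \<in> (borel \<Otimes>\<^sub>M (borel \<Otimes>\<^sub>M compacts)) \<rightarrow>\<^sub>M (compacts :: 'a::euclidean_space set measure)"
proof (rule measurable_into_compacts)
  let ?N = "borel \<Otimes>\<^sub>M (borel \<Otimes>\<^sub>M compacts) :: ('a \<times> real \<times> 'a set) measure"
  have \<Lambda>: "(\<lambda>w. snd (snd w)) \<in> ?N \<rightarrow>\<^sub>M compacts" by measurable
  show "compact (scaled w)" if "w \<in> space ?N" for w
  proof -
    have "compact (snd (snd w))" using measurable_space[OF \<Lambda> that] by (simp add: space_compacts)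
    then show ?thesis
      unfolding scaled_def case_prod_beta
      by (intro compact_continuous_image continuous_intros) auto
  qed
  fix U :: "'a set" assume U: "open U"
  show "{w \<in> space ?N. scaled w \<inter> U \<noteq> {}} \<in> sets ?N"
  \<comment> \<open>Separated because \<open>infdist\<close> to the empty set is 0 by
    default.\<close>
  proof (cases "U = UNIV")
    case True
    have "{w \<in> space ?N. scaled w \<inter> U \<noteq> {}} = {w \<in> space ?N. snd (snd w) \<inter> UNIV \<noteq> {}}"
      using True by (auto simp: scaled_def case_prod_beta)
    also have "\<dots> \<in> sets ?N" by (rule hit_measurable[OF \<Lambda> open_UNIV])
    finally show ?thesis .
  next
    case False
    define H where "H = (\<lambda>(q, m). {w \<in> space ?N. snd (snd w) \<inter> ball q (rad m) \<noteq> {}} \<inter>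
       {w \<in> space ?N. \<bar>fst (snd w)\<bar> * rad m < infdist (fst (snd w) *\<^sub>R (q + fst w)) (- U)})"
    have inf: "(\<lambda>x. infdist x (- U)) \<in> borel_measurable borel"
      by (intro borel_measurable_continuous_onI continuous_intros)
    have "H (q, m) \<in> sets ?N" for q m
    proof -
      have [measurable]: "(\<lambda>w. infdist (fst (snd w) *\<^sub>R (q + fst w)) (- U)) \<in> borel_measurable ?N"
        by (rule measurable_compose[OF _ inf]) measurable
      have "{w \<in> space ?N. \<bar>fst (snd w)\<bar> * rad m < infdist (fst (snd w) *\<^sub>R (q + fst w)) (- U)} \<in> sets ?N"
        by measurable
      then show ?thesis unfolding H_def by (auto intro!: sets.Int hit_measurable[OF \<Lambda> open_ball])
    qed
    then have "(\<Union>i\<in>dense_pts \<times> UNIV. H i) \<in> sets ?N"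
      by (intro sets.countable_UN') (auto simp: dense_pts(1))
    also have "(\<Union>i\<in>dense_pts \<times> UNIV. H i) = {w \<in> space ?N. scaled w \<inter> U \<noteq> {}}"
    proof (intro equalityI subsetI)
      fix w assume "w \<in> (\<Union>i\<in>dense_pts \<times> UNIV. H i)"
      then obtain q m y where *: "w \<in> space ?N" "y \<in> snd (snd w)" "dist q y < rad m"
        "\<bar>fst (snd w)\<bar> * rad m < infdist (fst (snd w) *\<^sub>R (q + fst w)) (- U)"
        by (auto simp: H_def)
      let ?s = "fst (snd w)" and ?t = "fst w"
      have "?s *\<^sub>R (y + ?t) \<in> U"
      proof (rule ccontr)
        assume "?s *\<^sub>R (y + ?t) \<notin> U"
        then have "infdist (?s *\<^sub>R (q + ?t)) (- U) \<le> dist (?s *\<^sub>R (q + ?t)) (?s *\<^sub>R (y + ?t))"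
          by (intro infdist_le) simp
        also have "\<dots> = \<bar>?s\<bar> * dist q y" by (simp add: dist_norm scaleR_diff_right[symmetric])
        also have "\<dots> \<le> \<bar>?s\<bar> * rad m" using *(3) by (intro mult_left_mono) auto
        finally show False using *(4) by simp
      qed
      then have "?s *\<^sub>R (y + ?t) \<in> scaled w \<inter> U" using *(2) by (auto simp: scaled_def case_prod_beta)
      then show "w \<in> {w \<in> space ?N. scaled w \<inter> U \<noteq> {}}" using *(1) by blast
    next
      fix w assume "w \<in> {w \<in> space ?N. scaled w \<inter> U \<noteq> {}}"
      then obtain y where w: "w \<in> space ?N" and y: "y \<in> snd (snd w)" "fst (snd w) *\<^sub>R (y + fst w) \<in> U"
        by (auto simp: scaled_def case_prod_beta)
      let ?s = "fst (snd w)" and ?t = "fst w"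
      obtain e where e: "e > 0" "ball (?s *\<^sub>R (y + ?t)) e \<subseteq> U" using U y(2) open_contains_ball by blast
      obtain m where m: "rad m < e / (2 * (\<bar>?s\<bar> + 1))"
        using rad_small[of "e / (2 * (\<bar>?s\<bar> + 1))"] e by (auto simp: add_nonneg_pos)
      have "\<bar>?s\<bar> * rad m \<le> (\<bar>?s\<bar> + 1) * rad m" using rad_pos[of m] by (intro mult_right_mono) auto
      also have "\<dots> < (\<bar>?s\<bar> + 1) * (e / (2 * (\<bar>?s\<bar> + 1)))" using m by (intro mult_strict_left_mono) auto
      also have "\<dots> = e / 2" by (simp add: field_simps)
      finally have sm: "\<bar>?s\<bar> * rad m < e / 2" .
      obtain q where q: "q \<in> dense_pts" "dist q y < rad m" using dense_pts(2)[OF rad_pos] by blast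
      have "dist (?s *\<^sub>R (q + ?t)) (?s *\<^sub>R (y + ?t)) = \<bar>?s\<bar> * dist q y" by (simp add: dist_norm scaleR_diff_right[symmetric])
      also have "\<dots> \<le> \<bar>?s\<bar> * rad m" using q(2) by (intro mult_left_mono) auto
      finally have d: "dist (?s *\<^sub>R (q + ?t)) (?s *\<^sub>R (y + ?t)) < e / 2" using sm by simp
      have "e / 2 \<le> infdist (?s *\<^sub>R (q + ?t)) (- U)"
      proof -
        have ne: "- U \<noteq> {}" using False by auto
        have "e / 2 \<le> dist (?s *\<^sub>R (q + ?t)) u" if "u \<in> - U" for u
        proof -
          have "u \<notin> ball (?s *\<^sub>R (y + ?t)) e" using e(2) that by blast
          then have "e \<le> dist (?s *\<^sub>R (y + ?t)) u" by simp
          also have "\<dots> \<le> dist (?s *\<^sub>R (q + ?t)) (?s *\<^sub>R (y + ?t)) + dist (?s *\<^sub>R (q + ?t)) u"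
            by (rule dist_triangle3)
          finally show ?thesis using d by simp
        qed
        then show ?thesis unfolding infdist_notempty[OF ne] using ne by (intro cINF_greatest)
      qed
      then have "w \<in> H (q, m)" using w y(1) q(2) sm by (auto simp: H_def)
      then show "w \<in> (\<Union>i\<in>dense_pts \<times> UNIV. H i)" using q(1) by blast
    qed
    finally show ?thesis .
  qed
qed

text \<open>The inner parallel set of depth \<beta>. The form as a containment of closed balls is
  jointly measurable in point and set and behaves simply under scaling.\<close>

definition core :: "real \<Rightarrow> 'a::euclidean_space set \<Rightarrow> 'a set" where
  "core \<beta> K = {y. cball y \<beta> \<subseteq> K}"

lemma core_measurable:
  assumes "0 \<le> \<beta>"
  shows "{w \<in> space (borel \<Otimes>\<^sub>M compacts). fst w \<in> core \<beta> (snd w)} \<in> sets (borel \<Otimes>\<^sub>M (compacts :: 'a::euclidean_space set measure))"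
  unfolding core_def using assms by (simp, intro cball_subset_measurable) auto

lemma scaled_core:
  assumes "0 < s"
  shows "cball q (\<beta> * s) \<subseteq> scaled (t, s, K) \<longleftrightarrow> q /\<^sub>R s - t \<in> core \<beta> K"
proof -
  have img: "y \<in> scaled (t, s, K) \<longleftrightarrow> y /\<^sub>R s - t \<in> K" for y
  proof
    assume "y \<in> scaled (t, s, K)"
    then show "y /\<^sub>R s - t \<in> K" using assms by (auto simp: scaled_def)
  next
    assume a: "y /\<^sub>R s - t \<in> K"
    have "y = s *\<^sub>R ((y /\<^sub>R s - t) + t)" using assms by simp
    then show "y \<in> scaled (t, s, K)" using a unfolding scaled_def by blast
  qed
  have d: "dist (q /\<^sub>R s - t) (y /\<^sub>R s - t) = dist q y / s" for y
    using assms by (simp add: dist_norm scaleR_diff_right[symmetric] divide_inverse mult.commute)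
  show ?thesis
  proof
    assume sub: "cball q (\<beta> * s) \<subseteq> scaled (t, s, K)"
    have "v \<in> K" if "dist (q /\<^sub>R s - t) v \<le> \<beta>" for v
    proof -
      let ?y = "s *\<^sub>R (v + t)"
      have v: "?y /\<^sub>R s - t = v" using assms by simp
      have "dist q ?y \<le> \<beta> * s" using d[of ?y] that assms unfolding v by (simp add: pos_divide_le_eq)
      then show ?thesis using sub img[of ?y] v by auto
    qed
    then show "q /\<^sub>R s - t \<in> core \<beta> K" by (auto simp: core_def)
  next
    assume c: "q /\<^sub>R s - t \<in> core \<beta> K"
    show "cball q (\<beta> * s) \<subseteq> scaled (t, s, K)"
    proof
      fix y assume "y \<in> cball q (\<beta> * s)"
      then have "dist (q /\<^sub>R s - t) (y /\<^sub>R s - t) \<le> \<beta>" unfolding d using assms by (simp add: pos_divide_le_eq)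
      then show "y \<in> scaled (t, s, K)" using c img unfolding core_def by auto
    qed
  qed
qed

lemma diameter_scaled:
  assumes "0 < s" "bounded K"
  shows "diameter (scaled (t, s, K)) = s * diameter K"
proof (rule antisym)
  have d: "dist (s *\<^sub>R (x + t)) (s *\<^sub>R (y + t)) = s * dist x y" for x y
    using assms by (simp add: dist_norm scaleR_diff_right[symmetric])
  show "diameter (scaled (t, s, K)) \<le> s * diameter K"
  proof (rule diameter_le)
    show "scaled (t, s, K) \<noteq> {} \<or> 0 \<le> s * diameter K" using assms diameter_ge_0[of K] by simp
    fix x y assume "x \<in> scaled (t, s, K)" "y \<in> scaled (t, s, K)"
    then obtain u v where "u \<in> K" "v \<in> K" "x = s *\<^sub>R (u + t)" "y = s *\<^sub>R (v + t)" by (auto simp: scaled_def)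
    then show "norm (x - y) \<le> s * diameter K"
      using d[of u v] diameter_bounded_bound[OF assms(2), of u v] assms(1) by (simp add: dist_norm)
  qed
  have b: "bounded (scaled (t, s, K))"
  proof -
    have "scaled (t, s, K) = (\<lambda>x. s *\<^sub>R x) ` ((\<lambda>x. t + x) ` K)" by (auto simp: scaled_def image_image add.commute)
    then show ?thesis using assms(2) by (simp add: bounded_scaling bounded_translation)
  qed
  have "diameter K \<le> diameter (scaled (t, s, K)) / s"
  proof (rule diameter_le)
    show "K \<noteq> {} \<or> 0 \<le> diameter (scaled (t, s, K)) / s" using assms diameter_ge_0[OF b] by simp
    fix u v assume "u \<in> K" "v \<in> K"
    then have "s * dist u v \<le> diameter (scaled (t, s, K))"
      using diameter_bounded_bound[OF b, of "s *\<^sub>R (u + t)" "s *\<^sub>R (v + t)"] d[of u v] by (auto simp: scaled_def)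
    then show "norm (u - v) \<le> diameter (scaled (t, s, K)) / s"
      using assms(1) by (simp add: pos_le_divide_eq mult.commute dist_norm)
  qed
  then show "s * diameter K \<le> diameter (scaled (t, s, K))" using assms(1) by (simp add: pos_le_divide_eq mult.commute)
qed

section \<open>The intensity of the cutouts\<close>

lemma nn_integral_inverse_atLeastLessThan:
  fixes a b :: real
  assumes "0 < a" "a \<le> b"
  shows "(\<integral>\<^sup>+s. ennreal (indicator {0<..} s / s) * indicator {a..<b} s \<partial>lborel) = ennreal (ln (b / a))"
proof -
  have "(\<integral>\<^sup>+s. ennreal (indicator {0<..} s / s) * indicator {a..<b} s \<partial>lborel)
      = (\<integral>\<^sup>+s. ennreal (1 / s) * indicator {a..b} s \<partial>lborel)"
  proof (rule nn_integral_cong_AE)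
    have "AE s in lborel. s \<noteq> b" by (rule AE_lborel_singleton)
    then show "AE s in lborel. ennreal (indicator {0<..} s / s) * indicator {a..<b} s = ennreal (1 / s) * indicator {a..b} s"
      by eventually_elim (use assms in \<open>auto simp: indicator_def\<close>)
  qed
  also have "\<dots> = ennreal (ln b - ln a)"
    by (rule nn_integral_FTC_Icc) (use assms in \<open>auto intro!: derivative_eq_intros borel_measurable_divide\<close>)
  also have "ln b - ln a = ln (b / a)" using assms by (simp add: ln_div)
  finally show ?thesis .
qed

lemma nn_integral_lborel_reflect:
  fixes c :: "'a::euclidean_space"
  assumes "f \<in> borel_measurable borel"
  shows "(\<integral>\<^sup>+t. f (c - t) \<partial>lborel) = (\<integral>\<^sup>+y. f y \<partial>lborel)"
proof -
  have eq: "lborel = distr lborel borel (\<lambda>x. c - x)"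
    using lborel_affine[of "-1" c] by (simp add: density_1)
  have "(\<integral>\<^sup>+y. f y \<partial>lborel) = (\<integral>\<^sup>+y. f y \<partial>distr lborel borel (\<lambda>x. c - x))"
    using eq by simp
  also have "\<dots> = (\<integral>\<^sup>+t. f (c - t) \<partial>lborel)"
    using assms by (intro nn_integral_distr) auto
  finally show ?thesis by simp
qed

lemma cutout_intensity_scaled:
  "cutout_intensity Q0 =
     distr (lborel \<Otimes>\<^sub>M (density lborel (\<lambda>s::real. ennreal (indicator {0<..} s / s)) \<Otimes>\<^sub>M Q0)) compacts scaled"
  by (simp add: cutout_intensity_def scaled_def)

text \<open>The depth is relative to the diameter, which makes the family compatible with scaling;
  for \<beta> = 0 it is plain membership of \<open>q\<close>.\<close>

definition size_set :: "real \<Rightarrow> real \<Rightarrow> real \<Rightarrow> 'a::euclidean_space \<Rightarrow> 'a set set" where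
  "size_set \<beta> a b q = {K. compact K \<and> a \<le> diameter K \<and> diameter K < b \<and> cball q (\<beta> * diameter K) \<subseteq> K}"

text \<open>The coefficient of ln(b/a) in the intensity of \<open>size_set\<close>; at depth 0 it
  turns out to be \<alpha>.\<close>

definition core_mass :: "'a::euclidean_space set measure \<Rightarrow> real \<Rightarrow> ennreal" where
  "core_mass Q0 \<beta> = (\<integral>\<^sup>+K. emeasure lborel (core \<beta> K) \<partial>Q0)"

lemma size_set_measurable:
  fixes q :: "'a::euclidean_space"
  assumes "0 \<le> \<beta>"
  shows "size_set \<beta> a b q \<in> sets compacts"
proof -
  have [measurable]: "diameter \<in> borel_measurable (compacts :: 'a set measure)" by (rule diameter_measurable)
  have "{K \<in> space compacts. cball q (\<beta> * diameter K) \<subseteq> K} \<in> sets (compacts :: 'a set measure)"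
    by (rule cball_subset_measurable[of "\<lambda>K. K"])
      (use assms in \<open>auto simp: space_compacts intro!: mult_nonneg_nonneg diameter_ge_0 compact_imp_bounded\<close>)
  moreover have "{K \<in> space (compacts :: 'a set measure). a \<le> diameter K} \<in> sets compacts"
    "{K \<in> space (compacts :: 'a set measure). diameter K < b} \<in> sets compacts" by measurable
  ultimately have "{K \<in> space (compacts :: 'a set measure). a \<le> diameter K} \<inter> {K \<in> space compacts. diameter K < b} \<inter>
     {K \<in> space compacts. cball q (\<beta> * diameter K) \<subseteq> K} \<in> sets compacts" by (intro sets.Int)
  also have "{K \<in> space (compacts :: 'a set measure). a \<le> diameter K} \<inter> {K \<in> space compacts. diameter K < b} \<inter>
     {K \<in> space compacts. cball q (\<beta> * diameter K) \<subseteq> K} = size_set \<beta> a b q"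
    by (auto simp: size_set_def space_compacts)
  finally show ?thesis .
qed

lemma emeasure_core_measurable:
  fixes Q0 :: "'a::euclidean_space set measure"
  assumes "sets Q0 = sets compacts" "0 \<le> \<beta>" "finite_measure Q0"
  shows "(\<lambda>K. emeasure lborel (core \<beta> K)) \<in> borel_measurable Q0"
proof -
  interpret Q0: finite_measure Q0 by (rule assms(3))
  interpret L: sigma_finite_measure "lborel :: 'a measure" by (rule sigma_finite_lborel)
  interpret LQ: pair_sigma_finite "lborel :: 'a measure" Q0 by unfold_locales
  let ?S = "{w \<in> space (borel \<Otimes>\<^sub>M compacts). fst w \<in> core \<beta> (snd w)} :: ('a \<times> 'a set) set"
  have s: "sets (lborel \<Otimes>\<^sub>M Q0) = sets (borel \<Otimes>\<^sub>M (compacts :: 'a set measure))"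
    using assms(1) by (intro sets_pair_measure_cong) auto
  have S: "?S \<in> sets (lborel \<Otimes>\<^sub>M Q0)" unfolding s by (rule core_measurable[OF assms(2)])
  have "(\<lambda>K. emeasure lborel ((\<lambda>y. (y, K)) -` ?S)) \<in> borel_measurable Q0"
    by (rule LQ.measurable_emeasure_Pair2[OF S])
  moreover have "(\<lambda>y. (y, K)) -` ?S = core \<beta> K" if "K \<in> space Q0" for K
    using that sets_eq_imp_space_eq[OF assms(1)] by (auto simp: space_pair_measure)
  ultimately show ?thesis by (simp cong: measurable_cong)
qed

lemma core_borel:
  fixes K :: "'a::euclidean_space set"
  assumes "compact K" "0 \<le> \<beta>"
  shows "core \<beta> K \<in> sets borel"
proof -
  have "(\<lambda>y. (y, K)) -` {w \<in> space (borel \<Otimes>\<^sub>M compacts). fst w \<in> core \<beta> (snd w)} \<in> sets (borel :: 'a measure)"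
    by (rule sets_Pair2[OF core_measurable[OF assms(2)]])
  moreover have "(\<lambda>y. (y, K)) -` {w \<in> space (borel \<Otimes>\<^sub>M compacts). fst w \<in> core \<beta> (snd w)} = core \<beta> K"
    using assms(1) by (auto simp: space_pair_measure space_compacts)
  ultimately show ?thesis by simp
qed

text \<open>For a fixed shape of unit diameter and a fixed scale s, the integral over the
  translations t is the volume of the core, whatever q and s are, since t is mapped to q/s - t and
  Lebesgue measure is invariant under reflections and translations. The scale is the diameter of the
  scaled set, so it runs over [a, b), and ds/s integrates to ln(b/a).\<close>

lemma emeasure_cutout_intensity_size_set:
  fixes Q0 :: "'a::euclidean_space set measure"
  assumes Q0: "sets Q0 = sets compacts" "finite_measure Q0" and diam: "AE K in Q0. diameter K = 1"
    and \<beta>: "0 \<le> \<beta>" and ab: "0 < a" "a \<le> b"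
  shows "emeasure (cutout_intensity Q0) (size_set \<beta> a b q) = ennreal (ln (b / a)) * core_mass Q0 \<beta>"
proof -
  interpret Q0: finite_measure Q0 by (rule Q0(2))
  let ?ds = "density lborel (\<lambda>s::real. ennreal (indicator {0<..} s / s))"
  let ?G = "?ds \<Otimes>\<^sub>M Q0"
  have dm: "(\<lambda>s::real. indicator {0<..} s / s) \<in> borel_measurable lborel" by measurable
  have "AE s in lborel. ennreal (indicator {0<..} (s::real) / s) \<noteq> \<infinity>" by simp
  then have "sigma_finite_measure ?ds"
    using dm by (subst sigma_finite_measure.sigma_finite_iff_density_finite[OF sigma_finite_lborel]) auto
  then interpret ds: sigma_finite_measure ?ds .
  interpret dsQ: pair_sigma_finite ?ds Q0 by unfold_locales
  have "sigma_finite_measure ?G"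
    by (rule sigma_finite_pair_measure[OF ds.sigma_finite_measure_axioms Q0.sigma_finite_measure_axioms])
  then interpret G: sigma_finite_measure ?G .
  interpret LG: pair_sigma_finite "lborel :: 'a measure" ?G by unfold_locales
  have sN: "sets (lborel \<Otimes>\<^sub>M ?G) = sets (borel \<Otimes>\<^sub>M (borel \<Otimes>\<^sub>M (compacts :: 'a set measure)))"
    using Q0(1) by (intro sets_pair_measure_cong) auto
  have scM: "scaled \<in> (lborel \<Otimes>\<^sub>M ?G) \<rightarrow>\<^sub>M (compacts :: 'a set measure)"
    by (subst measurable_cong_sets[OF sN refl]) (rule scaled_measurable)
  let ?T = "size_set \<beta> a b q"
  have T: "?T \<in> sets compacts" by (rule size_set_measurable[OF \<beta>])
  have "emeasure (cutout_intensity Q0) ?T = integral\<^sup>N (distr (lborel \<Otimes>\<^sub>M ?G) compacts scaled) (indicator ?T)"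
    using T unfolding cutout_intensity_scaled by (subst nn_integral_indicator) auto
  also have "\<dots> = (\<integral>\<^sup>+w. indicator ?T (scaled w) \<partial>(lborel \<Otimes>\<^sub>M ?G))"
    using T by (intro nn_integral_distr scM borel_measurable_indicator) auto
  also have "\<dots> = (\<integral>\<^sup>+v. (\<integral>\<^sup>+t. indicator ?T (scaled (t, v)) \<partial>lborel) \<partial>?G)"
    by (rule LG.nn_integral_snd[symmetric]) (use T in \<open>auto intro!: measurable_compose[OF scM] borel_measurable_indicator\<close>)
  also have "\<dots> = (\<integral>\<^sup>+s. (\<integral>\<^sup>+K. (\<integral>\<^sup>+t. indicator ?T (scaled (t, s, K)) \<partial>lborel) \<partial>Q0) \<partial>?ds)"
  proof (rule Q0.nn_integral_fst[symmetric])
    have "(\<lambda>(v, t). indicator ?T (scaled (t, v)) :: ennreal) \<in> borel_measurable (?G \<Otimes>\<^sub>M lborel)"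
      unfolding case_prod_beta
      by (rule measurable_compose[OF _ borel_measurable_indicator[OF T]], rule measurable_compose[OF _ scM]) measurable
    then show "(\<lambda>v. \<integral>\<^sup>+t. indicator ?T (scaled (t, v)) \<partial>lborel) \<in> borel_measurable ?G"
      by (rule sigma_finite_measure.borel_measurable_nn_integral[OF sigma_finite_lborel])
  qed
  also have "\<dots> = (\<integral>\<^sup>+s. ennreal (indicator {0<..} s / s) * (\<integral>\<^sup>+K. (\<integral>\<^sup>+t. indicator ?T (scaled (t, s, K)) \<partial>lborel) \<partial>Q0) \<partial>lborel)"
  proof (rule nn_integral_density)
    have "(\<lambda>(w, t). indicator ?T (scaled (t, w)) :: ennreal) \<in> borel_measurable (?G \<Otimes>\<^sub>M lborel)"
      unfolding case_prod_beta
      by (rule measurable_compose[OF _ borel_measurable_indicator[OF T]], rule measurable_compose[OF _ scM]) measurable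
    then have "(\<lambda>v. \<integral>\<^sup>+t. indicator ?T (scaled (t, v)) \<partial>lborel) \<in> borel_measurable ?G"
      by (rule sigma_finite_measure.borel_measurable_nn_integral[OF sigma_finite_lborel])
    then have "(\<lambda>(s, K). \<integral>\<^sup>+t. indicator ?T (scaled (t, s, K)) \<partial>lborel) \<in> borel_measurable ?G"
      by (simp add: case_prod_beta')
    then have "(\<lambda>s. \<integral>\<^sup>+K. (\<integral>\<^sup>+t. indicator ?T (scaled (t, s, K)) \<partial>lborel) \<partial>Q0) \<in> borel_measurable ?ds"
      by (rule Q0.borel_measurable_nn_integral)
    then show "(\<lambda>s. \<integral>\<^sup>+K. (\<integral>\<^sup>+t. indicator ?T (scaled (t, s, K)) \<partial>lborel) \<partial>Q0) \<in> borel_measurable lborel"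
      by simp
  qed (use dm in measurable)
  also have "\<dots> = (\<integral>\<^sup>+s. ennreal (indicator {0<..} s / s) * indicator {a..<b} s * core_mass Q0 \<beta> \<partial>lborel)"
  proof (rule nn_integral_cong)
    fix s :: real
    show "ennreal (indicator {0<..} s / s) * (\<integral>\<^sup>+K. (\<integral>\<^sup>+t. indicator ?T (scaled (t, s, K)) \<partial>lborel) \<partial>Q0)
       = ennreal (indicator {0<..} s / s) * indicator {a..<b} s * core_mass Q0 \<beta>"
    proof (cases "0 < s")
      case False
      then show ?thesis by simp
    next
      case s: True
      have "(\<integral>\<^sup>+K. (\<integral>\<^sup>+t. indicator ?T (scaled (t, s, K)) \<partial>lborel) \<partial>Q0)
         = (\<integral>\<^sup>+K. indicator {a..<b} s * emeasure lborel (core \<beta> K) \<partial>Q0)"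
      proof (rule nn_integral_cong_AE)
        have "AE K in Q0. K \<in> space Q0" by (rule AE_space)
        then show "AE K in Q0. (\<integral>\<^sup>+t. indicator ?T (scaled (t, s, K)) \<partial>lborel) = indicator {a..<b} s * emeasure lborel (core \<beta> K)"
          using diam
        proof eventually_elim
          case (elim K)
          then have K: "compact K" using sets_eq_imp_space_eq[OF Q0(1)] by (simp add: space_compacts)
          have cK: "core \<beta> K \<in> sets borel" by (rule core_borel[OF K \<beta>])
          have cs: "compact (scaled (t, s, K))" for t
            unfolding scaled_def prod.case using K by (intro compact_continuous_image continuous_intros) auto
          have ds: "diameter (scaled (t, s, K)) = s" for t
            using diameter_scaled[OF s compact_imp_bounded[OF K], of t] elim(2) by simp
          have "indicator ?T (scaled (t, s, K)) = indicator {a..<b} s * (indicator (core \<beta> K) (q /\<^sub>R s - t) :: ennreal)" for t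
            using cs[of t] ds[of t] scaled_core[OF s, of q \<beta> t K] by (auto simp: size_set_def indicator_def)
          then have "(\<integral>\<^sup>+t. indicator ?T (scaled (t, s, K)) \<partial>lborel) = (\<integral>\<^sup>+t. indicator {a..<b} s * indicator (core \<beta> K) (q /\<^sub>R s - t) \<partial>lborel)"
            by simp
          also have "\<dots> = (\<integral>\<^sup>+y. indicator {a..<b} s * indicator (core \<beta> K) y \<partial>lborel)"
            by (rule nn_integral_lborel_reflect[of "\<lambda>y. indicator {a..<b} s * indicator (core \<beta> K) y"]) (use cK in measurable)
          also have "\<dots> = indicator {a..<b} s * emeasure lborel (core \<beta> K)"
            using cK by (subst nn_integral_cmult) auto
          finally show ?case .
        qed
      qed
      also have "\<dots> = indicator {a..<b} s * core_mass Q0 \<beta>"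
        unfolding core_mass_def by (rule nn_integral_cmult[OF emeasure_core_measurable[OF Q0(1) \<beta> Q0(2)]])
      finally show ?thesis by (simp add: mult.assoc)
    qed
  qed
  also have "\<dots> = (\<integral>\<^sup>+s. ennreal (indicator {0<..} s / s) * indicator {a..<b} s \<partial>lborel) * core_mass Q0 \<beta>"
    by (rule nn_integral_multc) measurable
  also have "\<dots> = ennreal (ln (b / a)) * core_mass Q0 \<beta>"
    unfolding nn_integral_inverse_atLeastLessThan[OF ab] ..
  finally show ?thesis .
qed

section \<open>Core mass as a function of the depth\<close>

lemma core_antimono: "\<beta> \<le> \<beta>' \<Longrightarrow> core \<beta>' K \<subseteq> core \<beta> K"
  unfolding core_def by (auto simp: subset_iff)

lemma core_0: "core 0 K = K"
  by (auto simp: core_def)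

lemma core_mass_antimono:
  assumes "sets Q0 = sets compacts" "0 \<le> \<beta>" "\<beta> \<le> \<beta>'"
  shows "core_mass Q0 \<beta>' \<le> core_mass Q0 \<beta>"
  unfolding core_mass_def
proof (intro nn_integral_mono emeasure_mono core_antimono assms(3))
  fix K assume "K \<in> space Q0"
  then have "compact K" using sets_eq_imp_space_eq[OF assms(1)] by (simp add: space_compacts)
  then show "core \<beta> K \<in> sets lborel" using core_borel assms(2) by simp
qed

lemma core_mass_finite:
  fixes Q0 :: "'a::euclidean_space set measure"
  assumes Q0: "sets Q0 = sets compacts" "finite_measure Q0" and diam: "AE K in Q0. diameter K = 1"
  shows "core_mass Q0 0 < \<infinity>"
proof -
  interpret Q0: finite_measure Q0 by (rule Q0(2))
  define c where "c = unit_ball_vol (real DIM('a))"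
  have "core_mass Q0 0 \<le> (\<integral>\<^sup>+K. ennreal c \<partial>Q0)"
    unfolding core_mass_def
  proof (rule nn_integral_mono_AE)
    have "AE K in Q0. K \<in> space Q0" by (rule AE_space)
    then show "AE K in Q0. emeasure lborel (core 0 K) \<le> ennreal c"
      using diam
    proof eventually_elim
      case (elim K)
      then have K: "compact K" using sets_eq_imp_space_eq[OF Q0(1)] by (simp add: space_compacts)
      have "K \<noteq> {}" using elim(2) by auto
      then obtain x where x: "x \<in> K" by blast
      have "K \<subseteq> cball x 1"
        using diameter_bounded_bound[OF compact_imp_bounded[OF K] x] elim(2) by auto
      then have "emeasure lborel K \<le> emeasure lborel (cball x 1)" by (intro emeasure_mono) auto
      then show ?case by (simp add: core_0 emeasure_cball c_def)
    qed
  qed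
  also have "\<dots> = ennreal c * emeasure Q0 (space Q0)" by simp
  also have "\<dots> < \<infinity>"
  proof -
    have "emeasure Q0 (space Q0) < \<top>" by (subst less_top[symmetric]) (rule Q0.emeasure_finite)
    then show ?thesis by (simp add: ennreal_mult_less_top)
  qed
  finally show ?thesis .
qed

text \<open>As the depth tends to 0 the cores of a set increase to its interior, which has full
  measure if the boundary is null; the claim is then monotone convergence. A small positive depth
  therefore costs arbitrarily little of the exponent.\<close>

lemma core_mass_SUP:
  fixes Q0 :: "'a::euclidean_space set measure"
  assumes Q0: "sets Q0 = sets compacts" "finite_measure Q0" and fr: "AE K in Q0. emeasure lborel (frontier K) = 0"
  shows "(SUP i. core_mass Q0 (rad i)) = core_mass Q0 0"
proof -
  have rad_dec: "rad (Suc i) \<le> rad i" for i by (simp add: rad_def field_simps)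
  have cb: "core (rad i) K \<in> sets lborel" if "K \<in> space Q0" for i K
    using that sets_eq_imp_space_eq[OF Q0(1)] core_borel[of K "rad i"] rad_pos[of i] by (simp add: space_compacts)
  have "core_mass Q0 0 = (\<integral>\<^sup>+K. (SUP i. emeasure lborel (core (rad i) K)) \<partial>Q0)"
    unfolding core_mass_def
  proof (rule nn_integral_cong_AE)
    have "AE K in Q0. K \<in> space Q0" by (rule AE_space)
    then show "AE K in Q0. emeasure lborel (core 0 K) = (SUP i. emeasure lborel (core (rad i) K))"
      using fr
    proof eventually_elim
      case (elim K)
      then have K: "compact K" using sets_eq_imp_space_eq[OF Q0(1)] by (simp add: space_compacts)
      have "(SUP i. emeasure lborel (core (rad i) K)) = emeasure lborel (\<Union>i. core (rad i) K)"
        using cb[OF elim(1)] rad_dec by (intro SUP_emeasure_incseq incseq_SucI core_antimono) auto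
      also have "(\<Union>i. core (rad i) K) = interior K"
      proof (intro equalityI subsetI)
        fix y assume "y \<in> (\<Union>i. core (rad i) K)"
        then obtain i where "cball y (rad i) \<subseteq> K" by (auto simp: core_def)
        then show "y \<in> interior K" using rad_pos[of i] unfolding mem_interior_cball by blast
      next
        fix y assume "y \<in> interior K"
        then obtain e where e: "e > 0" "cball y e \<subseteq> K" unfolding mem_interior_cball by blast
        obtain i where "rad i < e" using rad_small[OF e(1)] by blast
        then have "cball y (rad i) \<subseteq> K" using e(2) subset_cball[of "rad i" e y] by auto
        then show "y \<in> (\<Union>i. core (rad i) K)" by (auto simp: core_def)
      qed
      also have "emeasure lborel (interior K) = emeasure lborel K"
      proof -
        have "K = interior K \<union> frontier K"
          using interior_subset[of K] compact_imp_closed[OF K] by (auto simp: frontier_def closure_closed)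
        then have "emeasure lborel K \<le> emeasure lborel (interior K) + emeasure lborel (frontier K)"
          using emeasure_subadditive[of "interior K" lborel "frontier K"] by simp
        then have "emeasure lborel K \<le> emeasure lborel (interior K)" using elim(2) by simp
        moreover have "emeasure lborel (interior K) \<le> emeasure lborel K"
          using interior_subset[of K] K by (intro emeasure_mono) (auto simp: borel_compact)
        ultimately show ?thesis by (rule antisym[rotated])
      qed
      finally show ?case by (simp add: core_0)
    qed
  qed
  also have "\<dots> = (SUP i. core_mass Q0 (rad i))"
    unfolding core_mass_def
  proof (rule nn_integral_monotone_convergence_SUP_AE)
    fix i
    show "AE K in Q0. emeasure lborel (core (rad i) K) \<le> emeasure lborel (core (rad (Suc i)) K)"
      using cb rad_dec by (intro AE_I2 emeasure_mono core_antimono) auto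
    show "(\<lambda>K. emeasure lborel (core (rad i) K)) \<in> borel_measurable Q0"
      using emeasure_core_measurable[OF Q0(1) _ Q0(2)] rad_pos[of i] by simp
  qed
  finally show ?thesis by simp
qed

text \<open>Null boundaries are given for almost all translated and scaled copies. Fubini provides
  one translation and one positive scale that are good for almost every shape, and undoing this
  similarity preserves boundaries and null sets.\<close>

lemma frontier_null_transfer:
  fixes Q0 :: "'a::euclidean_space set measure"
  assumes Q0: "sets Q0 = sets compacts" "finite_measure Q0"
    and fr: "AE K in cutout_intensity Q0. emeasure lborel (frontier K) = 0"
  shows "AE K in Q0. emeasure lborel (frontier K) = 0"
proof -
  interpret Q0: finite_measure Q0 by (rule Q0(2))
  let ?ds = "density lborel (\<lambda>s::real. ennreal (indicator {0<..} s / s))"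
  let ?G = "?ds \<Otimes>\<^sub>M Q0"
  have dm: "(\<lambda>s::real. indicator {0<..} s / s) \<in> borel_measurable lborel" by measurable
  have "AE s in lborel. ennreal (indicator {0<..} (s::real) / s) \<noteq> \<infinity>" by simp
  then have "sigma_finite_measure ?ds"
    using dm by (subst sigma_finite_measure.sigma_finite_iff_density_finite[OF sigma_finite_lborel]) auto
  then interpret ds: sigma_finite_measure ?ds .
  interpret dsQ: pair_sigma_finite ?ds Q0 by unfold_locales
  have "sigma_finite_measure ?G"
    by (rule sigma_finite_pair_measure[OF ds.sigma_finite_measure_axioms Q0.sigma_finite_measure_axioms])
  then interpret G: sigma_finite_measure ?G .
  interpret LG: pair_sigma_finite "lborel :: 'a measure" ?G by unfold_locales
  have sN: "sets (lborel \<Otimes>\<^sub>M ?G) = sets (borel \<Otimes>\<^sub>M (borel \<Otimes>\<^sub>M (compacts :: 'a set measure)))"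
    using Q0(1) by (intro sets_pair_measure_cong) auto
  have scM: "scaled \<in> (lborel \<Otimes>\<^sub>M ?G) \<rightarrow>\<^sub>M (compacts :: 'a set measure)"
    by (subst measurable_cong_sets[OF sN refl]) (rule scaled_measurable)
  have "AE w in lborel \<Otimes>\<^sub>M ?G. emeasure lborel (frontier (scaled w)) = 0"
    by (rule AE_distrD[OF scM fr[unfolded cutout_intensity_scaled]])
  then have "AE t in lborel. AE v in ?G. emeasure lborel (frontier (scaled (t, v))) = 0"
    by (rule LG.AE_pair)
  note ae = this
  have "\<exists>t. AE v in ?G. emeasure lborel (frontier (scaled (t, v))) = 0"
  proof (rule ccontr)
    assume no: "\<not> (\<exists>t. AE v in ?G. emeasure lborel (frontier (scaled (t, v))) = 0)"
    from ae have "AE t in lborel. t \<notin> ball (0::'a) 1" by eventually_elim (use no in blast)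
    then have "emeasure lborel (ball (0::'a) 1) = 0"
      by (intro AE_iff_measurable[where P="\<lambda>t. t \<notin> ball (0::'a) 1", THEN iffD1]) auto
    then have "unit_ball_vol (real DIM('a)) \<le> 0" by (simp add: emeasure_ball ennreal_eq_0_iff)
    moreover have "unit_ball_vol (real DIM('a)) > 0" by simp
    ultimately show False by linarith
  qed
  then obtain t where t: "AE v in ?G. emeasure lborel (frontier (scaled (t, v))) = 0" by blast
  have "AE s in ?ds. AE K in Q0. emeasure lborel (frontier (scaled (t, s, K))) = 0"
    by (rule dsQ.AE_pair[OF t])
  then have s1: "AE s in lborel. 0 < ennreal (indicator {0<..} s / s) \<longrightarrow> (AE K in Q0. emeasure lborel (frontier (scaled (t, s, K))) = 0)"
    using dm by (subst (asm) AE_density) auto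
  have "\<exists>s>0. AE K in Q0. emeasure lborel (frontier (scaled (t, s, K))) = 0"
  proof (rule ccontr)
    assume no: "\<not> (\<exists>s>0. AE K in Q0. emeasure lborel (frontier (scaled (t, s, K))) = 0)"
    have "AE s in lborel. s \<notin> {0<..<1::real}"
      using s1 by eventually_elim (use no in auto)
    then have "emeasure lborel {0<..<1::real} = 0"
      by (intro AE_iff_measurable[where P="\<lambda>s. s \<notin> {0<..<1::real}", THEN iffD1]) auto
    then show False by simp
  qed
  then obtain s where s: "0 < s" "AE K in Q0. emeasure lborel (frontier (scaled (t, s, K))) = 0" by blast
  show ?thesis using s(2) AE_space
  proof eventually_elim
    case (elim K)
    then have K: "compact K" using sets_eq_imp_space_eq[OF Q0(1)] by (simp add: space_compacts)
    have "scaled (t, s, K) = (\<lambda>x. s *\<^sub>R t + s *\<^sub>R x) ` K" by (auto simp: scaled_def scaleR_add_right add.commute)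
    also have "frontier \<dots> = (\<lambda>x. s *\<^sub>R t + s *\<^sub>R x) ` frontier K"
    proof -
      have 1: "(\<lambda>x. s *\<^sub>R t + s *\<^sub>R x) ` S = (+) (s *\<^sub>R t) ` ((\<lambda>x. s *\<^sub>R x) ` S)" for S :: "'a set" by (simp add: image_image)
      have "frontier ((\<lambda>x. s *\<^sub>R x) ` K) = (\<lambda>x. s *\<^sub>R x) ` frontier K"
        unfolding frontier_def
        using s(1) closure_scaleR[of s K] interior_injective_linear_image[of "\<lambda>x. s *\<^sub>R x" K]
        by (simp add: image_set_diff injective_scaleR linear_scale_self)
      then show ?thesis unfolding 1 frontier_translation by simp
    qed
    finally have f: "frontier (scaled (t, s, K)) = (\<lambda>x. s *\<^sub>R t + s *\<^sub>R x) ` frontier K" .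
    have "frontier K \<in> sets borel" by (simp add: borel_closed)
    have lm: "emeasure lebesgue (frontier K) = emeasure lborel (frontier K)" by (simp add: borel_closed)
    have "emeasure lebesgue ((\<lambda>x. s *\<^sub>R t + s *\<^sub>R x) ` frontier K) = ennreal (\<bar>s\<bar> ^ DIM('a)) * emeasure lebesgue (frontier K)"
      using emeasure_lebesgue_affine[of s "s *\<^sub>R t" "frontier K"] by (simp add: add.commute)
    moreover have "emeasure lebesgue ((\<lambda>x. s *\<^sub>R t + s *\<^sub>R x) ` frontier K) = 0"
      using elim(1) unfolding f[symmetric] by (simp add: borel_closed)
    ultimately have "ennreal (\<bar>s\<bar> ^ DIM('a)) * emeasure lebesgue (frontier K) = 0" by simp
    then show ?case using s(1) lm by auto
  qed
qed

section \<open>Void probabilities and moments\<close>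

lemma sum_lists_Suc:
  assumes "finite I"
  shows "(\<Sum>xs\<in>{xs. set xs \<subseteq> I \<and> length xs = Suc p}. f xs)
    = (\<Sum>xs\<in>{xs. set xs \<subseteq> I \<and> length xs = p}. \<Sum>x\<in>I. f (x # xs))"
proof -
  have inj: "inj_on (\<lambda>(xs, x). x # xs) ({xs. set xs \<subseteq> I \<and> length xs = p} \<times> I)"
    by (auto simp: inj_on_def)
  show ?thesis
    unfolding lists_length_Suc_eq sum.reindex[OF inj] by (simp add: sum.cartesian_product case_prod_beta o_def)
qed

text \<open>Expansion over lists with repetitions, so that points can be added to a configuration
  one at a time.\<close>

lemma power_sum_lists:
  fixes v :: "'i \<Rightarrow> real"
  assumes "finite I"
  shows "(\<Sum>i\<in>I. v i) ^ p = (\<Sum>xs\<in>{xs. set xs \<subseteq> I \<and> length xs = p}. prod_list (map v xs))"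
proof (induction p)
  case 0
  have "{xs. set xs \<subseteq> I \<and> length xs = 0} = {[]}" by auto
  then show ?case by simp
next
  case (Suc p)
  show ?case
    unfolding sum_lists_Suc[OF assms] by (simp add: Suc sum_distrib_left sum_distrib_right mult.commute)
qed

text \<open>The depth is a parameter because two kinds of values occur: 0 to identify \<alpha>, and
  a small positive one for the slices.\<close>

locale cutout =
  fixes M :: "'v measure" and Q0 :: "'a::euclidean_space set measure" and Y :: "'v \<Rightarrow> 'a set set" and \<beta> :: real
  assumes Q0: "sets Q0 = sets compacts" "finite_measure Q0" and diam: "AE K in Q0. diameter K = 1"
    and pp: "poisson_pp M (cutout_intensity Q0) Y" and \<beta>: "0 \<le> \<beta>"
begin

abbreviation "Q \<equiv> cutout_intensity Q0"

lemma prob: "prob_space M"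
  using pp by (simp add: poisson_pp_def)

sublocale prob_space M by (rule prob)

lemma sets_Q: "sets Q = sets compacts" and space_Q: "space Q = {K. compact K}"
  by (simp_all add: cutout_intensity_def space_compacts)

lemma Y_compact: "\<omega> \<in> space M \<Longrightarrow> K \<in> Y \<omega> \<Longrightarrow> compact K"
  using pp unfolding poisson_pp_def space_Q by blast

lemma
  assumes "S \<in> sets Q" "emeasure Q S < \<infinity>"
  shows count_measurable: "(\<lambda>\<omega>. card (Y \<omega> \<inter> S)) \<in> M \<rightarrow>\<^sub>M count_space UNIV"
    and count_finite: "AE \<omega> in M. finite (Y \<omega> \<inter> S)"
    and void_prob: "measure M {\<omega> \<in> space M. card (Y \<omega> \<inter> S) = 0} = exp (- measure Q S)"
proof -
  have *: "\<forall>S\<in>sets Q. emeasure Q S < \<infinity> \<longrightarrow>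
        (\<lambda>\<omega>. card (Y \<omega> \<inter> S)) \<in> M \<rightarrow>\<^sub>M count_space UNIV \<and>
        (AE \<omega> in M. finite (Y \<omega> \<inter> S)) \<and>
        (\<forall>j::nat. measure M {\<omega>\<in>space M. card (Y \<omega> \<inter> S) = j}
                   = measure Q S ^ j / fact j * exp (- measure Q S))"
    using pp unfolding poisson_pp_def by (elim conjE)
  from *[rule_format, OF assms] have
    a: "(\<lambda>\<omega>. card (Y \<omega> \<inter> S)) \<in> M \<rightarrow>\<^sub>M count_space UNIV"
    and b: "AE \<omega> in M. finite (Y \<omega> \<inter> S)"
    and c: "\<And>j::nat. measure M {\<omega>\<in>space M. card (Y \<omega> \<inter> S) = j}
                   = measure Q S ^ j / fact j * exp (- measure Q S)"
    by blast+
  show "(\<lambda>\<omega>. card (Y \<omega> \<inter> S)) \<in> M \<rightarrow>\<^sub>M count_space UNIV" "AE \<omega> in M. finite (Y \<omega> \<inter> S)"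
    "measure M {\<omega> \<in> space M. card (Y \<omega> \<inter> S) = 0} = exp (- measure Q S)"
    using a b c[of 0] by auto
qed

section \<open>Void probabilities at one and at several points\<close>

definition mass :: real where "mass = enn2real (core_mass Q0 \<beta>)"

lemma core_mass_eq: "core_mass Q0 \<beta> = ennreal mass"
proof -
  have "core_mass Q0 \<beta> \<le> core_mass Q0 0" by (rule core_mass_antimono[OF Q0(1)]) (use \<beta> in auto)
  also have "\<dots> < \<infinity>" by (rule core_mass_finite[OF Q0 diam])
  finally show ?thesis by (simp add: mass_def)
qed

lemma mass_nonneg: "0 \<le> mass" by (simp add: mass_def)

lemma size_set_Q:
  assumes "0 < a" "a \<le> b"
  shows "size_set \<beta> a b q \<in> sets Q" "emeasure Q (size_set \<beta> a b q) = ennreal (ln (b / a) * mass)"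
    "measure Q (size_set \<beta> a b q) = ln (b / a) * mass"
proof -
  show "size_set \<beta> a b q \<in> sets Q" unfolding sets_Q by (rule size_set_measurable[OF \<beta>])
  have l: "0 \<le> ln (b / a)" using assms by simp
  show e: "emeasure Q (size_set \<beta> a b q) = ennreal (ln (b / a) * mass)"
    unfolding emeasure_cutout_intensity_size_set[OF Q0 diam \<beta> assms] core_mass_eq
    using l mass_nonneg by (simp add: ennreal_mult)
  show "measure Q (size_set \<beta> a b q) = ln (b / a) * mass"
    unfolding measure_def e using l mass_nonneg by simp
qed

definition S :: "nat \<Rightarrow> 'a \<Rightarrow> 'a set set" where "S n q = size_set \<beta> (2 powr (- real n)) 1 q"

lemma powr_neg_le_1: "2 powr (- real n) \<le> (1::real)"
  using powr_mono[of "- real n" 0 2] by simp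

lemma S_Q: "S n q \<in> sets Q" "emeasure Q (S n q) < \<infinity>"
  unfolding S_def using powr_neg_le_1[of n] by (simp_all add: size_set_Q)

text \<open>\<open>card\<close> is 0 on infinite sets as well; since the count is almost surely
  finite, this is almost surely the event that no set of the family occurs.\<close>

definition vacant :: "nat \<Rightarrow> 'a \<Rightarrow> 'v set" where
  "vacant n q = {\<omega> \<in> space M. card (Y \<omega> \<inter> S n q) = 0}"

lemma count_zero_events:
  assumes "A \<in> sets Q" "emeasure Q A < \<infinity>"
  shows "{\<omega> \<in> space M. card (Y \<omega> \<inter> A) = 0} \<in> events"
proof -
  have "(\<lambda>\<omega>. card (Y \<omega> \<inter> A)) -` {0} \<inter> space M \<in> events"
    using measurable_sets[OF count_measurable[OF assms], of "{0}"] by simp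
  moreover have "(\<lambda>\<omega>. card (Y \<omega> \<inter> A)) -` {0} \<inter> space M = {\<omega> \<in> space M. card (Y \<omega> \<inter> A) = 0}" by auto
  ultimately show ?thesis by simp
qed

lemma vacant_events: "vacant n q \<in> events"
  unfolding vacant_def by (rule count_zero_events[OF S_Q])

text \<open>The Poisson probability that no set with diameter in [2^-n, 1) contains one of the
  points at the prescribed relative depth.\<close>

definition void :: "nat \<Rightarrow> 'a list \<Rightarrow> real" where
  "void n xs = exp (- measure Q (\<Union>x\<in>set xs. S n x))"

lemma Union_S_Q: "(\<Union>x\<in>set xs. S n x) \<in> sets Q" "emeasure Q (\<Union>x\<in>set xs. S n x) < \<infinity>"
proof -
  show "(\<Union>x\<in>set xs. S n x) \<in> sets Q" using S_Q(1) by auto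
  have "emeasure Q (\<Union>x\<in>set xs. S n x) \<le> (\<Sum>x\<in>set xs. emeasure Q (S n x))"
    using S_Q(1) by (intro emeasure_subadditive_finite) auto
  also have "\<dots> < \<infinity>" using S_Q(2) by (simp add: ennreal_sum_less_top)
  finally show "emeasure Q (\<Union>x\<in>set xs. S n x) < \<infinity>" .
qed

lemma prob_vacant_list: "measure M {\<omega> \<in> space M. \<forall>x\<in>set xs. \<omega> \<in> vacant n x} \<le> void n xs"
proof -
  let ?U = "\<Union>x\<in>set xs. S n x"
  have "measure M {\<omega> \<in> space M. \<forall>x\<in>set xs. \<omega> \<in> vacant n x} \<le> measure M {\<omega> \<in> space M. card (Y \<omega> \<inter> ?U) = 0}"
  proof (rule finite_measure_mono_AE)
    show "AE \<omega> in M. \<omega> \<in> {\<omega> \<in> space M. \<forall>x\<in>set xs. \<omega> \<in> vacant n x} \<longrightarrow> \<omega> \<in> {\<omega> \<in> space M. card (Y \<omega> \<inter> ?U) = 0}"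
      using count_finite[OF Union_S_Q[where xs=xs and n=n]]
    proof eventually_elim
      case (elim \<omega>)
      show ?case
      proof (intro impI CollectI conjI; elim CollectE conjE)
        assume v: "\<forall>x\<in>set xs. \<omega> \<in> vacant n x"
        have "Y \<omega> \<inter> S n x = {}" if "x \<in> set xs" for x
        proof -
          have "finite (Y \<omega> \<inter> S n x)" by (rule finite_subset[OF _ elim]) (use that in blast)
          moreover have "card (Y \<omega> \<inter> S n x) = 0" using v that by (simp add: vacant_def)
          ultimately show ?thesis by simp
        qed
        then have "Y \<omega> \<inter> ?U = {}" by blast
        then show "card (Y \<omega> \<inter> ?U) = 0" by simp
      qed
    qed
    show "{\<omega> \<in> space M. card (Y \<omega> \<inter> ?U) = 0} \<in> events" by (rule count_zero_events[OF Union_S_Q])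
  qed
  also have "\<dots> = void n xs" unfolding void_def by (rule void_prob[OF Union_S_Q])
  finally show ?thesis .
qed

text \<open>The factor gained from a new point at distance r: the void probability of the sets that
  contain it at the given depth and whose diameter runs from 2^-n up to r, with r clipped to
  [2^-n, 1].\<close>

definition w :: "nat \<Rightarrow> real \<Rightarrow> real" where
  "w n r = (2 powr (- real n) / max (2 powr (- real n)) (min r 1)) powr mass"

lemma w_nonneg: "0 \<le> w n r" by (simp add: w_def)

lemma exp_size_set:
  assumes "b = max (2 powr (- real n)) (min r 1)"
  shows "exp (- measure Q (size_set \<beta> (2 powr (- real n)) b q)) = w n r"
proof -
  have b: "2 powr (- real n) \<le> b" "0 < 2 powr (- real n)" using assms by auto
  then have "0 < b" by linarith
  have "exp (- measure Q (size_set \<beta> (2 powr (- real n)) b q)) = exp (mass * - ln (b / 2 powr (- real n)))"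
    using size_set_Q(3)[OF b(2,1)] by (simp add: mult.commute)
  also have "- ln (b / 2 powr (- real n)) = ln (2 powr (- real n) / b)"
    using \<open>0 < b\<close> b(2) by (simp add: ln_div)
  also have "exp (mass * ln (2 powr (- real n) / b)) = w n r"
    using \<open>0 < b\<close> assms by (simp add: w_def powr_def)
  finally show ?thesis .
qed

lemma void_single: "void n [x] = 2 powr (- mass * real n)"
proof -
  have "void n [x] = exp (- (ln (1 / 2 powr (- real n)) * mass))"
    unfolding void_def using size_set_Q(3)[of "2 powr (- real n)" 1 x] powr_neg_le_1[of n] by (simp add: S_def)
  also have "ln (1 / 2 powr (- real n)) = real n * ln 2" by (simp add: ln_div ln_powr)
  also have "exp (- (real n * ln 2 * mass)) = 2 powr (- mass * real n)" by (simp add: powr_def mult_ac)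
  finally show ?thesis .
qed

text \<open>A set that contains \<^term>\<open>x\<close> and is smaller than the distance to the nearest of the other points
  contains none of them, so it contributes to the union independently of them.\<close>

lemma void_Cons:
  assumes "xs \<noteq> []"
  shows "void n (x # xs) \<le> void n xs * (\<Sum>y\<leftarrow>xs. w n (dist x y))"
proof -
  obtain y where y: "y \<in> set xs" "\<And>y'. y' \<in> set xs \<Longrightarrow> dist x y \<le> dist x y'"
  proof -
    have "finite (set xs)" "set xs \<noteq> {}" using assms by auto
    from arg_min_if_finite[OF this, of "dist x"] show ?thesis
      using that[of "arg_min_on (dist x) (set xs)"] by (metis not_le)
  qed
  define b where "b = max (2 powr (- real n)) (min (dist x y) 1)"
  let ?T = "size_set \<beta> (2 powr (- real n)) b x" and ?U = "\<Union>y\<in>set xs. S n y"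
  have b: "2 powr (- real n) \<le> b" "b \<le> 1" using powr_neg_le_1[of n] by (auto simp: b_def)
  have T: "?T \<in> sets Q" "emeasure Q ?T < \<infinity>" using size_set_Q[of "2 powr (- real n)" b x] b by auto
  have TS: "?T \<subseteq> S n x" using b by (auto simp: size_set_def S_def)
  have disj: "?T \<inter> ?U = {}"
  proof (rule equals0I)
    fix K assume "K \<in> ?T \<inter> ?U"
    then obtain y' where K: "y' \<in> set xs" "K \<in> ?T" "K \<in> S n y'" by blast
    have c: "compact K" "2 powr (- real n) \<le> diameter K" "diameter K < b" "cball x (\<beta> * diameter K) \<subseteq> K" "cball y' (\<beta> * diameter K) \<subseteq> K"
      using K by (auto simp: size_set_def S_def)
    have "0 \<le> \<beta> * diameter K" using \<beta> diameter_ge_0[OF compact_imp_bounded[OF c(1)]] by simp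
    then have "x \<in> K" "y' \<in> K" using c by auto
    then have "dist x y' \<le> diameter K" by (intro diameter_bounded_bound compact_imp_bounded c)
    moreover have "diameter K < dist x y" using c(2,3) by (auto simp: b_def)
    ultimately show False using y(2)[OF K(1)] by linarith
  qed
  have "measure Q ?U + measure Q ?T = measure Q (?U \<union> ?T)"
    using disj T Union_S_Q[where xs=xs and n=n] by (intro measure_Union[symmetric]) auto
  also have "\<dots> \<le> measure Q (\<Union>y\<in>set (x # xs). S n y)"
    using TS T Union_S_Q[where xs="x # xs" and n=n] Union_S_Q[where xs=xs and n=n]
    by (intro measure_mono_fmeasurable) (auto simp: fmeasurable_def)
  finally have "void n (x # xs) \<le> exp (- measure Q ?U + - measure Q ?T)" by (simp add: void_def)
  also have "\<dots> = void n xs * w n (dist x y)" unfolding exp_add exp_size_set[OF b_def] by (simp add: void_def)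
  \<comment> \<open>Which point is nearest depends on \<open>x\<close>. Bounding its factor by the
    sum over all points makes it possible to sum over \<open>x\<close> for each \<open>y\<close>
    separately.\<close>
  also have "\<dots> \<le> void n xs * (\<Sum>y\<leftarrow>xs. w n (dist x y))"
  proof (intro mult_left_mono)
    show "w n (dist x y) \<le> (\<Sum>y\<leftarrow>xs. w n (dist x y))"
      using y(1) w_nonneg by (intro member_le_sum_list) auto
  qed (simp add: void_def)
  finally show ?thesis .
qed

text \<open>Each new point multiplies the sum by at most D times the number of old points, whence
  the factorial. The first point has no neighbour and is paid for by the bound on
  \<open>card I\<close>.\<close>

lemma sum_void_le:
  fixes pos :: "'i \<Rightarrow> 'a"
  assumes I: "finite I" and D: "0 \<le> D" "\<And>i. i \<in> I \<Longrightarrow> (\<Sum>x\<in>I. w n (dist (pos x) (pos i))) \<le> D"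
    "real (card I) * 2 powr (- mass * real n) \<le> D"
  shows "(\<Sum>xs\<in>{xs. set xs \<subseteq> I \<and> length xs = p}. void n (map pos xs)) \<le> fact p * D ^ p"
proof (induction p)
  case 0
  have "{xs. set xs \<subseteq> I \<and> length xs = 0} = {[]}" by auto
  then show ?case by (simp add: void_def)
next
  case (Suc p)
  have "(\<Sum>xs\<in>{xs. set xs \<subseteq> I \<and> length xs = Suc p}. void n (map pos xs))
    = (\<Sum>xs\<in>{xs. set xs \<subseteq> I \<and> length xs = p}. \<Sum>x\<in>I. void n (pos x # map pos xs))"
    unfolding sum_lists_Suc[OF I] by simp
  also have "\<dots> \<le> (\<Sum>xs\<in>{xs. set xs \<subseteq> I \<and> length xs = p}. void n (map pos xs) * (real (Suc p) * D))"
  proof (intro sum_mono)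
    fix xs assume xs: "xs \<in> {xs. set xs \<subseteq> I \<and> length xs = p}"
    have v0: "0 \<le> void n (map pos xs)" by (simp add: void_def)
    show "(\<Sum>x\<in>I. void n (pos x # map pos xs)) \<le> void n (map pos xs) * (real (Suc p) * D)"
    proof (cases "xs = []")
      case True
      have "(\<Sum>x\<in>I. void n (pos x # map pos xs)) = real (card I) * 2 powr (- mass * real n)"
        using True by (simp add: void_single)
      also have "\<dots> \<le> 1 * (1 * D)" using D by simp
      also have "\<dots> = void n (map pos xs) * (real (Suc p) * D)" using xs True by (simp add: void_def)
      finally show ?thesis .
    next
      case False
      have "(\<Sum>x\<in>I. void n (pos x # map pos xs)) \<le> (\<Sum>x\<in>I. void n (map pos xs) * (\<Sum>y\<leftarrow>map pos xs. w n (dist (pos x) y)))"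
        using False by (intro sum_mono void_Cons) simp
      also have "\<dots> = void n (map pos xs) * (\<Sum>y\<leftarrow>xs. \<Sum>x\<in>I. w n (dist (pos x) (pos y)))"
      proof -
        have "(\<Sum>x\<in>I. \<Sum>y\<leftarrow>ys. w n (dist (pos x) (pos y))) = (\<Sum>y\<leftarrow>ys. \<Sum>x\<in>I. w n (dist (pos x) (pos y)))" for ys
          by (induction ys) (auto simp: sum.distrib)
        then show ?thesis by (simp add: sum_distrib_left[symmetric] o_def)
      qed
      also have "\<dots> \<le> void n (map pos xs) * (\<Sum>y\<leftarrow>xs. D)"
        using xs by (intro mult_left_mono v0 sum_list_mono D(2)) auto
      also have "(\<Sum>y\<leftarrow>xs. D) = real p * D" using xs by (simp add: sum_list_triv)
      also have "void n (map pos xs) * (real p * D) \<le> void n (map pos xs) * (real (Suc p) * D)"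
        using D(1) by (intro mult_left_mono mult_right_mono v0) auto
      finally show ?thesis .
    qed
  qed
  also have "\<dots> = (\<Sum>xs\<in>{xs. set xs \<subseteq> I \<and> length xs = p}. void n (map pos xs)) * (real (Suc p) * D)"
    by (simp add: sum_distrib_right)
  also have "\<dots> \<le> (fact p * D ^ p) * (real (Suc p) * D)" using D(1) by (intro mult_right_mono Suc) auto
  finally show ?case by (simp add: mult_ac)
qed

section \<open>Moments of the number of vacant points\<close>

definition T :: "nat \<Rightarrow> 'i set \<Rightarrow> ('i \<Rightarrow> 'a) \<Rightarrow> 'v \<Rightarrow> real" where
  "T n I pos \<omega> = (\<Sum>i\<in>I. indicator (vacant n (pos i)) \<omega>)"

lemma T_measurable: "T n I pos \<in> borel_measurable M"
  unfolding T_def using vacant_events by (intro borel_measurable_sum borel_measurable_indicator) auto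

lemma T_nonneg: "0 \<le> T n I pos \<omega>"
  unfolding T_def by (intro sum_nonneg) auto

text \<open>Markov's inequality for the p-th power: the power of the count is a sum over lists of p
  indices of the indicator that all their points are vacant.\<close>

lemma prob_T_ge:
  assumes I: "finite I" and D: "0 \<le> D" "\<And>i. i \<in> I \<Longrightarrow> (\<Sum>x\<in>I. w n (dist (pos x) (pos i))) \<le> D"
    "real (card I) * 2 powr (- mass * real n) \<le> D" and l: "0 < l"
  shows "measure M {\<omega> \<in> space M. l \<le> T n I pos \<omega>} \<le> fact p * (D / l) ^ p"
proof -
  let ?L = "{xs. set xs \<subseteq> I \<and> length xs = p}"
  have fL: "finite ?L" by (rule finite_lists_length_eq[OF I])
  define E where "E xs = {\<omega> \<in> space M. \<forall>x\<in>set (map pos xs). \<omega> \<in> vacant n x}" for xs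
  have E: "E xs \<in> events" for xs
    unfolding E_def using vacant_events by (intro sets.sets_Collect_finite_All) (auto simp: Int_def[symmetric] vacant_def)
  have pow: "T n I pos \<omega> ^ p = (\<Sum>xs\<in>?L. indicator (E xs) \<omega>)" if \<omega>: "\<omega> \<in> space M" for \<omega>
  proof -
    have "prod_list (map (\<lambda>i. indicator (vacant n (pos i)) \<omega> :: real) xs) = indicator (E xs) \<omega>" for xs
      using \<omega> by (induction xs) (auto simp: E_def indicator_def)
    then show ?thesis unfolding T_def power_sum_lists[OF I] by simp
  qed
  have int: "integrable M (\<lambda>\<omega>. \<Sum>xs\<in>?L. indicator (E xs) \<omega> :: real)"
    using E by (intro Bochner_Integration.integrable_sum integrable_real_indicator) (auto simp: emeasure_eq_measure)
  have "{\<omega> \<in> space M. l \<le> T n I pos \<omega>} \<subseteq> {\<omega> \<in> space M. l ^ p \<le> (\<Sum>xs\<in>?L. indicator (E xs) \<omega> :: real)}"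
    using l by (auto simp: pow[symmetric] intro!: power_mono)
  then have "measure M {\<omega> \<in> space M. l \<le> T n I pos \<omega>} \<le> measure M {\<omega> \<in> space M. l ^ p \<le> (\<Sum>xs\<in>?L. indicator (E xs) \<omega> :: real)}"
    using borel_measurable_integrable[OF int] by (intro finite_measure_mono) auto
  also have "\<dots> \<le> (\<integral>\<omega>. (\<Sum>xs\<in>?L. indicator (E xs) \<omega>) \<partial>M) / l ^ p"
    by (rule integral_Markov_inequality_measure[OF int, of "{}"]) (use l in \<open>auto intro!: sum_nonneg\<close>)
  also have "(\<integral>\<omega>. (\<Sum>xs\<in>?L. indicator (E xs) \<omega>) \<partial>M) = (\<Sum>xs\<in>?L. measure M (E xs))"
    using E by (subst Bochner_Integration.integral_sum) (auto simp: emeasure_eq_measure)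
  also have "\<dots> \<le> (\<Sum>xs\<in>?L. void n (map pos xs))"
    unfolding E_def by (intro sum_mono prob_vacant_list)
  also have "\<dots> \<le> fact p * D ^ p" by (rule sum_void_le[OF I D])
  finally show ?thesis using l by (simp add: divide_right_mono power_divide)
qed

text \<open>A staircase in the dyadic scale of r dominates \<open>w\<close>, so that sums over a
  grid only need the number of grid points in balls. The last term covers r > 1, where
  \<open>w\<close> is constant.\<close>

lemma w_le_layers:
  "w n r \<le> (\<Sum>l\<le>n. of_bool (r \<le> 2 powr (- real l)) * 2 powr ((real l + 1 - real n) * mass)) + 2 powr (- mass * real n)"
proof (cases "r \<le> 1")
  case False
  then have "w n r = 2 powr (- mass * real n)"
    using powr_neg_le_1[of n] by (simp add: w_def max_def min_def powr_powr mult.commute)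
  then show ?thesis by (simp add: sum_nonneg)
next
  case True
  define L where "L = {l. l \<le> n \<and> r \<le> 2 powr (- real l)}"
  have fL: "finite L" "L \<noteq> {}" using True by (auto simp: L_def intro: exI[of _ 0])
  \<comment> \<open>The finest scale 2^-l with l \<le> n that is at least r; by maximality r exceeds
    2^-(l+1) unless l = n.\<close>
  define l where "l = Max L"
  have l: "l \<le> n" "r \<le> 2 powr (- real l)" using Max_in[OF fL] by (auto simp: l_def L_def)
  define m where "m = max (2 powr (- real n)) (min r 1)"
  have m: "2 powr (- real n) \<le> m" "r \<le> m" using True by (auto simp: m_def min_def)
  have "0 < 2 powr (- real n)" by simp
  then have m0: "0 < m" using m(1) by (rule less_le_trans)
  have nn: "0 \<le> 2 powr (- real n) / m" using m0 by simp
  have wm: "w n r = (2 powr (- real n) / m) powr mass" by (simp add: w_def m_def)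
  have "w n r \<le> 2 powr ((real l + 1 - real n) * mass)"
  proof (cases "l = n")
    case True
    have "2 powr (- real n) / m \<le> 1" using m(1) m0 by (simp add: divide_le_eq_1_pos)
    then have "\<bar>2 powr (- real n) / m\<bar> \<le> 1" using nn by (simp only: abs_of_nonneg)
    then have "w n r \<le> 1" unfolding wm by (rule powr_le1[OF mass_nonneg])
    also have "\<dots> \<le> 2 powr ((real l + 1 - real n) * mass)" using True mass_nonneg by (simp add: ge_one_powr_ge_zero)
    finally show ?thesis .
  next
    case False
    have "Suc l \<notin> L" using Max_ge[OF fL(1), of "Suc l"] by (auto simp: l_def)
    then have r: "2 powr (- real (Suc l)) < r" using False l by (auto simp: L_def)
    have "2 powr (- real n) / m \<le> 2 powr (- real n) / 2 powr (- real (Suc l))"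
      using r m m0 by (intro divide_left_mono mult_pos_pos) auto
    also have "\<dots> = 2 powr (real l + 1 - real n)" unfolding powr_diff[symmetric] by (rule arg_cong[where f="\<lambda>x. 2 powr x"]) simp
    finally have "w n r \<le> (2 powr (real l + 1 - real n)) powr mass"
      unfolding wm by (rule powr_mono2[OF mass_nonneg nn])
    then show ?thesis by (simp add: powr_powr)
  qed
  also have "\<dots> = of_bool (r \<le> 2 powr (- real l)) * 2 powr ((real l + 1 - real n) * mass)" using l by simp
  also have "\<dots> \<le> (\<Sum>l\<le>n. of_bool (r \<le> 2 powr (- real l)) * 2 powr ((real l + 1 - real n) * mass))"
    using l by (intro member_le_sum) auto
  finally show ?thesis by (simp add: add_increasing2)
qed

text \<open>At most a constant times 2^((n - l) k) grid points lie within 2^-l, each weighted by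
  2^((l + 1 - n) mass). As mass \<le> k, every scale contributes at most a constant times 2^((k -
  mass) n); the n + 1 scales produce the linear factor.\<close>

lemma grid_w_sum:
  fixes D :: "'a set" and g :: "'a \<Rightarrow> 'a" and z :: 'a and i :: "'a \<Rightarrow> int" and N n :: nat and B \<kappa> :: real
  assumes g: "orthogonal_transformation g" and D: "D \<subseteq> Basis" and \<kappa>: "0 < \<kappa>" "\<kappa> \<le> 1"
    and a: "mass \<le> real (card D)" and i: "i \<in> PiE D (\<lambda>_. UNIV)"
    and N: "real N \<le> B * 2 ^ n" and B: "1 \<le> B"
  defines "\<delta> \<equiv> \<kappa> * 2 powr (- real n)" and "I \<equiv> PiE D (\<lambda>_. {- int N..int N})"
  defines "pos \<equiv> \<lambda>j. flat_map D g z (\<lambda>b. \<delta> * of_int (j b))"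
  shows "(\<Sum>x\<in>I. w n (dist (pos x) (pos i))) \<le> ((3 / \<kappa>) ^ card D * 2 powr mass + (3 * B) ^ card D) * (real n + 2) * 2 powr ((real (card D) - mass) * real n)"
    and "real (card I) * 2 powr (- mass * real n) \<le> ((3 / \<kappa>) ^ card D * 2 powr mass + (3 * B) ^ card D) * (real n + 2) * 2 powr ((real (card D) - mass) * real n)"
proof -
  let ?k = "card D"
  have fD: "finite D" using D finite_subset finite_Basis by blast
  have fI: "finite I" unfolding I_def using fD by (intro finite_PiE) auto
  have \<delta>: "\<delta> > 0" using \<kappa> by (simp add: \<delta>_def)
  define P where "P = 2 powr ((real ?k - mass) * real n)"
  have P: "P > 0" by (simp add: P_def)
  define A1 A2 where "A1 = (3 / \<kappa>) ^ ?k * 2 powr mass" and "A2 = (3 * B) ^ ?k"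
  have A: "0 < A1" "0 < A2" using \<kappa> B by (simp_all add: A1_def A2_def)
  have cardI: "real (card I) * 2 powr (- mass * real n) \<le> (3 * B) ^ ?k * P"
  proof -
    have "real (card I) = (2 * real N + 1) ^ ?k" unfolding I_def using fD by (simp add: card_PiE)
    also have "\<dots> \<le> (3 * B * 2 ^ n) ^ ?k"
    proof (intro power_mono)
      have "1 * 1 \<le> B * 2 ^ n" using B by (intro mult_mono) auto
      then show "2 * real N + 1 \<le> 3 * B * 2 ^ n" using N by simp
    qed auto
    also have "\<dots> = (3 * B) ^ ?k * 2 powr (real ?k * real n)"
      by (simp add: power_mult_distrib powr_realpow[symmetric] powr_powr mult.commute)
    finally have "real (card I) * 2 powr (- mass * real n) \<le> (3 * B) ^ ?k * 2 powr (real ?k * real n) * 2 powr (- mass * real n)"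
      by (intro mult_right_mono) auto
    also have "\<dots> = (3 * B) ^ ?k * P" unfolding P_def by (simp add: mult.assoc powr_add[symmetric] algebra_simps)
    finally show ?thesis .
  qed
  have count: "real (card {x \<in> I. dist (pos x) (pos i) \<le> 2 powr (- real l)}) \<le> (3 / \<kappa> * 2 powr (real n - real l)) ^ ?k"
    if l: "l \<le> n" for l
  proof -
    define f where "f = \<lfloor>2 powr (- real l) / \<delta>\<rfloor>"
    have eq: "2 powr (- real l) / \<delta> = 2 powr (real n - real l) / \<kappa>"
      by (simp add: \<delta>_def powr_diff powr_minus field_simps)
    have "0 \<le> 2 powr (- real l) / \<delta>" using \<delta> by simp
    then have f: "of_int f \<le> 2 powr (real n - real l) / \<kappa>" "0 \<le> f"
      using of_int_floor_le[of "2 powr (- real l) / \<delta>"] unfolding eq[symmetric] f_def by simp_all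
    have "{x \<in> I. dist (pos x) (pos i) \<le> 2 powr (- real l)} \<subseteq> PiE D (\<lambda>b. {i b - f..i b + f})"
    proof
      fix x assume x: "x \<in> {x \<in> I. dist (pos x) (pos i) \<le> 2 powr (- real l)}"
      have "x b \<in> {i b - f..i b + f}" if b: "b \<in> D" for b
      proof -
        have "\<bar>\<delta> * of_int (x b) - \<delta> * of_int (i b)\<bar> \<le> 2 powr (- real l)"
          using abs_coord_le_flat_dist[OF g D b, of "\<lambda>b. \<delta> * of_int (x b)" "\<lambda>b. \<delta> * of_int (i b)" z] x by (simp add: pos_def)
        then have "\<delta> * \<bar>of_int (x b) - of_int (i b)\<bar> \<le> 2 powr (- real l)"
          using \<delta> by (simp add: abs_mult right_diff_distrib[symmetric])
        then have "of_int \<bar>x b - i b\<bar> \<le> 2 powr (- real l) / \<delta>"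
          using \<delta> by (simp add: pos_le_divide_eq mult.commute)
        then have "\<bar>x b - i b\<bar> \<le> f" unfolding f_def by (simp only: le_floor_iff)
        then show ?thesis unfolding atLeastAtMost_iff by linarith
      qed
      moreover have "x \<in> extensional D" using x by (simp add: I_def PiE_iff)
      ultimately show "x \<in> PiE D (\<lambda>b. {i b - f..i b + f})" unfolding PiE_iff by blast
    qed
    then have "card {x \<in> I. dist (pos x) (pos i) \<le> 2 powr (- real l)} \<le> card (PiE D (\<lambda>b. {i b - f..i b + f}))"
      using fD by (intro card_mono finite_PiE) auto
    also have "\<dots> = nat (2 * f + 1) ^ ?k" using fD by (simp add: card_PiE algebra_simps)
    finally have "real (card {x \<in> I. dist (pos x) (pos i) \<le> 2 powr (- real l)}) \<le> real (nat (2 * f + 1)) ^ ?k"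
      by (simp flip: of_nat_power)
    also have "\<dots> \<le> (3 / \<kappa> * 2 powr (real n - real l)) ^ ?k"
    proof (intro power_mono)
      have "1 \<le> 2 powr (real n - real l)" using l by (simp add: ge_one_powr_ge_zero)
      also have "\<dots> \<le> 2 powr (real n - real l) / \<kappa>" using \<kappa> by (simp add: pos_le_divide_eq mult_left_le)
      finally have "2 * of_int f + 1 \<le> 3 * (2 powr (real n - real l) / \<kappa>)" using f by linarith
      then show "real (nat (2 * f + 1)) \<le> 3 / \<kappa> * 2 powr (real n - real l)" using f(2) by simp
    qed simp
    finally show ?thesis .
  qed
  have "(\<Sum>x\<in>I. w n (dist (pos x) (pos i))) \<le> (\<Sum>x\<in>I. (\<Sum>l\<le>n. of_bool (dist (pos x) (pos i) \<le> 2 powr (- real l)) * 2 powr ((real l + 1 - real n) * mass)) + 2 powr (- mass * real n))"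
    by (intro sum_mono w_le_layers)
  also have "\<dots> = (\<Sum>l\<le>n. real (card {x \<in> I. dist (pos x) (pos i) \<le> 2 powr (- real l)}) * 2 powr ((real l + 1 - real n) * mass)) + real (card I) * 2 powr (- mass * real n)"
  proof -
    have "(\<Sum>x\<in>I. \<Sum>l\<le>n. of_bool (dist (pos x) (pos i) \<le> 2 powr (- real l)) * 2 powr ((real l + 1 - real n) * mass))
      = (\<Sum>l\<le>n. \<Sum>x\<in>I. of_bool (dist (pos x) (pos i) \<le> 2 powr (- real l)) * 2 powr ((real l + 1 - real n) * mass))"
      by (rule sum.swap)
    also have "\<dots> = (\<Sum>l\<le>n. real (card {x \<in> I. dist (pos x) (pos i) \<le> 2 powr (- real l)}) * 2 powr ((real l + 1 - real n) * mass))"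
      using fI by (intro sum.cong refl) (simp add: sum_distrib_right[symmetric] sum.If_cases Int_def of_bool_def)
    finally show ?thesis by (simp add: sum.distrib)
  qed
  also have "\<dots> \<le> (\<Sum>l\<le>n. (3 / \<kappa>) ^ ?k * 2 powr mass * P) + (3 * B) ^ ?k * P"
  proof (intro add_mono sum_mono cardI)
    fix l assume "l \<in> {..n}"
    then have l: "l \<le> n" by simp
    have "real (card {x \<in> I. dist (pos x) (pos i) \<le> 2 powr (- real l)}) * 2 powr ((real l + 1 - real n) * mass)
       \<le> (3 / \<kappa> * 2 powr (real n - real l)) ^ ?k * 2 powr ((real l + 1 - real n) * mass)"
      by (intro mult_right_mono count l) auto
    also have "\<dots> = (3 / \<kappa>) ^ ?k * 2 powr ((real n - real l) * real ?k + (real l + 1 - real n) * mass)"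
      by (simp add: power_mult_distrib power_divide powr_power powr_add mult_ac)
    also have "\<dots> \<le> (3 / \<kappa>) ^ ?k * 2 powr (mass + (real ?k - mass) * real n)"
    proof (intro mult_left_mono powr_mono)
      have "(real n - real l) * real ?k + (real l + 1 - real n) * mass = mass + (real ?k - mass) * (real n - real l)"
        by (simp add: algebra_simps)
      also have "\<dots> \<le> mass + (real ?k - mass) * real n" using a by (intro add_left_mono mult_left_mono) auto
      finally show "(real n - real l) * real ?k + (real l + 1 - real n) * mass \<le> mass + (real ?k - mass) * real n" .
    qed (use \<kappa> in auto)
    finally show "real (card {x \<in> I. dist (pos x) (pos i) \<le> 2 powr (- real l)}) * 2 powr ((real l + 1 - real n) * mass) \<le> (3 / \<kappa>) ^ ?k * 2 powr mass * P"
      by (simp add: P_def powr_add mult_ac)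
  qed
  also have "\<dots> = ((3 / \<kappa>) ^ ?k * 2 powr mass) * (real n + 1) * P + (3 * B) ^ ?k * P"
    by (simp add: algebra_simps)
  also have "\<dots> = (A1 * (real n + 1) + A2) * P" by (simp add: A1_def A2_def distrib_right)
  also have "\<dots> \<le> (A1 + A2) * (real n + 2) * P"
  proof (intro mult_right_mono)
    have "0 \<le> A1" "0 \<le> A2 * real n" "0 \<le> A2" using A by simp_all
    then show "A1 * (real n + 1) + A2 \<le> (A1 + A2) * (real n + 2)" by (simp add: algebra_simps)
  qed (use P in simp)
  finally show "(\<Sum>x\<in>I. w n (dist (pos x) (pos i))) \<le> ((3 / \<kappa>) ^ card D * 2 powr mass + (3 * B) ^ card D) * (real n + 2) * 2 powr ((real (card D) - mass) * real n)"
    unfolding P_def A1_def A2_def .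
  have "real (card I) * 2 powr (- mass * real n) \<le> A2 * P" using cardI by (simp only: A2_def)
  also have "\<dots> \<le> (A1 + A2) * (real n + 2) * P"
  proof (intro mult_right_mono)
    have "0 \<le> A1 * (real n + 2)" "0 \<le> A2 * real n" "0 \<le> A2" using A by simp_all
    moreover have "(A1 + A2) * (real n + 2) = A1 * (real n + 2) + A2 * real n + 2 * A2" by (simp add: algebra_simps)
    ultimately show "A2 \<le> (A1 + A2) * (real n + 2)" by linarith
  qed (use P in simp)
  finally show "real (card I) * 2 powr (- mass * real n) \<le> ((3 / \<kappa>) ^ card D * 2 powr mass + (3 * B) ^ card D) * (real n + 2) * 2 powr ((real (card D) - mass) * real n)"
    unfolding P_def A1_def A2_def .
qed

text \<open>A removed set of diameter at least 2^-n that contains x at relative depth \<beta>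
  swallows the ball of radius \<beta> 2^-n around x. No point of the intersection, hence none of its
  closure, is closer to x than that.\<close>

lemma nbhd_vacant:
  assumes \<omega>: "\<omega> \<in> space M" and x: "x \<in> open_nbhd (closure (\<Inter>m. cutout_A \<Omega> Y m \<omega>)) (\<beta> * 2 powr (- real n))"
  shows "\<omega> \<in> vacant n x"
proof -
  let ?A = "\<Inter>m. cutout_A \<Omega> Y m \<omega>"
  obtain a where a: "a \<in> closure ?A" "dist x a < \<beta> * 2 powr (- real n)" using x by (auto simp: open_nbhd_def)
  then have "0 < \<beta> * 2 powr (- real n) - dist x a" by simp
  then obtain a' where a': "a' \<in> ?A" "dist a' a < \<beta> * 2 powr (- real n) - dist x a"
    using a(1) unfolding closure_approachable by blast
  have d: "dist x a' < \<beta> * 2 powr (- real n)"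
    using a'(2) dist_triangle[of x a' a] by (simp add: dist_commute)
  have "Y \<omega> \<inter> S n x = {}"
  proof (rule equals0I)
    fix K assume "K \<in> Y \<omega> \<inter> S n x"
    then have K: "K \<in> Y \<omega>" "2 powr (- real n) \<le> diameter K" "diameter K < 1" "cball x (\<beta> * diameter K) \<subseteq> K"
      by (auto simp: S_def size_set_def)
    have "\<beta> * 2 powr (- real n) \<le> \<beta> * diameter K" using K(2) \<beta> by (intro mult_left_mono)
    then have "a' \<in> K" using d K(4) by auto
    moreover have "a' \<in> cutout_A \<Omega> Y n \<omega>" using a'(1) by blast
    ultimately show False using K by (auto simp: cutout_A_def)
  qed
  then show ?thesis using \<omega> by (simp add: vacant_def)
qed

end

section \<open>Slices of the cutout set\<close>

context cutout
begin

text \<open>Grid cells meeting the neighbourhood on an arbitrary plane are matched with vacant grid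
  points on a nearby plane of the net. The total displacement stays below \<beta> 2^-n: a quarter of
  this is reserved for the grid, a quarter for the net and half for the distance to the limit set.
  Of the 2\<epsilon> one goes into the union bound and one into the linear factor.\<close>

lemma hausdorff_slices:
  fixes D :: "'a set" and \<Omega> :: "'a set" and \<epsilon> :: real
  assumes \<beta>0: "0 < \<beta>" and D: "D \<subseteq> Basis" and D1: "1 \<le> card D" and a: "mass \<le> real (card D)"
    and \<Omega>: "bounded \<Omega>" and \<epsilon>: "0 < \<epsilon>"
  shows "\<exists>K\<in>borel_measurable M. (\<forall>\<omega>. 0 \<le> K \<omega>) \<and> (AE \<omega> in M. \<forall>V\<in>affine_planes (card D). \<forall>m.
      hausdorff_measure (card D) (open_nbhd (closure (\<Inter>m. cutout_A \<Omega> Y m \<omega>)) (2 powr (- real m)) \<inter> V)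
        \<le> ennreal (K \<omega> * 2 powr ((2 * \<epsilon> - mass) * real m)))"
proof -
  let ?k = "card D"
  have k0: "real ?k \<ge> 1" using D1 by simp
  obtain B0 where B0: "B0 > 0" "\<Omega> \<subseteq> ball 0 B0" using bounded_subset_ballD[OF \<Omega>, of 0] by auto
  define R where "R = B0 + 2"
  have R: "1 \<le> R" using B0 by (simp add: R_def)
  \<comment> \<open>Bounds the distance from the base point to a grid point whose cell meets
    \<open>E2\<close>: at most 2R, and 1 for the cell.\<close>
  define B' where "B' = 2 * R + 1"
  have B': "B' > 0" using R by (simp add: B'_def)
  \<comment> \<open>Grid constant: images of cells have diameter at most a quarter of \<beta> 2^-n,
    and at most 1.\<close>
  define \<kappa> where "\<kappa> = min (1 / real ?k) (\<beta> / (4 * real ?k))"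
  have \<kappa>: "0 < \<kappa>" "\<kappa> \<le> 1" "real ?k * \<kappa> \<le> 1" "real ?k * \<kappa> \<le> \<beta> / 4"
  proof -
    show "0 < \<kappa>" using \<beta>0 k0 by (simp add: \<kappa>_def)
    have "\<kappa> \<le> 1 / real ?k" "\<kappa> \<le> \<beta> / (4 * real ?k)" by (auto simp: \<kappa>_def)
    then show "real ?k * \<kappa> \<le> 1" "real ?k * \<kappa> \<le> \<beta> / 4" using k0 by (auto simp: field_simps)
    have "1 / real ?k \<le> 1" using k0 by simp
    then show "\<kappa> \<le> 1" using \<open>\<kappa> \<le> 1 / real ?k\<close> by linarith
  qed
  \<comment> \<open>Net constant: for points within B' of the base point, passing to the net plane
    costs at most a quarter of \<beta> 2^-n.\<close>
  define \<kappa>' where "\<kappa>' = min 1 (\<beta> / (4 * (B' + 1)))"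
  have \<kappa>': "0 < \<kappa>'" "\<kappa>' \<le> 1" "\<kappa>' * (B' + 1) \<le> \<beta> / 4"
  proof -
    show "0 < \<kappa>'" "\<kappa>' \<le> 1" using \<beta>0 B' by (auto simp: \<kappa>'_def)
    have "\<kappa>' \<le> \<beta> / (4 * (B' + 1))" by (auto simp: \<kappa>'_def)
    then show "\<kappa>' * (B' + 1) \<le> \<beta> / 4" using B' by (simp add: field_simps)
  qed
  define q where "q n = 2 powr (- real n)" for n
  have q: "0 < q n" "q n \<le> 1" for n using powr_neg_le_1[of n] by (auto simp: q_def)
  define \<delta> where "\<delta> n = \<kappa> * q n" for n
  have \<delta>: "\<delta> n > 0" for n using \<kappa> q by (simp add: \<delta>_def)
  have k\<delta>: "real ?k * \<delta> n \<le> \<beta> / 4 * q n" "real ?k * \<delta> n \<le> 1" for n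
  proof -
    show "real ?k * \<delta> n \<le> \<beta> / 4 * q n" using mult_right_mono[OF \<kappa>(4), of "q n"] q[of n] by (simp add: \<delta>_def mult.assoc)
    have "real ?k * \<delta> n \<le> 1 * q n" using mult_right_mono[OF \<kappa>(3), of "q n"] q[of n] by (simp add: \<delta>_def mult.assoc)
    then show "real ?k * \<delta> n \<le> 1" using q(2)[of n] by linarith
  qed
  define e where "e n = \<kappa>' * q n" for n
  have e: "0 < e n" "e n \<le> 1" for n using \<kappa>' q[of n] by (auto simp: e_def mult_le_one)
  define N where "N n = nat \<lceil>B' / \<delta> n\<rceil>" for n
  define B where "B = B' / \<kappa> + 1"
  have B: "1 \<le> B" using B' \<kappa> by (simp add: B_def)
  have N: "B' / \<delta> n \<le> real (N n)" "real (N n) \<le> B * 2 ^ n" for n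
  proof -
    show "B' / \<delta> n \<le> real (N n)" unfolding N_def by linarith
    have "0 \<le> B' / \<delta> n" using B' \<delta>[of n] by simp
    then have "real (N n) \<le> B' / \<delta> n + 1" unfolding N_def by linarith
    also have "B' / \<delta> n = B' / \<kappa> * 2 ^ n" by (simp add: \<delta>_def q_def powr_minus powr_realpow field_simps)
    also have "B' / \<kappa> * 2 ^ n + 1 \<le> B * 2 ^ n" by (simp add: B_def distrib_right)
    finally show "real (N n) \<le> B * 2 ^ n" by simp
  qed
  define I where "I n = PiE D (\<lambda>_. {- int (N n)..int (N n)})" for n
  define pos where "pos n h j = flat_map D (fst h) (snd h) (\<lambda>b. \<delta> n * of_int (j b))" for n :: nat and h :: "('a \<Rightarrow> 'a) \<times> 'a" and j :: "'a \<Rightarrow> int"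
  have fD: "finite D" using D finite_subset finite_Basis by blast
  have fI: "finite (I n)" for n unfolding I_def using fD by (intro finite_PiE) auto
  define c1 where "c1 = (3 / \<kappa>) ^ ?k * 2 powr mass + (3 * B) ^ ?k"
  have c1: "c1 > 0" using \<kappa> B by (simp add: c1_def add_pos_pos)
  define Dn where "Dn n = c1 * (real n + 2) * 2 powr ((real ?k - mass) * real n)" for n
  have Dn: "Dn n > 0" for n using c1 by (simp add: Dn_def)
  \<comment> \<open>Raising the threshold by 2^(\<epsilon> n) gains 2^(-\<epsilon> p n) in the p-th
    moment bound.\<close>
  define l where "l n = Dn n * 2 powr (\<epsilon> * real n)" for n
  have l: "l n > 0" for n using Dn by (simp add: l_def)
  obtain L :: nat and c :: real where c: "c > 0" and net: "\<And>\<epsilon>. 0 < \<epsilon> \<Longrightarrow> \<epsilon> \<le> 1 \<Longrightarrow>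
      \<exists>H :: (('a \<Rightarrow> 'a) \<times> 'a) set. finite H \<and> real (card H) \<le> c * (1 / \<epsilon>) ^ L \<and> is_flat_net R \<epsilon> H"
    by (rule flat_net[OF R], rule that)
  have "\<forall>n. \<exists>H :: (('a \<Rightarrow> 'a) \<times> 'a) set. finite H \<and> real (card H) \<le> c * (1 / e n) ^ L \<and> is_flat_net R (e n) H"
    using net e by blast
  from choice[OF this] obtain H :: "nat \<Rightarrow> (('a \<Rightarrow> 'a) \<times> 'a) set"
    where H0: "\<forall>n. finite (H n) \<and> real (card (H n)) \<le> c * (1 / e n) ^ L \<and> is_flat_net R (e n) (H n)"
    by (rule exE)
  have H: "finite (H n)" "real (card (H n)) \<le> c * (1 / e n) ^ L" and Hn: "is_flat_net R (e n) (H n)" for n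
    using H0 by blast+
  have Ho: "orthogonal_transformation (fst h)" if "h \<in> H n" for h n
    using Hn[of n] that unfolding is_flat_net_def by blast
  have Hnet: "\<exists>h\<in>H n. (\<forall>x. norm (g x - fst h x) \<le> e n * norm x) \<and> norm (z - snd h) \<le> e n"
    if "orthogonal_transformation g" "norm z \<le> R" for g z n
    using Hn[of n] that unfolding is_flat_net_def by blast
  \<comment> \<open>The net has a constant times 2^(L n) planes; this order leaves a union bound of
    a constant times 2^-n.\<close>
  define p where "p = nat \<lceil>(real L + 1) / \<epsilon>\<rceil>"
  have p: "real L + 1 \<le> \<epsilon> * real p"
  proof -
    have "(real L + 1) / \<epsilon> \<le> real p" unfolding p_def by linarith
    then show ?thesis using \<epsilon> by (simp add: pos_divide_le_eq mult.commute)
  qed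
  define Bad where "Bad n = (\<Union>h\<in>H n. {\<omega> \<in> space M. l n \<le> T n (I n) (pos n h) \<omega>})" for n
  have Bad1: "{\<omega> \<in> space M. l n \<le> T n (I n) (pos n h) \<omega>} \<in> events" for n h
    using T_measurable[measurable] by measurable
  have BadM: "Bad n \<in> events" for n unfolding Bad_def by (rule sets.finite_UN[OF H(1) Bad1])
  have BadP: "measure M (Bad n) \<le> c * (1 / \<kappa>') ^ L * fact p * (1 / 2) ^ n" for n
  proof -
    have "measure M (Bad n) \<le> (\<Sum>h\<in>H n. measure M {\<omega> \<in> space M. l n \<le> T n (I n) (pos n h) \<omega>})"
      unfolding Bad_def by (rule finite_measure_subadditive_finite[OF H(1) image_subsetI[OF Bad1]])
    also have "\<dots> \<le> (\<Sum>h\<in>H n. fact p * (Dn n / l n) ^ p)"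
    proof (intro sum_mono prob_T_ge fI l)
      fix h assume h: "h \<in> H n"
      show "0 \<le> Dn n" using Dn[of n] by simp
      show "real (card (I n)) * 2 powr (- mass * real n) \<le> Dn n"
        unfolding I_def Dn_def c1_def
        by (rule grid_w_sum(2)[OF Ho[OF h] D \<kappa>(1,2) a _ N(2) B, of "\<lambda>b\<in>D. 0"]) simp
      fix i assume "i \<in> I n"
      then have i: "i \<in> PiE D (\<lambda>_. UNIV)" by (auto simp: I_def PiE_iff)
      show "(\<Sum>x\<in>I n. w n (dist (pos n h x) (pos n h i))) \<le> Dn n"
        unfolding I_def Dn_def c1_def pos_def \<delta>_def q_def
        by (rule grid_w_sum(1)[OF Ho[OF h] D \<kappa>(1,2) a i N(2) B])
    qed
    also have "\<dots> = real (card (H n)) * (fact p * (Dn n / l n) ^ p)" by simp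
    also have "\<dots> \<le> c * (1 / e n) ^ L * (fact p * (Dn n / l n) ^ p)"
      using H(2)[of n] Dn[of n] l[of n] by (intro mult_right_mono) auto
    also have "(Dn n / l n) ^ p = 2 powr (- \<epsilon> * real p * real n)"
    proof -
      have "Dn n / l n = 2 powr (- \<epsilon> * real n)" using Dn[of n] by (simp add: l_def powr_minus_divide)
      then show ?thesis by (simp add: powr_power mult_ac)
    qed
    also have "(1 / e n) ^ L = (1 / \<kappa>') ^ L * 2 powr (real L * real n)"
    proof -
      have eq: "1 / e n = 1 / \<kappa>' * 2 powr real n" by (simp add: e_def q_def powr_minus_divide)
      show ?thesis unfolding eq power_mult_distrib by (simp add: powr_power mult.commute)
    qed
    also have "c * ((1 / \<kappa>') ^ L * 2 powr (real L * real n)) * (fact p * 2 powr (- \<epsilon> * real p * real n))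
       = c * (1 / \<kappa>') ^ L * fact p * 2 powr (real L * real n - \<epsilon> * real p * real n)"
      by (simp add: powr_diff powr_minus_divide)
    also have "\<dots> \<le> c * (1 / \<kappa>') ^ L * fact p * 2 powr (- real n)"
    proof (intro mult_left_mono powr_mono)
      have "(real L + 1) * real n \<le> \<epsilon> * real p * real n" using p by (intro mult_right_mono) auto
      then show "real L * real n - \<epsilon> * real p * real n \<le> - real n" by (simp add: algebra_simps)
    qed (use c \<kappa>' in auto)
    also have "2 powr (- real n) = (1 / 2) ^ n" by (simp add: powr_minus_divide powr_realpow power_divide)
    finally show ?thesis .
  qed
  have "summable (\<lambda>n. measure M (Bad n))"
    by (rule summable_comparison_test[of _ "\<lambda>n. c * (1 / \<kappa>') ^ L * fact p * (1 / 2) ^ n"])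
      (use BadP in \<open>auto intro: summable_mult summable_geometric\<close>)
  then have BC: "AE \<omega> in M. eventually (\<lambda>n. \<omega> \<in> space M - Bad n) sequentially"
    by (intro borel_cantelli_AE1 BadM) (auto simp: emeasure_eq_measure)
  \<comment> \<open>A supremum over all levels and net planes, measurable because countable. It is
    finite almost surely, since only finitely many bad events occur.\<close>
  define SX where "SX \<omega> = (SUP n. SUP h\<in>H n. ennreal (T n (I n) (pos n h) \<omega> / l n))" for \<omega>
  have SXm: "SX \<in> borel_measurable M"
  proof -
    have inner: "(\<lambda>\<omega>. SUP h\<in>H n. ennreal (T n (I n) (pos n h) \<omega> / l n)) \<in> borel_measurable M" for n
    proof (rule borel_measurable_SUP)
      show "countable (H n)" using H(1) by (rule countable_finite)
      show "(\<lambda>\<omega>. ennreal (T n (I n) (pos n h) \<omega> / l n)) \<in> borel_measurable M" for h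
        using T_measurable[measurable] by measurable
    qed
    show ?thesis unfolding SX_def[abs_def] by (rule borel_measurable_SUP[OF _ inner]) simp
  qed
  have T_le: "T n (I n) (pos n h) \<omega> \<le> enn2real (SX \<omega>) * l n"
    if ev: "eventually (\<lambda>n. \<omega> \<in> space M - Bad n) sequentially" and h: "h \<in> H n" and \<omega>: "\<omega> \<in> space M" for \<omega> h n
  proof -
    obtain n0 where n0: "\<And>n. n \<ge> n0 \<Longrightarrow> \<omega> \<notin> Bad n" using ev by (auto simp: eventually_sequentially)
    define s where "s = 1 + (\<Sum>n<n0. \<Sum>h\<in>H n. T n (I n) (pos n h) \<omega> / l n)"
    have nn: "0 \<le> T n (I n) (pos n h) \<omega> / l n" for n h
      by (rule divide_nonneg_nonneg[OF T_nonneg less_imp_le[OF l]])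
    have "T n (I n) (pos n h) \<omega> / l n \<le> s" if h: "h \<in> H n" for n h
    proof (cases "n0 \<le> n")
      case True
      then have "T n (I n) (pos n h) \<omega> < l n" using n0[OF True] h \<omega> by (auto simp: Bad_def not_le)
      then have "T n (I n) (pos n h) \<omega> / l n \<le> 1" using l[of n] by simp
      moreover have "0 \<le> (\<Sum>n<n0. \<Sum>h\<in>H n. T n (I n) (pos n h) \<omega> / l n)" by (intro sum_nonneg nn)
      ultimately show ?thesis unfolding s_def by linarith
    next
      case False
      have "T n (I n) (pos n h) \<omega> / l n \<le> (\<Sum>h\<in>H n. T n (I n) (pos n h) \<omega> / l n)"
        using h H(1) nn by (intro member_le_sum) auto
      also have "\<dots> \<le> (\<Sum>n<n0. \<Sum>h\<in>H n. T n (I n) (pos n h) \<omega> / l n)"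
        using False nn by (intro member_le_sum[of n _ "\<lambda>n. \<Sum>h\<in>H n. T n (I n) (pos n h) \<omega> / l n"]) (auto intro!: sum_nonneg)
      finally show ?thesis unfolding s_def by linarith
    qed
    then have "SX \<omega> \<le> ennreal s" unfolding SX_def by (intro SUP_least ennreal_leI)
    then have fin: "SX \<omega> < \<top>" by (rule le_less_trans) simp
    have "ennreal (T n (I n) (pos n h) \<omega> / l n) \<le> SX \<omega>"
      unfolding SX_def by (intro SUP_upper2[of n] SUP_upper2[of h]) (use h in auto)
    also have "SX \<omega> = ennreal (enn2real (SX \<omega>))" using fin by simp
    finally have "T n (I n) (pos n h) \<omega> / l n \<le> enn2real (SX \<omega>)" by (subst (asm) ennreal_le_iff) auto
    then show ?thesis using l[of n] by (simp add: pos_divide_le_eq)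
  qed
  define cU where "cU = unit_ball_vol (real ?k) / 2 ^ ?k * real ?k ^ ?k"
  have cU: "0 \<le> cU" by (simp add: cU_def less_imp_le)
  \<comment> \<open>Twice 2^-m has to fit into half of \<beta> 2^-n, which holds for n = m -
    j0.\<close>
  obtain j0 where j0: "q j0 \<le> \<beta> / 4"
  proof -
    obtain j where "(1 / 2) ^ j < \<beta> / 4" using real_arch_pow_inv[of "\<beta> / 4" "1 / 2"] \<beta>0 by auto
    moreover have "q j = (1 / 2) ^ j" by (simp add: q_def powr_minus_divide powr_realpow power_divide)
    ultimately show ?thesis using that[of j] by simp
  qed
  define c2 where "c2 = 2 + 1 / (\<epsilon> * ln 2)"
  have c2: "c2 > 0" using \<epsilon> by (simp add: c2_def add_pos_pos)
  have lin: "real n + 2 \<le> c2 * 2 powr (\<epsilon> * real n)" for n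
  proof -
    have "1 + \<epsilon> * ln 2 * real n \<le> exp (\<epsilon> * ln 2 * real n)" by (rule exp_ge_add_one_self)
    also have "\<dots> = 2 powr (\<epsilon> * real n)" by (simp add: powr_def mult_ac)
    finally have ex: "1 + \<epsilon> * ln 2 * real n \<le> 2 powr (\<epsilon> * real n)" .
    have "0 \<le> \<epsilon> * ln 2 * real n" using \<epsilon> by simp
    then have "1 \<le> 2 powr (\<epsilon> * real n)" "\<epsilon> * ln 2 * real n \<le> 2 powr (\<epsilon> * real n)" using ex by linarith+
    then have "2 \<le> 2 * 2 powr (\<epsilon> * real n)" "real n \<le> 1 / (\<epsilon> * ln 2) * 2 powr (\<epsilon> * real n)"
      using \<epsilon> by (simp_all add: pos_le_divide_eq mult_ac)
    then show ?thesis unfolding c2_def distrib_right by linarith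
  qed
  define s where "s = 2 * \<epsilon> - mass"
  \<comment> \<open>Compensates the shift from n to m = n + j0 for either sign of \<open>s\<close>,
    and serves for the levels m < j0 as well.\<close>
  define F where "F = 2 powr (\<bar>s\<bar> * real j0)"
  define K where "K \<omega> = (cU * (4 * R) ^ ?k + cU * c1 * c2 * \<kappa> ^ ?k * enn2real (SX \<omega>)) * F" for \<omega>
  have K0: "0 \<le> K \<omega>" for \<omega>
    unfolding K_def F_def using cU R c1 c2 \<kappa> by (intro mult_nonneg_nonneg add_nonneg_nonneg) auto
  have slice: "hausdorff_measure ?k (open_nbhd (closure (\<Inter>m. cutout_A \<Omega> Y m \<omega>)) (2 powr (- real m)) \<inter> V)
        \<le> ennreal (K \<omega> * 2 powr (s * real m))"
    if ev: "eventually (\<lambda>n. \<omega> \<in> space M - Bad n) sequentially" and \<omega>: "\<omega> \<in> space M"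
      and V: "V \<in> affine_planes ?k" for \<omega> V m
  proof -
    define A where "A = closure (\<Inter>m. cutout_A \<Omega> Y m \<omega>)"
    define E where "E = open_nbhd A (q m)"
    define E2 where "E2 = open_nbhd E (q m)"
    have "(\<Inter>m. cutout_A \<Omega> Y m \<omega>) \<subseteq> \<Omega>" by (auto simp: cutout_A_def)
    then have "A \<subseteq> closure (ball 0 B0)" unfolding A_def using B0 by (intro closure_mono) blast
    then have Ab: "A \<subseteq> cball 0 B0" using B0 by (simp add: closure_ball)
    have E2a: "\<exists>a\<in>A. dist x a < 2 * q m" if x: "x \<in> E2" for x
    proof -
      obtain e a where ea: "a \<in> A" "dist e a < q m" "dist x e < q m" using x by (auto simp: E2_def E_def open_nbhd_def)
      then have "dist x a < 2 * q m" using dist_triangle[of x a e] by auto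
      then show ?thesis using ea by blast
    qed
    have E2n: "norm x < R" if x: "x \<in> E2" for x
    proof -
      obtain a where a: "a \<in> A" "dist x a < 2 * q m" using E2a[OF x] by blast
      then have "norm a \<le> B0" using Ab by auto
      then show ?thesis using norm_triangle_sub[of x a] a(2) q(2)[of m] by (simp add: dist_norm R_def)
    qed
    have EE2: "E \<subseteq> E2"
    proof
      fix x assume "x \<in> E"
      then show "x \<in> E2" unfolding E2_def open_nbhd_def using q[of m] by (intro CollectI bexI[of _ x]) auto
    qed
    have bE2: "bounded E2" using E2n by (intro boundedI[of _ R]) (simp add: less_imp_le)
    have bE: "bounded E" by (rule bounded_subset[OF bE2 EE2])
    have E2b: "E2 \<in> sets borel" by (simp add: E2_def open_open_nbhd)
    have "hausdorff_measure ?k (E \<inter> V) \<le> ennreal (K \<omega> * 2 powr (s * real m))"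
    proof (cases "E \<inter> V = {}")
      case True
      then show ?thesis by (simp add: hausdorff_measure_empty[OF D1])
    next
      case False
      then obtain z where z: "z \<in> E" "z \<in> V" by blast
      obtain g where g: "orthogonal_transformation g" and Vg: "V = range (flat_map D g z)"
        using affine_plane_flat_map[OF V z(2) D] .
      have zR: "norm z \<le> R" using E2n z(1) EE2 by (simp add: less_imp_le subset_iff)
      have Hfm: "hausdorff_measure ?k (E \<inter> V) \<le> ennreal cU * emeasure (flat_measure D g z) E2"
        unfolding cU_def E2_def Vg by (rule hausdorff_measure_le_flat_measure[OF g D bE q(1) D1])
      show ?thesis
      proof (cases "j0 \<le> m")
        \<comment> \<open>Only finitely many levels lie below \<open>j0\<close>, and the trivial
          diameter bound suffices for them.\<close>
        case False
        have "emeasure (flat_measure D g z) E2 \<le> ennreal ((2 * (2 * R)) ^ ?k)"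
        proof (rule flat_measure_le_diameter[OF g D E2b])
          fix x y assume "x \<in> E2" "y \<in> E2"
          then have "norm x < R" "norm y < R" using E2n by auto
          then show "dist x y \<le> 2 * R" using norm_triangle_ineq4[of x y] by (simp add: dist_norm)
        qed (use R in simp)
        then have "ennreal cU * emeasure (flat_measure D g z) E2 \<le> ennreal cU * ennreal ((4 * R) ^ ?k)"
          by (intro mult_left_mono) auto
        also have "\<dots> = ennreal (cU * (4 * R) ^ ?k)" using cU R by (simp add: ennreal_mult)
        also have "\<dots> \<le> ennreal (K \<omega> * 2 powr (s * real m))"
        proof (rule ennreal_leI)
          have "1 \<le> F * 2 powr (s * real m)"
          proof -
            have "- s * real m \<le> \<bar>s\<bar> * real m" by (rule mult_right_mono) auto
            then have "- (\<bar>s\<bar> * real m) \<le> s * real m" by simp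
            moreover have "\<bar>s\<bar> * real m \<le> \<bar>s\<bar> * real j0" using False by (intro mult_left_mono) auto
            ultimately have "0 \<le> \<bar>s\<bar> * real j0 + s * real m" by linarith
            then show ?thesis unfolding F_def powr_add[symmetric] by (rule ge_one_powr_ge_zero[rotated]) simp
          qed
          then have "cU * (4 * R) ^ ?k * 1 \<le> cU * (4 * R) ^ ?k * (F * 2 powr (s * real m))"
            using cU R by (intro mult_left_mono) auto
          also have "\<dots> \<le> (cU * (4 * R) ^ ?k + cU * c1 * c2 * \<kappa> ^ ?k * enn2real (SX \<omega>)) * (F * 2 powr (s * real m))"
            using cU c1 c2 \<kappa> by (intro mult_right_mono) (auto simp: F_def)
          finally show "cU * (4 * R) ^ ?k \<le> K \<omega> * 2 powr (s * real m)" by (simp add: K_def mult.assoc)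
        qed
        finally show ?thesis using Hfm by (rule order_trans[rotated])
      next
        case True
        define n where "n = m - j0"
        have mn: "m = n + j0" using True by (simp add: n_def)
        have qm: "q m \<le> \<beta> / 4 * q n"
        proof -
          have "q m = q j0 * q n"
            unfolding q_def powr_add[symmetric] by (rule arg_cong[where f="\<lambda>x. 2 powr x"]) (simp add: mn)
          then show ?thesis using mult_right_mono[OF j0, of "q n"] q(1)[of n] by simp
        qed
        obtain h where h: "h \<in> H n" "\<forall>x. norm (g x - fst h x) \<le> e n * norm x" "norm (z - snd h) \<le> e n"
          using Hnet[OF g zR, of n] by blast
        let ?J = "grid_index D g z (\<delta> n) E2"
        have Jsub: "?J \<subseteq> {j \<in> I n. \<omega> \<in> vacant n (pos n h j)}"
        proof
          fix j assume "j \<in> ?J"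
          then obtain t where j: "j \<in> PiE D (\<lambda>_. UNIV)" and t: "t \<in> grid_cell D (\<delta> n) j" "flat_map D g z t \<in> E2"
            unfolding grid_index_iff[OF \<delta>[of n]] by (elim conjE bexE)
          define u where "u b = \<delta> n * of_int (j b)" for b
          define v where "v = (\<Sum>b\<in>D. u b *\<^sub>R b)"
          have tu: "dist (flat_map D g z t) (flat_map D g z u) \<le> real ?k * \<delta> n"
          proof (rule flat_dist_le[OF g D])
            fix b assume "b \<in> D"
            then have "t b \<in> {\<delta> n * of_int (j b)..<\<delta> n * (of_int (j b) + 1)}" using t(1) by (auto simp: grid_cell_def PiE_iff)
            then show "\<bar>t b - u b\<bar> \<le> \<delta> n" by (auto simp: u_def algebra_simps)
          qed
          have nv: "norm v \<le> B'"
          proof -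
            have "norm v = dist (flat_map D g z u) z"
              by (simp add: flat_map_def v_def dist_norm orthogonal_transformation_norm[OF g])
            also have "\<dots> \<le> dist (flat_map D g z t) (flat_map D g z u) + dist (flat_map D g z t) z" by (rule dist_triangle3)
            also have "\<dots> \<le> 1 + (R + R)"
            proof (intro add_mono)
              show "dist (flat_map D g z t) (flat_map D g z u) \<le> 1" using tu k\<delta>(2)[of n] by linarith
              show "dist (flat_map D g z t) z \<le> R + R"
                using E2n[OF t(2)] zR norm_triangle_ineq4[of "flat_map D g z t" z] by (simp add: dist_norm)
            qed
            finally show ?thesis by (simp add: B'_def)
          qed
          have posj: "pos n h j = flat_map D (fst h) (snd h) u" by (simp add: pos_def u_def[abs_def])
          have gh: "dist (flat_map D g z u) (pos n h j) \<le> e n * (B' + 1)"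
          proof -
            have "dist (flat_map D g z u) (pos n h j) = norm ((g v - fst h v) + (z - snd h))"
              unfolding posj by (simp add: flat_map_def v_def dist_norm algebra_simps)
            also have "\<dots> \<le> norm (g v - fst h v) + norm (z - snd h)" by (rule norm_triangle_ineq)
            also have "\<dots> \<le> e n * norm v + e n" using h by (intro add_mono) auto
            also have "\<dots> \<le> e n * B' + e n" using nv e(1)[of n] by (intro add_mono mult_left_mono) auto
            finally show ?thesis by (simp add: algebra_simps)
          qed
          have eb: "e n * (B' + 1) \<le> \<beta> / 4 * q n"
            using mult_right_mono[OF \<kappa>'(3), of "q n"] q(1)[of n] by (simp add: e_def mult_ac)
          obtain a where a: "a \<in> A" "dist (flat_map D g z t) a < 2 * q m" using E2a[OF t(2)] by blast
          have "dist (pos n h j) a \<le> dist (flat_map D g z u) (pos n h j) + dist (flat_map D g z u) a" by (rule dist_triangle3)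
          also have "dist (flat_map D g z u) a \<le> dist (flat_map D g z t) (flat_map D g z u) + dist (flat_map D g z t) a" by (rule dist_triangle3)
          finally have "dist (pos n h j) a < \<beta> * q n" using gh eb tu k\<delta>(1)[of n] a(2) qm by (simp add: field_simps)
          then have "pos n h j \<in> open_nbhd (closure (\<Inter>m. cutout_A \<Omega> Y m \<omega>)) (\<beta> * 2 powr (- real n))"
            using a(1) unfolding open_nbhd_def A_def q_def by blast
          then have vac: "\<omega> \<in> vacant n (pos n h j)" by (rule nbhd_vacant[OF \<omega>])
          have "j b \<in> {- int (N n)..int (N n)}" if b: "b \<in> D" for b
          proof -
            have "\<bar>u b\<bar> = \<bar>v \<bullet> b\<bar>" unfolding v_def using D b by (simp add: inner_sum_Basis_subset)
            also have "\<dots> \<le> B'" using Basis_le_norm[of b v] D b nv by auto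
            finally have "\<delta> n * of_int \<bar>j b\<bar> \<le> B'" using \<delta>[of n] by (simp add: u_def abs_mult)
            then have "of_int \<bar>j b\<bar> \<le> B' / \<delta> n" using \<delta>[of n] by (simp add: pos_le_divide_eq mult.commute)
            also have "\<dots> \<le> real (N n)" by (rule N(1))
            finally have "\<bar>j b\<bar> \<le> int (N n)" by linarith
            then show ?thesis unfolding atLeastAtMost_iff by linarith
          qed
          then have "j \<in> I n" using j unfolding I_def PiE_iff by blast
          then show "j \<in> {j \<in> I n. \<omega> \<in> vacant n (pos n h j)}" using vac by blast
        qed
        have "real (card ?J) \<le> real (card {j \<in> I n. \<omega> \<in> vacant n (pos n h j)})"
          using Jsub fI[of n] by (intro of_nat_mono card_mono) auto
        also have "\<dots> = T n (I n) (pos n h) \<omega>"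
          unfolding T_def using fI[of n] by (simp add: indicator_def of_bool_def sum.If_cases Int_def)
        also have "\<dots> \<le> enn2real (SX \<omega>) * l n" by (rule T_le[OF ev h(1) \<omega>])
        finally have cardJ: "real (card ?J) \<le> enn2real (SX \<omega>) * l n" .
        have "emeasure (flat_measure D g z) E2 \<le> ennreal (real (card ?J) * \<delta> n ^ ?k)"
          by (rule flat_measure_le_card_grid_index[OF g D \<delta> E2b bE2])
        also have "\<dots> \<le> ennreal (enn2real (SX \<omega>) * l n * \<delta> n ^ ?k)"
          using cardJ \<delta>[of n] by (intro ennreal_leI mult_right_mono) auto
        finally have "ennreal cU * emeasure (flat_measure D g z) E2 \<le> ennreal cU * ennreal (enn2real (SX \<omega>) * l n * \<delta> n ^ ?k)"
          by (rule mult_left_mono) simp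
        also have "\<dots> = ennreal (cU * (enn2real (SX \<omega>) * l n * \<delta> n ^ ?k))"
          using cU l[of n] \<delta>[of n] by (simp add: ennreal_mult less_imp_le)
        also have "\<dots> \<le> ennreal (K \<omega> * 2 powr (s * real m))"
        proof (rule ennreal_leI)
          have "l n * \<delta> n ^ ?k = c1 * \<kappa> ^ ?k * ((real n + 2) * 2 powr ((\<epsilon> - mass) * real n))"
          proof -
            have "2 powr ((real ?k - mass) * real n) * 2 powr (\<epsilon> * real n) * q n ^ ?k = 2 powr ((\<epsilon> - mass) * real n)"
              unfolding q_def by (simp add: powr_power powr_add[symmetric] algebra_simps)
            then show ?thesis by (simp add: l_def Dn_def \<delta>_def power_mult_distrib mult_ac)
          qed
          also have "\<dots> \<le> c1 * \<kappa> ^ ?k * (c2 * 2 powr (s * real n))"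
          proof (intro mult_left_mono)
            have "(real n + 2) * 2 powr ((\<epsilon> - mass) * real n) \<le> c2 * 2 powr (\<epsilon> * real n) * 2 powr ((\<epsilon> - mass) * real n)"
              by (intro mult_right_mono lin) simp
            also have "\<dots> = c2 * 2 powr (s * real n)" by (simp add: s_def mult.assoc powr_add[symmetric] algebra_simps)
            finally show "(real n + 2) * 2 powr ((\<epsilon> - mass) * real n) \<le> c2 * 2 powr (s * real n)" .
          qed (use c1 \<kappa> in simp)
          also have "\<dots> \<le> c1 * \<kappa> ^ ?k * (c2 * (F * 2 powr (s * real m)))"
          proof (intro mult_left_mono)
            have "- (s * real j0) \<le> \<bar>s\<bar> * real j0" using mult_right_mono[of "- s" "\<bar>s\<bar>" "real j0"] by simp
            then have "s * real n \<le> \<bar>s\<bar> * real j0 + s * real m" by (simp add: mn algebra_simps)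
            then show "2 powr (s * real n) \<le> F * 2 powr (s * real m)" unfolding F_def powr_add[symmetric] by (intro powr_mono) auto
          qed (use c1 c2 \<kappa> in auto)
          finally have "cU * enn2real (SX \<omega>) * (l n * \<delta> n ^ ?k) \<le> cU * enn2real (SX \<omega>) * (c1 * \<kappa> ^ ?k * (c2 * (F * 2 powr (s * real m))))"
            using cU by (intro mult_left_mono) auto
          also have "\<dots> = (cU * c1 * c2 * \<kappa> ^ ?k * enn2real (SX \<omega>)) * (F * 2 powr (s * real m))" by (simp add: mult_ac)
          also have "\<dots> \<le> (cU * (4 * R) ^ ?k + cU * c1 * c2 * \<kappa> ^ ?k * enn2real (SX \<omega>)) * (F * 2 powr (s * real m))"
            using cU R by (intro mult_right_mono) (auto simp: F_def)
          finally show "cU * (enn2real (SX \<omega>) * l n * \<delta> n ^ ?k) \<le> K \<omega> * 2 powr (s * real m)" by (simp add: K_def mult_ac)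
        qed
        finally show ?thesis using Hfm by (rule order_trans[rotated])
      qed
    qed
    then show ?thesis by (simp add: E_def A_def q_def)
  qed
  show ?thesis
  proof (intro bexI[of _ K] conjI allI K0)
    show "K \<in> borel_measurable M" unfolding K_def[abs_def] using SXm by measurable
    show "AE \<omega> in M. \<forall>V\<in>affine_planes (card D). \<forall>m.
      hausdorff_measure (card D) (open_nbhd (closure (\<Inter>m. cutout_A \<Omega> Y m \<omega>)) (2 powr (- real m)) \<inter> V)
        \<le> ennreal (K \<omega> * 2 powr ((2 * \<epsilon> - mass) * real m))"
      using BC AE_space unfolding s_def[symmetric]
    proof eventually_elim
      case (elim \<omega>)
      show ?case
      proof (intro ballI allI)
        fix V :: "'a set" and m assume V: "V \<in> affine_planes ?k"
        show "hausdorff_measure ?k (open_nbhd (closure (\<Inter>m. cutout_A \<Omega> Y m \<omega>)) (2 powr (- real m)) \<inter> V)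
          \<le> ennreal (K \<omega> * 2 powr (s * real m))"
          by (rule slice[OF elim V])
      qed
    qed
  qed
qed

end

section \<open>Identification of the exponent and conclusion\<close>

lemma cutout_alpha_eq_core_mass:
  fixes Q0 :: "'a::euclidean_space set measure"
  assumes Q0: "sets Q0 = sets compacts" "finite_measure Q0" and diam: "AE K in Q0. diameter K = 1"
    and pp: "poisson_pp M (cutout_intensity Q0) Y"
    and \<alpha>: "2 powr (- \<alpha>) = measure M {\<omega>\<in>space M.
          (0::'a) \<notin> \<Union>{\<Lambda>\<in>Y \<omega>. 1/2 \<le> diameter \<Lambda> \<and> diameter \<Lambda> < 1}}"
  shows "core_mass Q0 0 = ennreal \<alpha>" "0 \<le> \<alpha>"
proof -
  interpret cutout M Q0 Y 0 by (rule cutout.intro[OF Q0 diam pp order_refl])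
  \<comment> \<open>At depth 0 with diameters in [1/2, 1) the intensity of this family is ln 2 times
    the mass; its void probability 2^(-mass) is the one that defines \<alpha>.\<close>
  let ?S = "size_set 0 (1/2) 1 (0::'a)"
  let ?Z = "{\<omega>\<in>space M. (0::'a) \<notin> \<Union>{\<Lambda>\<in>Y \<omega>. 1/2 \<le> diameter \<Lambda> \<and> diameter \<Lambda> < 1}}"
  have S: "?S \<in> sets Q" "emeasure Q ?S < \<infinity>" "measure Q ?S = ln 2 * mass"
    using size_set_Q[of "1/2" 1 "0::'a"] by auto
  \<comment> \<open>A non-measurable set would have \<open>measure\<close> 0, whereas the value here
    is the positive number 2^(-\<alpha>).\<close>
  have Zm: "?Z \<in> events"
  proof (rule ccontr)
    assume "?Z \<notin> events"
    then have "measure M ?Z = 0" by (rule measure_notin_sets)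
    then show False using \<alpha> by simp
  qed
  have "measure M ?Z = measure M {\<omega> \<in> space M. card (Y \<omega> \<inter> ?S) = 0}"
  proof (rule finite_measure_eq_AE[OF _ Zm count_zero_events[OF S(1,2)]])
    show "AE \<omega> in M. \<omega> \<in> ?Z \<longleftrightarrow> \<omega> \<in> {\<omega> \<in> space M. card (Y \<omega> \<inter> ?S) = 0}"
      using count_finite[OF S(1,2)] AE_space
    proof eventually_elim
      case (elim \<omega>)
      have "(0::'a) \<notin> \<Union>{\<Lambda>\<in>Y \<omega>. 1/2 \<le> diameter \<Lambda> \<and> diameter \<Lambda> < 1} \<longleftrightarrow> Y \<omega> \<inter> ?S = {}"
        using Y_compact[OF elim(2)] by (auto simp: size_set_def)
      also have "\<dots> \<longleftrightarrow> card (Y \<omega> \<inter> ?S) = 0" using elim(1) by simp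
      finally show ?case using elim(2) by simp
    qed
  qed
  also have "\<dots> = exp (- (ln 2 * mass))" unfolding void_prob[OF S(1,2)] S(3) ..
  also have "\<dots> = 2 powr (- mass)" by (simp add: powr_def mult.commute)
  finally have "2 powr (- \<alpha>) = 2 powr (- mass)" using \<alpha> by simp
  then have "\<alpha> = mass" by (simp add: powr_inj)
  then show "core_mass Q0 0 = ennreal \<alpha>" "0 \<le> \<alpha>" using core_mass_eq mass_nonneg by auto
qed

text \<open>The slices need a positive depth, chosen so small that its mass is at least \<alpha> -
  \<epsilon>/3. The slice bound with \<epsilon>/3 then has the exponent 2\<epsilon>/3 - mass, at
  most \<epsilon> - \<alpha>.\<close>

lemma cutout_hausdorff_slices:
  fixes Q0 :: "'a::euclidean_space set measure"
  assumes Q0: "sets Q0 = sets compacts" "finite_measure Q0" and diam: "AE K in Q0. diameter K = 1"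
    and fr: "AE K in cutout_intensity Q0. emeasure lborel (frontier K) = 0"
    and pp: "poisson_pp M (cutout_intensity Q0) Y"
    and \<alpha>: "2 powr (- \<alpha>) = measure M {\<omega>\<in>space M.
          (0::'a) \<notin> \<Union>{\<Lambda>\<in>Y \<omega>. 1/2 \<le> diameter \<Lambda> \<and> diameter \<Lambda> < 1}}"
    and k: "1 \<le> k" "k \<le> DIM('a)" and \<alpha>k: "\<alpha> \<le> real k" and \<Omega>: "bounded \<Omega>" and \<epsilon>: "0 < \<epsilon>"
  shows "\<exists>K. K \<in> borel_measurable M \<and>
         (AE \<omega> in M. \<forall>V\<in>affine_planes k. \<forall>n.
            hausdorff_measure k
              (open_nbhd (closure (\<Inter>m. cutout_A \<Omega> Y m \<omega>)) (2 powr (- real n)) \<inter> V)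
            \<le> ennreal (K \<omega> * 2 powr ((\<epsilon> - \<alpha>) * real n)))"
proof -
  note \<alpha>eq = cutout_alpha_eq_core_mass[OF Q0 diam pp \<alpha>]
  have SUP: "(SUP i. core_mass Q0 (rad i)) = ennreal \<alpha>"
    unfolding core_mass_SUP[OF Q0 frontier_null_transfer[OF Q0 fr]] by (rule \<alpha>eq(1))
  obtain i where i: "ennreal (\<alpha> - \<epsilon> / 3) \<le> core_mass Q0 (rad i)"
  proof (cases "\<alpha> - \<epsilon> / 3 < 0")
    \<comment> \<open>\<open>ennreal\<close> sends negative numbers to 0, so any depth will
      do.\<close>
    case True
    then have "ennreal (\<alpha> - \<epsilon> / 3) = 0" by (simp add: ennreal_neg)
    then show ?thesis using that[of 0] by simp
  next
    case False
    then have "ennreal (\<alpha> - \<epsilon> / 3) < (SUP i. core_mass Q0 (rad i))"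
      unfolding SUP using \<epsilon> by (subst ennreal_less_iff) auto
    then obtain i where "ennreal (\<alpha> - \<epsilon> / 3) < core_mass Q0 (rad i)" unfolding less_SUP_iff by blast
    then show ?thesis using that[of i] by (simp add: less_imp_le)
  qed
  interpret cutout M Q0 Y "rad i" by (rule cutout.intro[OF Q0 diam pp less_imp_le[OF rad_pos]])
  have m1: "\<alpha> - \<epsilon> / 3 \<le> mass"
    using i unfolding core_mass_eq by (subst (asm) ennreal_le_iff[OF mass_nonneg])
  have "ennreal mass \<le> ennreal \<alpha>"
    unfolding core_mass_eq[symmetric] \<alpha>eq(1)[symmetric] using rad_pos[of i] by (intro core_mass_antimono[OF Q0(1)]) auto
  then have m2: "mass \<le> \<alpha>" by (subst (asm) ennreal_le_iff[OF \<alpha>eq(2)])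
  obtain D :: "'a set" where D: "D \<subseteq> Basis" "card D = k" using k(2) by (metis obtain_subset_with_card_n)
  have \<epsilon>3: "0 < \<epsilon> / 3" using \<epsilon> by simp
  have D1: "1 \<le> card D" and mD: "mass \<le> real (card D)" using k D m2 \<alpha>k by auto
  obtain K where K: "K \<in> borel_measurable M" "\<forall>\<omega>. 0 \<le> K \<omega>" "AE \<omega> in M. \<forall>V\<in>affine_planes (card D). \<forall>m.
      hausdorff_measure (card D) (open_nbhd (closure (\<Inter>m. cutout_A \<Omega> Y m \<omega>)) (2 powr (- real m)) \<inter> V)
        \<le> ennreal (K \<omega> * 2 powr ((2 * (\<epsilon> / 3) - mass) * real m))"
    using hausdorff_slices[OF rad_pos D(1) D1 mD \<Omega> \<epsilon>3] by (elim bexE conjE)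
  have le: "ennreal (K \<omega> * 2 powr ((2 * (\<epsilon> / 3) - mass) * real n)) \<le> ennreal (K \<omega> * 2 powr ((\<epsilon> - \<alpha>) * real n))" for \<omega> n
    using m1 K(2) by (intro ennreal_leI mult_left_mono powr_mono mult_right_mono) auto
  show ?thesis
  proof (intro exI[of _ K] conjI K(1))
    show "AE \<omega> in M. \<forall>V\<in>affine_planes k. \<forall>n.
            hausdorff_measure k
              (open_nbhd (closure (\<Inter>m. cutout_A \<Omega> Y m \<omega>)) (2 powr (- real n)) \<inter> V)
            \<le> ennreal (K \<omega> * 2 powr ((\<epsilon> - \<alpha>) * real n))"
      using K(3) unfolding D(2) by (rule eventually_mono) (use le order_trans in blast)
  qed
qed

lemma subdivision_hausdorff_slices:
  fixes F0 :: "'a::euclidean_space set"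
  assumes SM: "subdivision_martingale M F0 cells W C" and nf: "non_flat k (\<Union>n. cells n)"
    and comp: "\<exists>C1>0. \<exists>C2>0. \<forall>\<omega>\<in>space M. \<forall>n x.
          C1 * sm_mu cells F0 W n \<omega> x
            \<le> 2 powr (\<alpha> * real n) * indicator {y. sm_mu cells F0 W n \<omega> y \<noteq> 0} x \<and>
          2 powr (\<alpha> * real n) * indicator {y. sm_mu cells F0 W n \<omega> y \<noteq> 0} x
            \<le> C2 * sm_mu cells F0 W n \<omega> x"
    and k: "1 \<le> k" "k \<le> DIM('a)" and \<alpha>k: "\<alpha> < real k"
  shows "\<exists>K. K \<in> borel_measurable M \<and>
         (AE \<omega> in M. \<forall>V\<in>affine_planes k. \<forall>n.
            hausdorff_measure k
              (open_nbhd (closure (\<Inter>m. {y. sm_mu cells F0 W m \<omega> y \<noteq> 0})) (2 powr (- real n)) \<inter> V)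
            \<le> ennreal (K \<omega> * 2 powr (- \<alpha> * real n)))"
proof -
  obtain D :: "'a set" where DB: "D \<subseteq> Basis" "card D = k" using k(2) by (metis obtain_subset_with_card_n)
  from nf obtain \<gamma> Cn where nf': "\<gamma> > 0" "Cn > 0" "\<forall>\<Lambda>\<in>(\<Union>n. cells n). nf_bound k \<gamma> Cn \<Lambda>"
    unfolding non_flat_def by blast
  from comp obtain C1 C2 where comp': "C1 > 0" "C2 > 0" "\<forall>\<omega>\<in>space M. \<forall>n x.
          C1 * sm_mu cells F0 W n \<omega> x
            \<le> 2 powr (\<alpha> * real n) * indicator {y. sm_mu cells F0 W n \<omega> y \<noteq> 0} x \<and>
          2 powr (\<alpha> * real n) * indicator {y. sm_mu cells F0 W n \<omega> y \<noteq> 0} x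
            \<le> C2 * sm_mu cells F0 W n \<omega> x"
    by (elim exE conjE)
  interpret nonflat_subdivision M F0 cells W C D \<alpha> C1 C2 \<gamma> Cn
  proof
    show "nf_bound (card D) \<gamma> Cn \<Lambda>" if "\<Lambda> \<in> cells n" for \<Lambda> n
      using nf'(3) that unfolding DB(2) by blast
  qed (use SM DB k \<alpha>k nf' comp' in simp_all)
  show ?thesis
    by (rule hausdorff_slices) (unfold DB(2), blast)
qed

theorem theorem11p2:
  fixes k :: nat and \<alpha> :: real
    and M1 :: "'w measure" and F0 :: "'a::euclidean_space set" and \<F> :: "nat \<Rightarrow> 'a set set"
    and W :: "nat \<Rightarrow> 'a set \<Rightarrow> 'w \<Rightarrow> real" and C :: real
    and M2 :: "'v measure" and Q0 :: "'a set measure" and Y :: "'v \<Rightarrow> 'a set set"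
    and \<Omega> :: "'a set" and R :: "real \<Rightarrow> 'a set \<Rightarrow> 'a set"
  assumes "1 \<le> k" and "k < DIM('a)" and "\<alpha> < real k"
  shows
    "(subdivision_martingale M1 F0 \<F> W C \<and> non_flat k (\<Union>n. \<F> n) \<and>
      (\<exists>C1>0. \<exists>C2>0. \<forall>\<omega>\<in>space M1. \<forall>n x.
          C1 * sm_mu \<F> F0 W n \<omega> x
            \<le> 2 powr (\<alpha> * real n) * indicator {y. sm_mu \<F> F0 W n \<omega> y \<noteq> 0} x \<and>
          2 powr (\<alpha> * real n) * indicator {y. sm_mu \<F> F0 W n \<omega> y \<noteq> 0} x
            \<le> C2 * sm_mu \<F> F0 W n \<omega> x)
     \<longrightarrow>
      (\<exists>K. K \<in> borel_measurable M1 \<and>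
         (AE \<omega> in M1. \<forall>V\<in>affine_planes k. \<forall>n.
            hausdorff_measure k
              (open_nbhd (closure (\<Inter>m. {y. sm_mu \<F> F0 W m \<omega> y \<noteq> 0})) (2 powr (- real n)) \<inter> V)
            \<le> ennreal (K \<omega> * 2 powr (- \<alpha> * real n)))) \<and>
      (AE \<omega> in M1. \<forall>V\<in>affine_planes k.
         upper_box_dim (V \<inter> closure (\<Inter>m. {y. sm_mu \<F> F0 W m \<omega> y \<noteq> 0})) \<le> ereal (real k - \<alpha>)))
    \<and>
    (prob_space M2 \<and> sets Q0 = sets compacts \<and> finite_measure Q0 \<and>
      (AE \<Lambda> in Q0. diameter \<Lambda> = 1) \<and>
      (AE \<Lambda> in cutout_intensity Q0. emeasure lborel (frontier \<Lambda>) = 0) \<and>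
      poisson_pp M2 (cutout_intensity Q0) Y \<and>
      open \<Omega> \<and> connected \<Omega> \<and> bounded \<Omega> \<and> \<Omega> \<noteq> {} \<and>
      2 powr (- \<alpha>) = measure M2 {\<omega>\<in>space M2.
          (0::'a) \<notin> \<Union>{\<Lambda>\<in>Y \<omega>. 1/2 \<le> diameter \<Lambda> \<and> diameter \<Lambda> < 1}} \<and>
      reg_inner_approx Q0 R \<and>
      (\<exists>\<rho>0>0. \<forall>\<rho>. 0 < \<rho> \<and> \<rho> < \<rho>0 \<longrightarrow>
         (\<exists>\<gamma>0>0. \<exists>C'>0. nf_bound k \<gamma>0 C' \<Omega> \<and> (AE \<Lambda> in Q0. nf_bound k \<gamma>0 C' (R \<rho> \<Lambda>))))
     \<longrightarrow>
      (\<forall>\<epsilon>>0. \<exists>K. K \<in> borel_measurable M2 \<and>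
         (AE \<omega> in M2. \<forall>V\<in>affine_planes k. \<forall>n.
            hausdorff_measure k
              (open_nbhd (closure (\<Inter>m. cutout_A \<Omega> Y m \<omega>)) (2 powr (- real n)) \<inter> V)
            \<le> ennreal (K \<omega> * 2 powr ((\<epsilon> - \<alpha>) * real n)))) \<and>
      (AE \<omega> in M2. \<forall>V\<in>affine_planes k.
         upper_box_dim (V \<inter> closure (\<Inter>m. cutout_A \<Omega> Y m \<omega>)) \<le> ereal (real k - \<alpha>)))"
proof ((rule conjI; rule impI), goal_cases)
  case 1
  note h = 1
  let ?A = "\<lambda>\<omega>. closure (\<Inter>m. {y. sm_mu \<F> F0 W m \<omega> y \<noteq> 0})"
  have kd: "k \<le> DIM('a)" using assms(2) by simp
  have ex: "\<exists>K. K \<in> borel_measurable M1 \<and>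
         (AE \<omega> in M1. \<forall>V\<in>affine_planes k. \<forall>n.
            hausdorff_measure k (open_nbhd (?A \<omega>) (2 powr (- real n)) \<inter> V) \<le> ennreal (K \<omega> * 2 powr (- \<alpha> * real n)))"
    by (rule subdivision_hausdorff_slices[OF h[THEN conjunct1] h[THEN conjunct2, THEN conjunct1]
        h[THEN conjunct2, THEN conjunct2] assms(1) kd assms(3)])
  then obtain K where K: "AE \<omega> in M1. \<forall>V\<in>affine_planes k. \<forall>n.
            hausdorff_measure k (open_nbhd (?A \<omega>) (2 powr (- real n)) \<inter> V) \<le> ennreal (K \<omega> * 2 powr (- \<alpha> * real n))"
    by blast
  have F0: "bounded F0"
    by (rule h[THEN conjunct1, unfolded subdivision_martingale_def, THEN conjunct2, THEN conjunct2, THEN conjunct2, THEN conjunct1])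
  have A: "bounded (?A \<omega>)" for \<omega>
  proof (rule bounded_closure, rule bounded_subset[OF F0], rule subsetI)
    fix x assume "x \<in> (\<Inter>m. {y. sm_mu \<F> F0 W m \<omega> y \<noteq> 0})"
    then have "sm_mu \<F> F0 W 0 \<omega> x \<noteq> 0" by blast
    then show "x \<in> F0" by (simp add: indicator_eq_0_iff)
  qed
  have "AE \<omega> in M1. \<forall>V\<in>affine_planes k. upper_box_dim (V \<inter> ?A \<omega>) \<le> ereal (real k - \<alpha>)"
    using K
  proof eventually_elim
    case (elim \<omega>)
    show ?case
    proof
      fix V :: "'a set" assume V: "V \<in> affine_planes k"
      show "upper_box_dim (V \<inter> ?A \<omega>) \<le> ereal (real k - \<alpha>)"
        by (rule upper_box_dim_le[OF assms(1) kd V A less_imp_le[OF assms(3)]]) (use elim V in blast)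
    qed
  qed
  with ex show ?case by (rule conjI)
next
  case 2
  note h = 2
  let ?A = "\<lambda>\<omega>. closure (\<Inter>m. cutout_A \<Omega> Y m \<omega>)"
  have kd: "k \<le> DIM('a)" using assms(2) by simp
  have Q0: "sets Q0 = sets compacts" "finite_measure Q0" "AE \<Lambda> in Q0. diameter \<Lambda> = 1"
    and fr: "AE \<Lambda> in cutout_intensity Q0. emeasure lborel (frontier \<Lambda>) = 0"
    and pp: "poisson_pp M2 (cutout_intensity Q0) Y" and \<Omega>: "bounded \<Omega>"
    and \<alpha>: "2 powr (- \<alpha>) = measure M2 {\<omega>\<in>space M2.
          (0::'a) \<notin> \<Union>{\<Lambda>\<in>Y \<omega>. 1/2 \<le> diameter \<Lambda> \<and> diameter \<Lambda> < 1}}"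
    by (rule h[THEN conjunct2, THEN conjunct1], rule h[THEN conjunct2, THEN conjunct2, THEN conjunct1], rule h[THEN conjunct2, THEN conjunct2, THEN conjunct2, THEN conjunct1],
      rule h[THEN conjunct2, THEN conjunct2, THEN conjunct2, THEN conjunct2, THEN conjunct1],
      rule h[THEN conjunct2, THEN conjunct2, THEN conjunct2, THEN conjunct2, THEN conjunct2, THEN conjunct1],
      rule h[THEN conjunct2, THEN conjunct2, THEN conjunct2, THEN conjunct2, THEN conjunct2, THEN conjunct2, THEN conjunct2, THEN conjunct2, THEN conjunct1],
      rule h[THEN conjunct2, THEN conjunct2, THEN conjunct2, THEN conjunct2, THEN conjunct2, THEN conjunct2, THEN conjunct2, THEN conjunct2, THEN conjunct2, THEN conjunct2, THEN conjunct1])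
  have ex: "\<exists>K. K \<in> borel_measurable M2 \<and>
         (AE \<omega> in M2. \<forall>V\<in>affine_planes k. \<forall>n.
            hausdorff_measure k (open_nbhd (?A \<omega>) (2 powr (- real n)) \<inter> V) \<le> ennreal (K \<omega> * 2 powr ((\<epsilon> - \<alpha>) * real n)))"
    if "0 < \<epsilon>" for \<epsilon>
    by (rule cutout_hausdorff_slices[OF Q0 fr pp \<alpha> assms(1) kd less_imp_le[OF assms(3)] \<Omega> that])
  have A: "bounded (?A \<omega>)" for \<omega>
    by (rule bounded_closure, rule bounded_subset[OF \<Omega>]) (auto simp: cutout_A_def)
  \<comment> \<open>The exceptional null set depends on \<epsilon>. The choice \<epsilon> =
    \<open>rad i\<close> leaves countably many of them, and i tends to infinity at the end.\<close>
  have box: "AE \<omega> in M2. \<forall>V\<in>affine_planes k. upper_box_dim (V \<inter> ?A \<omega>) \<le> ereal (real k - (\<alpha> - rad i))" for i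
  proof -
    obtain K where K: "AE \<omega> in M2. \<forall>V\<in>affine_planes k. \<forall>n.
            hausdorff_measure k (open_nbhd (?A \<omega>) (2 powr (- real n)) \<inter> V) \<le> ennreal (K \<omega> * 2 powr ((rad i - \<alpha>) * real n))"
      using ex[OF rad_pos[of i]] by blast
    have s: "\<alpha> - rad i \<le> real k" using assms(3) rad_pos[of i] by linarith
    have e: "- (\<alpha> - rad i) = rad i - \<alpha>" by simp
    show ?thesis
      using K
    proof eventually_elim
      case (elim \<omega>)
      show ?case
      proof
        fix V :: "'a set" assume V: "V \<in> affine_planes k"
        show "upper_box_dim (V \<inter> ?A \<omega>) \<le> ereal (real k - (\<alpha> - rad i))"
          by (rule upper_box_dim_le[OF assms(1) kd V A s], unfold e) (use elim V in blast)
      qed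
    qed
  qed
  have box': "AE \<omega> in M2. \<forall>i. \<forall>V\<in>affine_planes k. upper_box_dim (V \<inter> ?A \<omega>) \<le> ereal (real k - (\<alpha> - rad i))"
    unfolding AE_all_countable by (intro allI box)
  have "AE \<omega> in M2. \<forall>V\<in>affine_planes k. upper_box_dim (V \<inter> ?A \<omega>) \<le> ereal (real k - \<alpha>)"
    using box'
  proof eventually_elim
    case (elim \<omega>)
    show ?case
    proof
      fix V :: "'a set" assume V: "V \<in> affine_planes k"
      show "upper_box_dim (V \<inter> ?A \<omega>) \<le> ereal (real k - \<alpha>)"
      proof (rule ereal_le_epsilon2)
        fix e :: real assume "0 < e"
        then obtain i where "rad i < e" using rad_small by blast
        then have "ereal (real k - (\<alpha> - rad i)) \<le> ereal (real k - \<alpha>) + ereal e" by simp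
        moreover have "upper_box_dim (V \<inter> ?A \<omega>) \<le> ereal (real k - (\<alpha> - rad i))" using elim V by blast
        ultimately show "upper_box_dim (V \<inter> ?A \<omega>) \<le> ereal (real k - \<alpha>) + ereal e" by (rule order_trans[rotated])
      qed
    qed
  qed
  moreover have "\<forall>\<epsilon>>0. \<exists>K. K \<in> borel_measurable M2 \<and>
         (AE \<omega> in M2. \<forall>V\<in>affine_planes k. \<forall>n.
            hausdorff_measure k (open_nbhd (?A \<omega>) (2 powr (- real n)) \<inter> V) \<le> ennreal (K \<omega> * 2 powr ((\<epsilon> - \<alpha>) * real n)))"
    using ex by blast
  ultimately show ?case by (intro conjI)
qed

end
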